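(* Let $d$ be a positive integer. Let $k$ be a field, $A = k[x_1,\ldots,x_n]$, and let $R = A/I$ be a monomial ring with a minimal Taylor resolution. Assume that $|G(I)| = t$ with $d \le t$, and that there exists a total ordering $m_1 \prec m_2 \prec \cdots \prec m_t$ on $G(I)$ such that $\gcd(m_i, m_{i+1}, \ldots, m_{i+d-1}) \neq 1$ and $\gcd(m_i, m_{i+d+j}) = 1$ for any $j \geq 0$ (with $i+d+j \le t$) and $i = 1,\ldots,t-d$. Consider the collection $$\mathcal{B} = \{\emptyset \ne S \subseteq \mathbb{N}_t \mid \text{any two consecutive numbers in } S \text{ differ at most by } d-1\}.$$ Then: 1. The minimal generating set of the homology $H(K^R)$ of $K^R$ is $\{X_S \mid S \in \mathcal{B}\}$, that is, $H(K^R) = k(X_S)_{S \in \mathcal{B}}/J$, where $J$ is the ideal $$J = \bigl(X_{S_1}\cdots X_{S_l} \;\big|\; \text{each } S_i \in \mathcal{B},\ S_i \cup S_j \notin \mathcal{B} \text{ for all } i,j \in \mathbb{N}_l, \text{ and } S_i \cap S_j \neq \emptyset \text{ for some } i,j \in \mathbb{N}_l\bigr).$$ 2. For any non-empty set $S \subseteq \mathbb{N}_t$ there exists a partition $S_1,\ldots,S_l$ of $S$ such that each $S_j \in \mathcal{B}$ and $S_i \cup S_j \notin \mathcal{B}$ for $i \ne j$. Put $m = |S|$ (so $m = n_1 + \cdots + n_l$ when the partition has weight $(n_1,\ldots,n_l)$). Then the Hilbert series of $H(K^R)$ is $$\mathrm{Hilb}(H(K^R))(X,Y) = \sum_{(n_1,\ldots,n_l)}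 f(n_1,\ldots,n_l)\, X^l Y^m,$$ where $f(n_1,\ldots,n_l)$ is the number of subsets of $\mathbb{N}_t$ whose $d$-partition has the given length $l \le t$ and weight $(n_1,\ldots,n_l) \in \mathbb{Z}_{>0}^l$ (the empty sequence, $l = 0$, contributing the constant term $1$).
   Context: $\mathbb{N}_r = \{1,\ldots,r\}$ for a positive integer $r$, and $|S|$ is the cardinality of a set $S$. A monomial ring is a quotient $R = A/I$ of $A = k[x_1,\ldots,x_n]$ by a monomial ideal $I$; $G(I) = \{m_1,\ldots,m_t\}$ is the unique minimal set of monomial generators of $I$. For $i_1 < \cdots < i_l$ in $\mathbb{N}_t$ put $m_{i_1,\ldots,i_l} = \operatorname{lcm}(m_{i_1},\ldots,m_{i_l})$. The Taylor resolution of $R$ is the exterior algebra of a free $A$-module of rank $t$, with basis $e_{i_1,\ldots,i_l}$ and differential $d(e_{i_1,\ldots,i_l}) = \sum_{j=1}^l (-1)^{j-1}\frac{m_{i_1,\ldots,i_l}}{m_{i_1,\ldots,\hat{i}_j,\ldots,i_l}} e_{i_1,\ldots,\hat{i}_j,\ldots,i_l}$ (here $d$ denotes the differential, not the integer). It is minimal if and only if $m_{i_1,\ldots,i_l} \ne m_{i_1,\ldots,\hat{i}_j,\ldots,i_l}$ always; equivalently, for each $i$ there is a variable $x_{v(i)}$ whose exponent in $m_i$ is strictly larger than its exponent in every other $m_j$. $K^R$ is the Koszul complex of $R$ on the images of $x_1,\ldots,x_n$, i.e. the exterior algebra over $R$ on generators $T_1,\ldots,T_n$ with $T_i \mapsto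 x_i$ under the differential, and $H(K^R)$ is its homology algebra. Fix a choice of $x_{v(i)}$ for each $i$. For non-empty $S = \{i_1 < \cdots < i_l\} \subseteq \mathbb{N}_t$ let $$f_S = \frac{\operatorname{lcm}(m_{i_1},\ldots,m_{i_l})}{x_{v(i_1)}\cdots x_{v(i_l)}}\, T_{v(i_1)}\cdots T_{v(i_l)},$$ and let $\bar f_S$ be its homology class; these classes, together with $1$, form a $k$-basis of $H(K^R)$. The variable $X_S$ corresponds to $\bar f_S$, and $k(X_S)_{S\in\mathcal{B}}$ denotes the free graded-commutative $k$-algebra on the variables $X_S$, with $X_S$ of homological degree $|S|$. $H(K^R)$ is considered as a bigraded algebra by polynomial degree (number of factors $X_S$, recorded by $X$) and total degree (homological degree, recorded by $Y$), so that $X_S$ with $S \in \mathcal{B}$ has bidegree $(1,|S|)$; $\mathrm{Hilb}(H(K^R))(X,Y)$ is the corresponding bigraded Hilbert series. A strictly ordered partition of a finite totally ordered set $S$ is a sequence $(S_1,\ldots,S_l)$ of non-empty subsets partitioning $S$ with $\max(S_i) < \min(S_{i+1})$ for $i = 1,\ldots,l-1$; $l$ is its length and $(|S_1|,\ldots,|S_l|)$ its weight. For non-empty $S \subseteq \mathbb{N}_t$, the $d$-partition of $S$ is the strictly ordered partition $(S_1,\ldots,S_l)$ of $S$ such that any two consecutive numbers in each $S_i$ differ at most by $d-1$, and $\min(S_{j+1}) - \max(S_j) \ge d$ for $j = 1,\ldots,l-1$.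
   Formalization: J as printed is wrong (it is 0 or contains every X_S); here J is generated by the products with S_i ∪ S_j ∈ B or S_i ∩ S_j ≠ ∅ for some i ≠ j. The condition gcd(m_i,…,m_{i+d-1}) ≠ 1 is required for i = 1,…,t-d+1. *)

theory Defs
  imports
    "HOL-Algebra.Algebra"
    "HOL-Algebra.Algebraic_Closure_Type"
    "HOL-Library.Poly_Mapping"
    "HOL-Library.Disjoint_Sets"
    "HOL-Computational_Algebra.Formal_Power_Series"
begin

section \<open>Polynomial rings and monomial ideals\<close>

text \<open>
  The variables are indexed by a type \<open>'n\<close> of class finite and linorder, so that
  \<open>('n, 'k) mpoly\<close> is \<open>k[x\<^sub>1, \<dots>, x\<^sub>n]\<close> with \<open>n = CARD('n)\<close>. A monomial is
  represented by its exponent vector; in particular the monomial \<open>1\<close> is the vector \<open>0\<close>, and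
  quotients of monomials are differences of exponent vectors.
\<close>

type_synonym 'n mono = "'n \<Rightarrow>\<^sub>0 nat"
type_synonym ('n, 'k) mpoly = "'n mono \<Rightarrow>\<^sub>0 'k"

definition poly_ring :: "('n, 'k::field) mpoly ring"
  where "poly_ring = ring_of_type_algebra"

definition mono_poly :: "'n mono \<Rightarrow> ('n, 'k::field) mpoly"
  where "mono_poly u = Poly_Mapping.single u 1"

definition var :: "'n \<Rightarrow> ('n, 'k::field) mpoly"
  where "var x = mono_poly (Poly_Mapping.single x 1)"

definition const_poly :: "'k \<Rightarrow> ('n, 'k::field) mpoly"
  where "const_poly c = Poly_Mapping.single 0 c"

definition irrelevant_ideal :: "('n, 'k::field) mpoly set"
  where "irrelevant_ideal = Idl\<^bsub>poly_ring\<^esub> (range var)"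

definition monomial_ideal :: "('n, 'k::field) mpoly set \<Rightarrow> bool"
  where "monomial_ideal I \<longleftrightarrow> (\<exists>M. I = Idl\<^bsub>poly_ring\<^esub> (mono_poly ` M))"

definition min_mono_gens :: "('n, 'k::field) mpoly set \<Rightarrow> 'n mono set \<Rightarrow> bool"
  where "min_mono_gens I G \<longleftrightarrow>
    Idl\<^bsub>poly_ring\<^esub> (mono_poly ` G) = I \<and> (\<forall>G'. G' \<subset> G \<longrightarrow> Idl\<^bsub>poly_ring\<^esub> (mono_poly ` G') \<noteq> I)"

text \<open>Least common multiple and greatest common divisor of \<open>m i\<close> for \<open>i \<in> S\<close>, with \<open>S\<close> finite;
  the lcm over the empty set is \<open>1\<close>, and the gcd is only used for non-empty \<open>S\<close>.\<close>

definition mono_lcm :: "(nat \<Rightarrow> 'n::finite mono) \<Rightarrow> nat set \<Rightarrow> 'n mono"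
  where "mono_lcm m S =
    Abs_poly_mapping (\<lambda>x. Max (insert 0 ((\<lambda>i. Poly_Mapping.lookup (m i) x) ` S)))"

definition mono_gcd :: "(nat \<Rightarrow> 'n::finite mono) \<Rightarrow> nat set \<Rightarrow> 'n mono"
  where "mono_gcd m S =
    Abs_poly_mapping (\<lambda>x. Min ((\<lambda>i. Poly_Mapping.lookup (m i) x) ` S))"


section \<open>The Taylor resolution\<close>

text \<open>An element of the Taylor complex is its family of coefficients \<open>c S\<close> at the basis elements
  \<open>e\<^sub>S\<close>, \<open>S \<subseteq> {1..t}\<close>. The first function gives the coefficient of \<open>e\<^sub>U\<close> in \<open>d e\<^sub>S\<close>; if
  \<open>i\<close> is the \<open>j\<close>-th element of \<open>S\<close>, then \<open>card {k \<in> S. k < i} = j - 1\<close>.\<close>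

definition taylor_coeff ::
    "(nat \<Rightarrow> 'n::finite mono) \<Rightarrow> nat set \<Rightarrow> nat set \<Rightarrow> ('n, 'k::field) mpoly"
  where "taylor_coeff m S U =
    (\<Sum>i\<in>{i \<in> S. U = S - {i}}.
      (- 1) ^ card {k \<in> S. k < i} * mono_poly (mono_lcm m S - mono_lcm m (S - {i})))"

definition taylor_diff ::
    "(nat \<Rightarrow> 'n::finite mono) \<Rightarrow> nat \<Rightarrow> (nat set \<Rightarrow> ('n, 'k::field) mpoly)
      \<Rightarrow> (nat set \<Rightarrow> ('n, 'k) mpoly)"
  where "taylor_diff m t c = (\<lambda>U. \<Sum>S\<in>Pow {1..t}. c S * taylor_coeff m S U)"

text \<open>Minimality of the complex \<open>F\<close>: \<open>d F \<subseteq> (x\<^sub>1, \<dots>, x\<^sub>n) F\<close>. The type of coefficients is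
  passed explicitly because it is not determined by the monomials.\<close>

definition taylor_minimal :: "'k::field itself \<Rightarrow> (nat \<Rightarrow> 'n::finite mono) \<Rightarrow> nat \<Rightarrow> bool"
  where "taylor_minimal _ m t \<longleftrightarrow>
    (\<forall>c :: nat set \<Rightarrow> ('n, 'k) mpoly. \<forall>U\<in>Pow {1..t}. taylor_diff m t c U \<in> irrelevant_ideal)"


section \<open>The Koszul complex and its homology algebra\<close>

definition signed :: "('r, 'b) ring_scheme \<Rightarrow> nat \<Rightarrow> 'r \<Rightarrow> 'r"
  where "signed R e r = (if even e then r else \<ominus>\<^bsub>R\<^esub> r)"

text \<open>The exterior algebra over a commutative ring \<open>R\<close> on generators \<open>T\<^sub>x\<close>, \<open>x :: 'n\<close>. The element
  \<open>f\<close> stands for the sum of the \<open>f W \<cdot> T\<^sub>W\<close>, where \<open>T\<^sub>W\<close> is the product of the \<open>T\<^sub>x\<close>, \<open>x \<in> W\<close>, in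
  increasing order; the sign of \<open>T\<^sub>U T\<^sub>V = \<plusminus> T\<^bsub>U \<union> V\<^esub>\<close> counts the inversions.\<close>

definition ext_ring :: "('r, 'b) ring_scheme \<Rightarrow> ('n::{finite,linorder} set \<Rightarrow> 'r) ring"
  where "ext_ring R = \<lparr>
    carrier = {f. \<forall>W. f W \<in> carrier R},
    monoid.mult = (\<lambda>f g W. finsum R
      (\<lambda>U. signed R (card {(u, v). u \<in> U \<and> v \<in> W - U \<and> v < u}) (f U \<otimes>\<^bsub>R\<^esub> g (W - U))) (Pow W)),
    one = (\<lambda>W. if W = {} then \<one>\<^bsub>R\<^esub> else \<zero>\<^bsub>R\<^esub>),
    ring.zero = (\<lambda>W. \<zero>\<^bsub>R\<^esub>),
    add = (\<lambda>f g W. f W \<oplus>\<^bsub>R\<^esub> g W) \<rparr>"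

definition ext_const :: "('r, 'b) ring_scheme \<Rightarrow> 'r \<Rightarrow> 'n set \<Rightarrow> 'r"
  where "ext_const R r = (\<lambda>W. if W = {} then r else \<zero>\<^bsub>R\<^esub>)"

definition ext_gen :: "('r, 'b) ring_scheme \<Rightarrow> 'n \<Rightarrow> 'n set \<Rightarrow> 'r"
  where "ext_gen R x = (\<lambda>W. if W = {x} then \<one>\<^bsub>R\<^esub> else \<zero>\<^bsub>R\<^esub>)"

text \<open>The coefficient at \<open>T\<^sub>W\<close> of the image of \<open>f\<close> under the derivation \<open>T\<^sub>w \<mapsto> xs w\<close>.\<close>

definition koszul_diff ::
    "('r, 'b) ring_scheme \<Rightarrow> ('n::{finite,linorder} \<Rightarrow> 'r) \<Rightarrow> ('n set \<Rightarrow> 'r) \<Rightarrow> ('n set \<Rightarrow> 'r)"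
  where "koszul_diff R xs f = (\<lambda>W. finsum R
    (\<lambda>w. signed R (card {u \<in> W. u < w}) (xs w \<otimes>\<^bsub>R\<^esub> f (insert w W))) (- W))"

definition homology_ring :: "('c, 'b) ring_scheme \<Rightarrow> ('c \<Rightarrow> 'c) \<Rightarrow> 'c set ring"
  where "homology_ring K \<delta> =
    (K \<lparr>carrier := {z \<in> carrier K. \<delta> z = \<zero>\<^bsub>K\<^esub>}\<rparr>) Quot (\<delta> ` carrier K)"

definition homology_class :: "('c, 'b) ring_scheme \<Rightarrow> ('c \<Rightarrow> 'c) \<Rightarrow> 'c \<Rightarrow> 'c set"
  where "homology_class K \<delta> z = (\<delta> ` carrier K) +>\<^bsub>K\<^esub> z"

definition ring_prod :: "('r, 'b) ring_scheme \<Rightarrow> 'r list \<Rightarrow> 'r"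
  where "ring_prod R as = foldr (\<lambda>a b. a \<otimes>\<^bsub>R\<^esub> b) as \<one>\<^bsub>R\<^esub>"

text \<open>The case of \<open>R = k[x\<^sub>1, \<dots>, x\<^sub>n]/I\<close>.\<close>

definition quot_ring :: "('n, 'k::field) mpoly set \<Rightarrow> ('n, 'k) mpoly set ring"
  where "quot_ring I = poly_ring Quot I"

definition quot_cls :: "('n, 'k::field) mpoly set \<Rightarrow> ('n, 'k) mpoly \<Rightarrow> ('n, 'k) mpoly set"
  where "quot_cls I p = I +>\<^bsub>poly_ring\<^esub> p"

type_synonym ('n, 'k) koszul = "'n set \<Rightarrow> ('n, 'k) mpoly set"

definition koszul_ring :: "('n::{finite,linorder}, 'k::field) mpoly set \<Rightarrow> ('n, 'k) koszul ring"
  where "koszul_ring I = ext_ring (quot_ring I)"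

definition koszul_d ::
    "('n::{finite,linorder}, 'k::field) mpoly set \<Rightarrow> ('n, 'k) koszul \<Rightarrow> ('n, 'k) koszul"
  where "koszul_d I = koszul_diff (quot_ring I) (\<lambda>x. quot_cls I (var x))"

definition HK :: "('n::{finite,linorder}, 'k::field) mpoly set \<Rightarrow> ('n, 'k) koszul set ring"
  where "HK I = homology_ring (koszul_ring I) (koszul_d I)"

definition HK_scalar ::
    "('n::{finite,linorder}, 'k::field) mpoly set \<Rightarrow> 'k \<Rightarrow> ('n, 'k) koszul set"
  where "HK_scalar I c = homology_class (koszul_ring I) (koszul_d I)
    (ext_const (quot_ring I) (quot_cls I (const_poly c)))"

text \<open>The element \<open>f\<^sub>S\<close> and its class.\<close>

definition koszul_f :: "('n::{finite,linorder}, 'k::field) mpoly set \<Rightarrow> (nat \<Rightarrow> 'n mono)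
    \<Rightarrow> (nat \<Rightarrow> 'n) \<Rightarrow> nat set \<Rightarrow> ('n, 'k) koszul"
  where "koszul_f I m v S =
    ext_const (quot_ring I)
      (quot_cls I (mono_poly (mono_lcm m S - (\<Sum>i\<in>S. Poly_Mapping.single (v i) 1))))
    \<otimes>\<^bsub>koszul_ring I\<^esub>
    ring_prod (koszul_ring I) (map (\<lambda>i. ext_gen (quot_ring I) (v i)) (sorted_list_of_set S))"

definition HK_f :: "('n::{finite,linorder}, 'k::field) mpoly set \<Rightarrow> (nat \<Rightarrow> 'n mono)
    \<Rightarrow> (nat \<Rightarrow> 'n) \<Rightarrow> nat set \<Rightarrow> ('n, 'k) koszul set"
  where "HK_f I m v S = homology_class (koszul_ring I) (koszul_d I) (koszul_f I m v S)"


section \<open>Free graded-commutative algebras\<close>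

text \<open>The free associative algebra on a set \<open>B\<close> of letters; words are lists.\<close>

definition free_alg :: "'x set \<Rightarrow> ('x list \<Rightarrow>\<^sub>0 'k::field) ring"
  where "free_alg B = \<lparr>
    carrier = {p. Poly_Mapping.keys p \<subseteq> lists B},
    monoid.mult = (\<lambda>p q. \<Sum>u\<in>Poly_Mapping.keys p. \<Sum>w\<in>Poly_Mapping.keys q.
      Poly_Mapping.single (u @ w) (Poly_Mapping.lookup p u * Poly_Mapping.lookup q w)),
    one = Poly_Mapping.single [] 1,
    ring.zero = 0,
    add = (+) \<rparr>"

text \<open>Graded commutativity is understood in the strict sense, i.e. odd elements have square zero in
  every characteristic.\<close>

definition gc_relations :: "'x set \<Rightarrow> ('x \<Rightarrow> nat) \<Rightarrow> ('x list \<Rightarrow>\<^sub>0 'k::field) set"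
  where "gc_relations B dg =
    {Poly_Mapping.single [a, b] 1 - Poly_Mapping.single [b, a] ((- 1) ^ (dg a * dg b)) |
      a b. a \<in> B \<and> b \<in> B} \<union>
    {Poly_Mapping.single [a, a] 1 | a. a \<in> B \<and> odd (dg a)}"

definition gc_ideal :: "'x set \<Rightarrow> ('x \<Rightarrow> nat) \<Rightarrow> ('x list \<Rightarrow>\<^sub>0 'k::field) set"
  where "gc_ideal B dg = Idl\<^bsub>free_alg B\<^esub> (gc_relations B dg)"

definition free_gc_alg :: "'x set \<Rightarrow> ('x \<Rightarrow> nat) \<Rightarrow> ('x list \<Rightarrow>\<^sub>0 'k::field) set ring"
  where "free_gc_alg B dg = free_alg B Quot gc_ideal B dg"

definition gc_var :: "'x set \<Rightarrow> ('x \<Rightarrow> nat) \<Rightarrow> 'x \<Rightarrow> ('x list \<Rightarrow>\<^sub>0 'k::field) set"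
  where "gc_var B dg a = gc_ideal B dg +>\<^bsub>free_alg B\<^esub> Poly_Mapping.single [a] 1"

definition gc_scalar :: "'x set \<Rightarrow> ('x \<Rightarrow> nat) \<Rightarrow> 'k \<Rightarrow> ('x list \<Rightarrow>\<^sub>0 'k::field) set"
  where "gc_scalar B dg c = gc_ideal B dg +>\<^bsub>free_alg B\<^esub> Poly_Mapping.single [] c"


section \<open>The collection of subsets and the ideal of relations\<close>

definition gaps_lt :: "nat \<Rightarrow> nat set \<Rightarrow> bool"
  where "gaps_lt d S \<longleftrightarrow>
    (\<forall>a\<in>S. \<forall>b\<in>S. a < b \<and> {a<..<b} \<inter> S = {} \<longrightarrow> b - a \<le> d - 1)"

definition BB :: "nat \<Rightarrow> nat \<Rightarrow> nat set set"
  where "BB d t = {S. S \<noteq> {} \<and> S \<subseteq> {1..t} \<and> gaps_lt d S}"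

text \<open>Two members of \<open>BB d t\<close> that meet have their union in \<open>BB d t\<close>. So the generators are exactly
  the products violating the condition that all unions of two different factors lie outside
  \<open>BB d t\<close>; the second disjunct is implied by the first one.\<close>

definition rel_ideal :: "nat \<Rightarrow> nat \<Rightarrow> (nat set list \<Rightarrow>\<^sub>0 'k::field) set set"
  where "rel_ideal d t = Idl\<^bsub>free_gc_alg (BB d t) card\<^esub>
    {ring_prod (free_gc_alg (BB d t) card) (map (gc_var (BB d t) card) Ss) | Ss.
      set Ss \<subseteq> BB d t \<and>
      (\<exists>i < length Ss. \<exists>j < length Ss. i \<noteq> j \<and>
        (Ss ! i \<union> Ss ! j \<in> BB d t \<or> Ss ! i \<inter> Ss ! j \<noteq> {}))}"


section \<open>Strictly ordered partitions and d-partitions\<close>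

definition strictly_ordered_partition :: "nat set \<Rightarrow> nat set list \<Rightarrow> bool"
  where "strictly_ordered_partition S P \<longleftrightarrow>
    {} \<notin> set P \<and> \<Union> (set P) = S \<and>
    (\<forall>i < length P. \<forall>j < length P. i \<noteq> j \<longrightarrow> P ! i \<inter> P ! j = {}) \<and>
    (\<forall>i. Suc i < length P \<longrightarrow> Max (P ! i) < Min (P ! Suc i))"

definition d_partition :: "nat \<Rightarrow> nat set \<Rightarrow> nat set list \<Rightarrow> bool"
  where "d_partition d S P \<longleftrightarrow>
    strictly_ordered_partition S P \<and>
    (\<forall>T\<in>set P. gaps_lt d T) \<and>
    (\<forall>j. Suc j < length P \<longrightarrow> Max (P ! j) + d \<le> Min (P ! Suc j))"

text \<open>The weight of a partition also determines its length. The empty list is the \<open>d\<close>-partition of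
  the empty set.\<close>

definition weight_count :: "nat \<Rightarrow> nat \<Rightarrow> nat list \<Rightarrow> nat"
  where "weight_count d t ns = card {S. S \<subseteq> {1..t} \<and> (\<exists>P. d_partition d S P \<and> map card P = ns)}"


section \<open>Bigraded algebras and Hilbert series\<close>

text \<open>In the library, \<^locale>\<open>subalgebra\<close> means \<open>K\<close>-linear subspace.\<close>

definition lin_span :: "('r, 'b) ring_scheme \<Rightarrow> 'r set \<Rightarrow> 'r set \<Rightarrow> 'r set"
  where "lin_span H K G = \<Inter> {V. subalgebra K V H \<and> G \<subseteq> V}"

definition bigraded_algebra ::
    "('r, 'b) ring_scheme \<Rightarrow> 'r set \<Rightarrow> (nat \<Rightarrow> nat \<Rightarrow> 'r set) \<Rightarrow> bool"
  where "bigraded_algebra H K V \<longleftrightarrow>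
    (\<forall>l m. subalgebra K (V l m) H) \<and>
    \<one>\<^bsub>H\<^esub> \<in> V 0 0 \<and>
    (\<forall>l m l' m'. \<forall>a\<in>V l m. \<forall>b\<in>V l' m'. a \<otimes>\<^bsub>H\<^esub> b \<in> V (l + l') (m + m')) \<and>
    (\<forall>h\<in>carrier H. \<exists>!c. (\<forall>l m. c (l, m) \<in> V l m) \<and> finite {p. c p \<noteq> \<zero>\<^bsub>H\<^esub>} \<and>
      h = finsum H c {p. c p \<noteq> \<zero>\<^bsub>H\<^esub>})"

text \<open>\<open>X\<close> is the outer and \<open>Y\<close> the inner formal variable.\<close>

definition Hilb :: "('r, 'b) ring_scheme \<Rightarrow> 'r set \<Rightarrow> (nat \<Rightarrow> nat \<Rightarrow> 'r set) \<Rightarrow> int fps fps"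
  where "Hilb H K V = Abs_fps (\<lambda>l. Abs_fps (\<lambda>m. int (ring.dim H K (V l m))))"

definition XX :: "int fps fps" where "XX = fps_X"

definition YY :: "int fps fps" where "YY = fps_const fps_X"

definition HK_bidegree :: "('n::{finite,linorder}, 'k::field) mpoly set \<Rightarrow> (nat \<Rightarrow> 'n mono)
    \<Rightarrow> (nat \<Rightarrow> 'n) \<Rightarrow> nat \<Rightarrow> nat \<Rightarrow> nat \<Rightarrow> nat \<Rightarrow> ('n, 'k) koszul set set"
  where "HK_bidegree I m v d t l p = lin_span (HK I) (range (HK_scalar I))
    {ring_prod (HK I) (map (HK_f I m v) Ss) | Ss.
      set Ss \<subseteq> BB d t \<and> length Ss = l \<and> sum_list (map card Ss) = p}"

end

theory Submission
  imports Defs "HOL-Library.Function_Algebras"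
begin

text \<open>
  The homology of the Koszul complex is computed in each multidegree separately. In multidegree
  \<open>u\<close> the complex has the basis \<open>x\<^sup>u\<^sup>-\<^sup>W T\<^sub>W\<close>, where \<open>W\<close> runs through the sets of variables dividing
  \<open>x\<^sup>u\<close> with \<open>x\<^sup>u\<^sup>-\<^sup>W \<notin> I\<close>. For a generator \<open>m\<^sub>i\<close> dividing \<open>x\<^sup>u\<close> let \<open>A\<^sub>i\<close> be the set of variables
  of \<open>x\<^sup>u\<close> at which \<open>m\<^sub>i\<close> attains the exponent of \<open>u\<close>; then the condition says that \<open>W\<close> meets every
  \<open>A\<^sub>i\<close>. If some variable of \<open>x\<^sup>u\<close> lies in no \<open>A\<^sub>i\<close>, adding and removing it contracts the complex.
  Otherwise \<open>u\<close> is the exponent of \<open>lcm {m\<^sub>i}\<close>, and \<open>v i\<close> lies in \<open>A\<^sub>i\<close> and in no other \<open>A\<^sub>j\<close>. If \<open>W\<close>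
  contains a further variable \<open>x \<in> A\<^sub>i\<close>, then \<open>W\<close> meets \<open>A\<^sub>i\<close> with or without \<open>v i\<close>, so adding and removing \<open>v i\<close>
  contracts the part of the complex that involves \<open>x\<close>. Only \<open>W = {v i}\<close> survives. Hence the classes
  of the \<open>f\<^sub>S\<close>, \<open>S \<subseteq> {1..t}\<close>, form a \<open>k\<close>-basis of the homology (\<open>taylor_cycles_span\<close> and
  \<open>taylor_cycles_independent\<close>).

  The products of the basis elements are determined by divisibility. If \<open>S\<close> precedes \<open>T\<close> and \<open>m\<^sub>i\<close>, \<open>m\<^sub>j\<close>
  are coprime for all \<open>i \<in> S\<close>, \<open>j \<in> T\<close>, then \<open>f\<^sub>S f\<^sub>T = f\<^bsub>S \<union> T\<^esub>\<close> already in the complex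
  (\<open>koszul_cycle_concat\<close>). If some variable divides both \<open>m\<^sub>i\<close> and \<open>m\<^sub>j\<close> for one such pair, then
  \<open>f\<^sub>S f\<^sub>T\<close> is a boundary (\<open>koszul_cycle_product_boundary\<close>). The hypotheses on the greatest common
  divisors say that \<open>m\<^sub>i\<close> and \<open>m\<^sub>j\<close> are coprime exactly if \<open>i\<close> and \<open>j\<close> differ by at least \<open>d\<close>, and
  two members of \<open>BB d t\<close> either lie apart by at least \<open>d\<close> or contain indices closer than \<open>d\<close>; the
  second case is precisely the one in which their product is a relation.

  What remains is formal (locale \<open>taylor_homology\<close>). Every \<open>f\<^sub>S\<close> is the product of the \<open>f\<^sub>T\<close> over the
  blocks \<open>T\<close> of the \<open>d\<close>-partition of \<open>S\<close>, so the \<open>f\<^sub>T\<close> with \<open>T \<in> BB d t\<close> generate. A word in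
  the variables \<open>X\<^sub>T\<close> either contains two close letters, and is then a relation, or is a rearrangement of
  the \<open>d\<close>-partition of the union of its letters (\<open>mset_dpart_if_not_close\<close>). So the presented
  algebra is spanned by the \<open>d\<close>-partitions of the subsets of \<open>{1..t}\<close>, which are mapped to the
  basis \<open>f\<^sub>S\<close>; therefore the presentation is faithful. The same normal form shows that no generator
  can be omitted and that the part of bidegree \<open>(l, p)\<close> has as a basis the \<open>f\<^sub>S\<close> with \<open>|S| = p\<close> whose
  \<open>d\<close>-partition has \<open>l\<close> blocks. Counting these sets gives the Hilbert series.
\<close>

section \<open>Exterior algebras and their differentials\<close>

text \<open>The sign in \<open>T\<^sub>U T\<^sub>V = \<plusminus> T\<^bsub>U \<union> V\<^esub>\<close>. It takes values in an arbitrary ring because the same sign is used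
over the polynomial ring and over its coefficient field.\<close>

definition inv_sign :: "'n::{finite,linorder} set \<Rightarrow> 'n set \<Rightarrow> 'r::comm_ring_1"
  where "inv_sign U V = (- 1) ^ card {(u, v). u \<in> U \<and> v \<in> V \<and> v < u}"

lemma inv_sign_empty [simp]: "inv_sign {} V = 1" "inv_sign U {} = 1"
  by (simp_all add: inv_sign_def)

lemma inv_sign_square [simp]: "inv_sign U V * inv_sign U V = (1 :: 'r::comm_ring_1)"
  by (simp add: inv_sign_def flip: power_mult_distrib)

lemma inv_sign_square_left [simp]: "inv_sign U V * (inv_sign U V * x) = (x :: 'r::comm_ring_1)"
  by (simp flip: mult.assoc)

lemma inv_sign_Un_left:
  assumes "U \<inter> U' = {}"
  shows "inv_sign (U \<union> U') V = inv_sign U V * inv_sign U' V"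
proof -
  have "{(u, v). u \<in> U \<union> U' \<and> v \<in> V \<and> v < u} =
      {(u, v). u \<in> U \<and> v \<in> V \<and> v < u} \<union> {(u, v). u \<in> U' \<and> v \<in> V \<and> v < u}"
    by auto
  moreover have "{(u, v). u \<in> U \<and> v \<in> V \<and> v < u} \<inter> {(u, v). u \<in> U' \<and> v \<in> V \<and> v < u} = {}"
    using assms by auto
  ultimately show ?thesis
    by (simp add: inv_sign_def card_Un_disjoint power_add)
qed

lemma inv_sign_Un_right:
  assumes "V \<inter> V' = {}"
  shows "inv_sign U (V \<union> V') = inv_sign U V * inv_sign U V'"
proof -
  have "{(u, v). u \<in> U \<and> v \<in> V \<union> V' \<and> v < u} =
      {(u, v). u \<in> U \<and> v \<in> V \<and> v < u} \<union> {(u, v). u \<in> U \<and> v \<in> V' \<and> v < u}"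
    by auto
  moreover have "{(u, v). u \<in> U \<and> v \<in> V \<and> v < u} \<inter> {(u, v). u \<in> U \<and> v \<in> V' \<and> v < u} = {}"
    using assms by auto
  ultimately show ?thesis
    by (simp add: inv_sign_def card_Un_disjoint power_add)
qed

lemma inv_sign_insert_left:
  "w \<notin> U \<Longrightarrow> inv_sign (insert w U) V = inv_sign {w} V * inv_sign U V"
  using inv_sign_Un_left[of "{w}" U V] by simp

lemma inv_sign_insert_right:
  "w \<notin> V \<Longrightarrow> inv_sign U (insert w V) = inv_sign U {w} * inv_sign U V"
  using inv_sign_Un_right[of "{w}" V U] by simp

lemma inv_sign_swap:
  assumes "U \<inter> V = {}"
  shows "inv_sign U V = (- 1) ^ (card U * card V) * (inv_sign V U :: 'r::comm_ring_1)"
proof -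
  let ?A = "{(u, v). u \<in> U \<and> v \<in> V \<and> v < u}" and ?B = "{(u, v). u \<in> U \<and> v \<in> V \<and> u < v}"
  have "U \<times> V = ?A \<union> ?B" "?A \<inter> ?B = {}"
    using assms by auto
  then have "card (U \<times> V) = card ?A + card ?B"
    by (simp only: card_Un_disjoint[OF finite finite])
  then have "card U * card V = card ?A + card ?B"
    by simp
  moreover have "card ?B = card {(v, u). v \<in> V \<and> u \<in> U \<and> u < v}"
    by (rule bij_betw_same_card[of prod.swap], rule bij_betwI[of _ _ _ prod.swap]) auto
  ultimately show ?thesis
    by (simp add: inv_sign_def power_add mult.assoc flip: power_mult_distrib)
qed

lemma inv_sign_swap_single:
  assumes "w \<notin> U"
  shows "inv_sign U {w} = (- 1) ^ card U * (inv_sign {w} U :: 'r::comm_ring_1)"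
  using inv_sign_swap[of U "{w}"] assms by simp

text \<open>The product and the differential of \<open>ext_ring\<close> and \<open>koszul_diff\<close> over a ring given by a type
class. Over the polynomial ring they describe a lift of the Koszul complex of the quotient; over the
field, with all \<open>xs w = 1\<close>, the differential is that of a single multidegree.\<close>

definition emul :: "('n::{finite,linorder} set \<Rightarrow> 'r::comm_ring_1) \<Rightarrow> ('n set \<Rightarrow> 'r) \<Rightarrow> 'n set \<Rightarrow> 'r"
  where "emul f g W = (\<Sum>U\<in>Pow W. inv_sign U (W - U) * (f U * g (W - U)))"

definition ebasis :: "'n set \<Rightarrow> 'r \<Rightarrow> 'n set \<Rightarrow> 'r::zero"
  where "ebasis U r = (\<lambda>W. if W = U then r else 0)"

lemma ebasis_apply: "ebasis U r W = (if W = U then r else 0)"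
  by (simp add: ebasis_def)

definition ed :: "('n::{finite,linorder} \<Rightarrow> 'r::comm_ring_1) \<Rightarrow> ('n set \<Rightarrow> 'r) \<Rightarrow> 'n set \<Rightarrow> 'r"
  where "ed xs f W = (\<Sum>w\<in>- W. inv_sign {w} W * (xs w * f (insert w W)))"

lemma emul_add_left: "emul (f + f') g = emul f g + emul f' g"
  by (simp add: emul_def fun_eq_iff algebra_simps sum.distrib)

lemma emul_add_right: "emul f (g + g') = emul f g + emul f g'"
  by (simp add: emul_def fun_eq_iff algebra_simps sum.distrib)

lemma emul_zero_right [simp]: "emul f 0 = 0"
  by (simp add: emul_def fun_eq_iff)

lemma emul_ebasis_empty_left: "emul (ebasis {} r) g = (\<lambda>W. r * g W)"
proof
  fix W
  have "emul (ebasis {} r) g W = (\<Sum>U\<in>Pow W. if U = {} then r * g W else 0)"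
    unfolding emul_def by (rule sum.cong) (auto simp: ebasis_def)
  then show "emul (ebasis {} r) g W = r * g W"
    by simp
qed

lemma emul_ebasis_empty_right: "emul g (ebasis {} r) = (\<lambda>W. r * g W)"
proof
  fix W
  have "emul g (ebasis {} r) W = (\<Sum>U\<in>Pow W. if U = W then r * g W else 0)"
    unfolding emul_def by (rule sum.cong) (auto simp: ebasis_def)
  then show "emul g (ebasis {} r) W = r * g W"
    by simp
qed

lemma emul_one [simp]: "emul (ebasis {} 1) g = g" "emul g (ebasis {} 1) = g"
  by (simp_all add: emul_ebasis_empty_left emul_ebasis_empty_right)

lemma emul_ebasis:
  "emul (ebasis U a) (ebasis V b) =
    (if U \<inter> V = {} then ebasis (U \<union> V) (inv_sign U V * (a * b)) else 0)"
proof
  fix W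
  have "emul (ebasis U a) (ebasis V b) W =
      (\<Sum>A\<in>Pow W. if A = U then (if W - U = V then inv_sign U V * (a * b) else 0) else 0)"
    unfolding emul_def by (rule sum.cong) (auto simp: ebasis_def)
  also have "\<dots> = (if U \<subseteq> W \<and> W - U = V then inv_sign U V * (a * b) else 0)"
    by simp
  also have "(U \<subseteq> W \<and> W - U = V) \<longleftrightarrow> (U \<inter> V = {} \<and> W = U \<union> V)"
    by auto
  finally show "emul (ebasis U a) (ebasis V b) W =
      (if U \<inter> V = {} then ebasis (U \<union> V) (inv_sign U V * (a * b)) else 0) W"
    by (simp add: ebasis_def)
qed

text \<open>Both sides are sums over the ordered partitions of \<open>W\<close> into three sets, and the sign is
multiplicative in each argument.\<close>

lemma emul_assoc: "emul (emul f g) h = emul f (emul g h)"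
proof
  fix W
  let ?L = "\<lambda>(U, A). inv_sign U (W - U) * (inv_sign A (U - A) * (f A * g (U - A))) * h (W - U)"
  let ?R = "\<lambda>(A, B). inv_sign A (W - A) * (f A * (inv_sign B (W - A - B) * (g B * h (W - A - B))))"
  have "emul (emul f g) h W = (\<Sum>(U, A)\<in>(SIGMA U:Pow W. Pow U). ?L (U, A))"
    by (simp add: emul_def sum_distrib_left sum_distrib_right sum.Sigma mult.assoc)
  also have "\<dots> = (\<Sum>(A, B)\<in>(SIGMA A:Pow W. Pow (W - A)). ?R (A, B))"
  proof (rule sum.reindex_bij_witness[where j = "\<lambda>(U, A). (A, U - A)" and i = "\<lambda>(A, B). (A \<union> B, A)"];
      clarsimp)
    fix U A assume UA: "U \<subseteq> W" "A \<subseteq> U"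
    define B where "B = U - A"
    define C where "C = W - U"
    have e: "U = A \<union> B" "W - A - B = C" "W - A = B \<union> C"
      and d: "A \<inter> B = {}" "B \<inter> C = {}" "A \<inter> C = {}"
      using UA by (auto simp: B_def C_def)
    have "inv_sign A (W - A) * (f A * (inv_sign B (W - A - B) * (g B * h (W - A - B)))) =
        inv_sign U C * (inv_sign A B * (f A * g B)) * h C"
      unfolding e(2) unfolding e(3) e(1) inv_sign_Un_left[OF d(1)] inv_sign_Un_right[OF d(2)]
      by (simp add: ac_simps)
    then show "inv_sign A (W - A) * (f A * (inv_sign (U - A) (W - A - (U - A)) *
          (g (U - A) * h (W - A - (U - A))))) =
        inv_sign U (W - U) * (inv_sign A (U - A) * (f A * g (U - A))) * h (W - U)"
      by (simp add: B_def C_def)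
  qed (auto simp: Un_Diff)
  also have "\<dots> = emul f (emul g h) W"
    by (simp add: emul_def sum_distrib_left sum_distrib_right sum.Sigma mult.assoc)
  finally show "emul (emul f g) h W = emul f (emul g h) W" .
qed

lemma ed_add: "ed xs (f + g) = ed xs f + ed xs g"
  by (simp add: ed_def fun_eq_iff algebra_simps sum.distrib)

lemma ed_minus: "ed xs (- f) = - ed xs f"
  by (simp add: ed_def fun_eq_iff sum_negf)

lemma ed_zero [simp]: "ed xs 0 = 0"
  by (simp add: ed_def fun_eq_iff)

lemma ed_diff: "ed xs (f - g) = ed xs f - ed xs g"
  using ed_add[of xs f "- g"] by (simp add: ed_minus)

text \<open>Removing \<open>w\<close> and \<open>w'\<close> in the two possible orders gives opposite signs. The terms are cancelled in
pairs \<open>w < w'\<close>: that the sum equals its own negative would not suffice in characteristic \<open>2\<close>.\<close>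

lemma ed_ed: "ed xs (ed xs f) = 0"
proof
  fix W
  define T where "T = (\<lambda>w w'. inv_sign {w} W * (xs w * (inv_sign {w'} (insert w W) *
      (xs w' * f (insert w' (insert w W))))))"
  have T: "T w w' + T w' w = 0" if "w < w'" "w \<notin> W" "w' \<notin> W" for w w'
  proof -
    have "inv_sign {w'} {w} = - (1 :: 'b)" "inv_sign {w} {w'} = (1 :: 'b)"
    proof -
      have "{(u, v). u \<in> {w'} \<and> v \<in> {w} \<and> v < u} = {(w', w)}"
          "{(u, v). u \<in> {w} \<and> v \<in> {w'} \<and> v < u} = {}"
        using that by auto
      then show "inv_sign {w'} {w} = - (1 :: 'b)" "inv_sign {w} {w'} = (1 :: 'b)"
        unfolding inv_sign_def by (simp_all only:) simp_all
    qed
    then show ?thesis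
      using that by (simp add: T_def inv_sign_insert_right[of w W] inv_sign_insert_right[of w' W]
          insert_commute[of w w'] ac_simps)
  qed
  have "ed xs (ed xs f) W = (\<Sum>w\<in>- W. \<Sum>w'\<in>- insert w W. T w w')"
    by (simp add: ed_def T_def sum_distrib_left)
  also have "\<dots> = (\<Sum>(w, w')\<in>(SIGMA w:- W. - insert w W). T w w')"
    by (simp add: sum.Sigma)
  also have "(SIGMA w:- W. - insert w W) =
      {(w, w'). w \<notin> W \<and> w' \<notin> W \<and> w < w'} \<union> {(w, w'). w \<notin> W \<and> w' \<notin> W \<and> w' < w}"
    by auto
  also have "(\<Sum>(w, w')\<in>\<dots>. T w w') = (\<Sum>(w, w')\<in>{(w, w'). w \<notin> W \<and> w' \<notin> W \<and> w < w'}. T w w') +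
      (\<Sum>(w, w')\<in>{(w, w'). w \<notin> W \<and> w' \<notin> W \<and> w' < w}. T w w')"
    by (rule sum.union_disjoint) auto
  also have "(\<Sum>(w, w')\<in>{(w, w'). w \<notin> W \<and> w' \<notin> W \<and> w' < w}. T w w') =
      (\<Sum>(w, w')\<in>{(w, w'). w \<notin> W \<and> w' \<notin> W \<and> w < w'}. T w' w)"
    by (rule sum.reindex_bij_witness[of _ prod.swap prod.swap]) auto
  also have "(\<Sum>(w, w')\<in>{(w, w'). w \<notin> W \<and> w' \<notin> W \<and> w < w'}. T w w') + \<dots> =
      (\<Sum>(w, w')\<in>{(w, w'). w \<notin> W \<and> w' \<notin> W \<and> w < w'}. T w w' + T w' w)"
    by (simp add: sum.distrib[symmetric] split_def)
  also have "\<dots> = 0"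
    by (rule sum.neutral) (auto simp: T)
  finally show "ed xs (ed xs f) W = 0 W"
    by simp
qed

definition grade_twist :: "('n set \<Rightarrow> 'r::comm_ring_1) \<Rightarrow> 'n set \<Rightarrow> 'r"
  where "grade_twist f U = (- 1) ^ card U * f U"

lemma sum_Pow_insert:
  assumes "w \<notin> W" "finite W"
  shows "(\<Sum>U\<in>Pow (insert w W). F U) = (\<Sum>U\<in>Pow W. F (insert w U)) + (\<Sum>U\<in>Pow W. F U)"
proof -
  have "Pow (insert w W) = insert w ` Pow W \<union> Pow W"
    by (auto simp: Pow_insert)
  moreover have "insert w ` Pow W \<inter> Pow W = {}"
    using assms by auto
  moreover have "inj_on (insert w) (Pow W)"
    using assms by (intro inj_onI) (metis Diff_insert_absorb PowD subsetD)
  ultimately show ?thesis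
    using assms by (simp add: sum.union_disjoint sum.reindex)
qed

text \<open>The Leibniz rule. The products on the right contain terms in which \<open>w\<close> belongs to \<open>W\<close>; the terms of the
first product with \<open>w \<in> W - U\<close> cancel those of the second one with \<open>insert w U\<close> in place of \<open>U\<close>.\<close>

lemma ed_emul: "ed xs (emul f g) = emul (ed xs f) g + emul (grade_twist f) (ed xs g)"
proof
  fix W
  define P where "P = (\<lambda>w U. inv_sign U (W - U) * inv_sign {w} U * (xs w * (f (insert w U) * g (W - U))))"
  define Q where "Q = (\<lambda>w U. (- 1) ^ card U * inv_sign U (W - U) * inv_sign {w} (W - U) *
      (xs w * (f U * g (insert w (W - U)))))"
  have 1: "inv_sign {w} W * (xs w * emul f g (insert w W)) =
      (\<Sum>U\<in>Pow W. P w U) + (\<Sum>U\<in>Pow W. Q w U)" if w: "w \<in> - W" for w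
  proof -
    have "inv_sign {w} W * (xs w * (inv_sign (insert w U) (insert w W - insert w U) *
        (f (insert w U) * g (insert w W - insert w U)))) = P w U"
      "inv_sign {w} W * (xs w * (inv_sign U (insert w W - U) *
        (f U * g (insert w W - U)))) = Q w U"
      if U: "U \<in> Pow W" for U
    proof -
      have e: "insert w W - insert w U = W - U" "insert w W - U = insert w (W - U)" "w \<notin> U"
        and W: "W = U \<union> (W - U)" and d: "U \<inter> (W - U) = {}" "w \<notin> W - U"
        using w U by auto
      have s: "inv_sign {w} W = inv_sign {w} U * (inv_sign {w} (W - U) :: 'b)"
        by (subst W, subst inv_sign_Un_right) auto
      show "inv_sign {w} W * (xs w * (inv_sign (insert w U) (insert w W - insert w U) *
          (f (insert w U) * g (insert w W - insert w U)))) = P w U"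
        using e(3) unfolding e s P_def
        by (simp add: inv_sign_insert_left[of w U] ac_simps)
      show "inv_sign {w} W * (xs w * (inv_sign U (insert w W - U) *
          (f U * g (insert w W - U)))) = Q w U"
        using e(3) d unfolding e s Q_def
        by (simp add: inv_sign_insert_right[of w "W - U"] inv_sign_swap_single[of w U] ac_simps)
    qed
    then show ?thesis
      using w unfolding emul_def
      by (subst sum_Pow_insert) (simp_all add: sum_distrib_left algebra_simps sum.distrib)
  qed
  have 2: "emul (ed xs f) g W = (\<Sum>U\<in>Pow W. (\<Sum>w\<in>- W. P w U) + (\<Sum>w\<in>W - U. P w U))"
  proof -
    have "emul (ed xs f) g W = (\<Sum>U\<in>Pow W. \<Sum>w\<in>- U. P w U)"
      unfolding emul_def ed_def P_def sum_distrib_left sum_distrib_right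
      by (simp add: ac_simps)
    also have "\<dots> = (\<Sum>U\<in>Pow W. (\<Sum>w\<in>- W. P w U) + (\<Sum>w\<in>W - U. P w U))"
      by (rule sum.cong[OF refl], subst sum.union_disjoint[symmetric]) (auto intro!: sum.cong)
    finally show ?thesis .
  qed
  have 3: "emul (grade_twist f) (ed xs g) W = (\<Sum>U\<in>Pow W. (\<Sum>w\<in>- W. Q w U) + (\<Sum>w\<in>U. Q w U))"
  proof -
    have "emul (grade_twist f) (ed xs g) W = (\<Sum>U\<in>Pow W. \<Sum>w\<in>- (W - U). Q w U)"
      unfolding emul_def ed_def Q_def grade_twist_def sum_distrib_left sum_distrib_right
      by (simp add: ac_simps)
    also have "\<dots> = (\<Sum>U\<in>Pow W. (\<Sum>w\<in>- W. Q w U) + (\<Sum>w\<in>U. Q w U))"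
      by (rule sum.cong[OF refl], subst sum.union_disjoint[symmetric]) (auto intro!: sum.cong)
    finally show ?thesis .
  qed
  have 4: "(\<Sum>U\<in>Pow W. \<Sum>w\<in>U. Q w U) = - (\<Sum>U\<in>Pow W. \<Sum>w\<in>W - U. P w U)"
  proof -
    have "(\<Sum>U\<in>Pow W. \<Sum>w\<in>U. Q w U) = (\<Sum>(U, w)\<in>(SIGMA U:Pow W. U). Q w U)"
      by (simp add: sum.Sigma)
    also have "\<dots> = (\<Sum>(U, w)\<in>(SIGMA U:Pow W. W - U). - P w U)"
    proof (rule sum.reindex_bij_witness[where j = "\<lambda>(U, w). (U - {w}, w)"
          and i = "\<lambda>(U, w). (insert w U, w)"]; clarsimp)
      fix U w assume UW: "U \<subseteq> W" "w \<in> U"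
      define V where "V = U - {w}"
      define C where "C = W - U"
      have e: "U = insert w V" "W - V = insert w C" "W - insert w V = C"
        and d: "w \<notin> V" "w \<notin> C"
        using UW by (auto simp: V_def C_def)
      have "- P w V = Q w U"
        using d unfolding P_def Q_def e
        by (simp add: inv_sign_insert_right[of w C] inv_sign_insert_left[of w V]
            inv_sign_swap_single[of w V] ac_simps)
      then show "- P w (U - {w}) = Q w U"
        by (simp add: V_def)
    qed auto
    also have "\<dots> = - (\<Sum>U\<in>Pow W. \<Sum>w\<in>W - U. P w U)"
      by (simp add: sum.Sigma sum_negf split_def)
    finally show ?thesis .
  qed
  have "ed xs (emul f g) W = (\<Sum>w\<in>- W. (\<Sum>U\<in>Pow W. P w U) + (\<Sum>U\<in>Pow W. Q w U))"
    unfolding ed_def by (rule sum.cong[OF refl 1])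
  also have "\<dots> = (\<Sum>U\<in>Pow W. \<Sum>w\<in>- W. P w U) + (\<Sum>U\<in>Pow W. \<Sum>w\<in>- W. Q w U)"
    by (simp add: sum.distrib sum.swap[of _ "- W"])
  finally show "ed xs (emul f g) W = (emul (ed xs f) g + emul (grade_twist f) (ed xs g)) W"
    by (simp add: 2 3 4 sum.distrib)
qed

section \<open>Hitting sets\<close>

lemma ed_eq_0_outside:
  assumes "\<And>W. h W \<noteq> 0 \<Longrightarrow> W \<subseteq> N" "\<not> W \<subseteq> N"
  shows "ed xs h W = 0"
proof -
  have "h (insert w W) = 0" for w
    using assms by (metis insert_subset)
  then show ?thesis
    by (simp add: ed_def)
qed

text \<open>Adding \<open>z\<close> is a homotopy from the identity to zero on the part of the complex spanned by the sets
that satisfy \<open>Q\<close>. The support of the preimage is recorded because the reduction below has to preserve what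
it achieved before.\<close>

lemma toggle_homotopy:
  fixes g :: "'n::{finite,linorder} set \<Rightarrow> 'r::comm_ring_1"
  assumes up: "\<And>W. W \<in> F \<Longrightarrow> insert z W \<in> F"
    and Q_insert: "\<And>W w. Q W \<Longrightarrow> Q (insert w W)" and Q_remove: "\<And>W. Q W \<Longrightarrow> Q (W - {z})"
    and remove: "\<And>W. W \<in> F \<Longrightarrow> Q W \<Longrightarrow> W - {z} \<in> F"
    and supp: "\<And>W. g W \<noteq> 0 \<Longrightarrow> W \<in> F"
    and cycle: "\<And>W. W \<in> F \<Longrightarrow> Q W \<Longrightarrow> ed (\<lambda>_. 1) g W = 0"
  obtains h where "\<And>W. h W \<noteq> 0 \<Longrightarrow> W \<in> F \<and> Q W \<and> z \<in> W \<and> g (W - {z}) \<noteq> 0"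
    and "\<And>W. W \<in> F \<Longrightarrow> Q W \<Longrightarrow> ed (\<lambda>_. 1) h W = g W"
proof
  define h where "h = (\<lambda>W. if z \<in> W \<and> Q W then inv_sign {z} (W - {z}) * g (W - {z}) else 0)"
  show "W \<in> F \<and> Q W \<and> z \<in> W \<and> g (W - {z}) \<noteq> 0" if "h W \<noteq> 0" for W
  proof -
    have "z \<in> W" "Q W" "g (W - {z}) \<noteq> 0"
      using that by (auto simp: h_def split: if_splits)
    moreover from this have "insert z (W - {z}) \<in> F"
      by (intro up supp)
    ultimately show ?thesis
      by (simp add: insert_absorb)
  qed
  show "ed (\<lambda>_. 1) h W = g W" if W: "W \<in> F" "Q W" for W
  proof (cases "z \<in> W")
    case False
    have "ed (\<lambda>_. 1) h W = (\<Sum>w\<in>- W. if w = z then g W else 0)"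
      unfolding ed_def by (rule sum.cong) (use False W Q_insert in \<open>auto simp: h_def\<close>)
    then show ?thesis
      using False by simp
  next
    case True
    define V where "V = W - {z}"
    have V: "z \<notin> V" "W = insert z V"
      using True by (auto simp: V_def)
    have "V \<in> F" "Q V"
      using W remove Q_remove by (auto simp: V_def)
    then have "0 = ed (\<lambda>_. 1) g V"
      using cycle by simp
    also have "- V = insert z (- W)"
      using V by auto
    then have "ed (\<lambda>_. 1) g V = inv_sign {z} V * g W +
        (\<Sum>w\<in>- W. inv_sign {w} V * g (insert w V))"
      using V unfolding ed_def by simp
    finally have "inv_sign {z} V * (inv_sign {z} V * g W +
        (\<Sum>w\<in>- W. inv_sign {w} V * g (insert w V))) = 0"
      by simp
    then have 1: "inv_sign {z} V * (\<Sum>w\<in>- W. inv_sign {w} V * g (insert w V)) = - g W"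
      by (simp only: distrib_left inv_sign_square_left add_eq_0_iff)
    have "ed (\<lambda>_. 1) h W = (\<Sum>w\<in>- W. - (inv_sign {z} V * (inv_sign {w} V * g (insert w V))))"
      unfolding ed_def
    proof (rule sum.cong[OF refl])
      fix w assume w: "w \<in> - W"
      then have wz: "w \<noteq> z" "w \<notin> V" "insert w W - {z} = insert w V"
        using V by auto
      have "inv_sign {w} {z} = (- 1 :: 'r) * inv_sign {z} {w}"
        using inv_sign_swap_single[of z "{w}"] wz(1) by simp
      then have "inv_sign {w} W * inv_sign {z} (insert w V) = - (inv_sign {z} V * inv_sign {w} V :: 'r)"
        unfolding V(2) inv_sign_insert_right[OF V(1)] inv_sign_insert_right[OF wz(2)]
        by (simp add: ac_simps)
      moreover have "h (insert w W) = inv_sign {z} (insert w V) * g (insert w V)"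
        using True W(2) Q_insert wz by (simp add: h_def)
      ultimately show "inv_sign {w} W * (1 * h (insert w W)) =
          - (inv_sign {z} V * (inv_sign {w} V * g (insert w V)))"
        by (simp flip: mult.assoc)
    qed
    also have "\<dots> = g W"
      using 1 by (simp add: sum_negf sum_distrib_left)
    finally show ?thesis .
  qed
qed

definition hitting_sets :: "'n set \<Rightarrow> 'i set \<Rightarrow> ('i \<Rightarrow> 'n set) \<Rightarrow> 'n set set"
  where "hitting_sets N U A = {W. W \<subseteq> N \<and> (\<forall>i\<in>U. W \<inter> A i \<noteq> {})}"

text \<open>Modulo boundaries, a chain that is closed away from \<open>v ` U\<close> can be concentrated on \<open>v ` U\<close>. The
variables outside \<open>v ` U\<close> are removed one after the other: a variable \<open>x \<in> A i\<close> keeps \<open>A i\<close> hit, and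
\<open>v i\<close> hits no other \<open>A j\<close>, so that \<open>v i\<close> can be toggled in all sets containing \<open>x\<close>.\<close>

lemma hitting_set_reduction:
  fixes g :: "'n::{finite,linorder} set \<Rightarrow> 'r::comm_ring_1"
  assumes A: "\<And>i. i \<in> U \<Longrightarrow> A i \<subseteq> N" "N \<subseteq> (\<Union>i\<in>U. A i)"
    and v: "\<And>i. i \<in> U \<Longrightarrow> v i \<in> A i" "\<And>i j. i \<in> U \<Longrightarrow> j \<in> U \<Longrightarrow> i \<noteq> j \<Longrightarrow> v i \<notin> A j"
    and supp: "\<And>W. g W \<noteq> 0 \<Longrightarrow> W \<in> hitting_sets N U A"
    and cycle: "\<And>W. W \<in> hitting_sets N U A \<Longrightarrow> W \<noteq> v ` U \<Longrightarrow> ed (\<lambda>_. 1) g W = 0"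
  obtains h where "\<And>W. h W \<noteq> 0 \<Longrightarrow> W \<in> hitting_sets N U A"
    and "\<And>W. W \<in> hitting_sets N U A \<Longrightarrow> W \<noteq> v ` U \<Longrightarrow> ed (\<lambda>_. 1) h W = g W"
proof -
  let ?F = "hitting_sets N U A" and ?d = "ed (\<lambda>_. 1 :: 'r)"
  have up: "insert w W \<in> ?F" if "W \<in> ?F" "w \<in> N" for w W
    using that by (auto simp: hitting_sets_def)
  have sub: "W \<subseteq> N" if "W \<in> ?F" for W
    using that by (auto simp: hitting_sets_def)
  have main: "\<exists>h. (\<forall>W. h W \<noteq> 0 \<longrightarrow> W \<in> ?F) \<and>
      (\<forall>W\<in>?F. W \<inter> Y \<noteq> {} \<longrightarrow> ?d h W = g W)" if "Y \<subseteq> N - v ` U" for Y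
    using finite[of Y] that
  proof (induction Y rule: finite_induct)
    case empty
    show ?case
      by (rule exI[of _ "\<lambda>_. 0"]) simp
  next
    case (insert x Y)
    then obtain h where h: "\<And>W. h W \<noteq> 0 \<Longrightarrow> W \<in> ?F"
        "\<And>W. W \<in> ?F \<Longrightarrow> W \<inter> Y \<noteq> {} \<Longrightarrow> ?d h W = g W"
      by auto
    define g' where "g' = (\<lambda>W. if W \<in> ?F then g W - ?d h W else 0)"
    have g'_insert: "g' (Set.insert w W) = g (Set.insert w W) - ?d h (Set.insert w W)"
      if "W \<in> ?F" for w W
    proof (cases "w \<in> N")
      case False
      then have "Set.insert w W \<notin> ?F" "?d h (Set.insert w W) = 0"
        using sub h(1) by (auto intro!: ed_eq_0_outside[of h N])
      then show ?thesis
        using supp by (auto simp: g'_def)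
    qed (use that up in \<open>auto simp: g'_def\<close>)
    have d_g': "?d g' W = 0" if "W \<in> ?F" "x \<in> W" for W
    proof -
      have "W \<noteq> v ` U"
        using that insert.prems by auto
      then have "?d g W - ?d (?d h) W = 0"
        using cycle that by (simp add: ed_ed)
      moreover have "?d g' W = ?d (g - ?d h) W"
        unfolding ed_def[of "\<lambda>_. 1 :: 'r" g'] ed_def[of "\<lambda>_. 1 :: 'r" "g - ?d h"]
        by (rule sum.cong) (simp_all add: g'_insert[OF that(1)])
      ultimately show ?thesis
        by (simp add: ed_diff)
    qed
    obtain i where i: "i \<in> U" "x \<in> A i"
      using A(2) insert.prems by auto
    have remove: "W - {v i} \<in> ?F" if "W \<in> ?F" "x \<in> W" for W
    proof -
      have "(W - {v i}) \<inter> A j \<noteq> {}" if "j \<in> U" for j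
      proof (cases "j = i")
        case True
        have "x \<noteq> v i"
          using insert.prems i(1) by auto
        then show ?thesis
          using True i \<open>x \<in> W\<close> by auto
      next
        case False
        obtain y where "y \<in> W" "y \<in> A j"
          using \<open>W \<in> ?F\<close> \<open>j \<in> U\<close> by (auto simp: hitting_sets_def)
        moreover have "y \<noteq> v i"
          using v(2)[OF i(1) \<open>j \<in> U\<close>] False \<open>y \<in> A j\<close> by auto
        ultimately show ?thesis
          by auto
      qed
      then show ?thesis
        using sub[OF that(1)] by (auto simp: hitting_sets_def)
    qed
    have vX: "v i \<in> N" "v i \<notin> insert x Y"
      using A(1) v(1) i insert.prems by auto
    obtain h' where h': "\<And>W. h' W \<noteq> 0 \<Longrightarrow> W \<in> ?F \<and> x \<in> W \<and> v i \<in> W \<and> g' (W - {v i}) \<noteq> 0"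
        "\<And>W. W \<in> ?F \<Longrightarrow> x \<in> W \<Longrightarrow> ?d h' W = g' W"
    proof (rule toggle_homotopy[of ?F "v i" "\<lambda>W. x \<in> W" g'])
      show "g' W \<noteq> 0 \<Longrightarrow> W \<in> ?F" for W
        by (auto simp: g'_def split: if_splits)
    qed (use up vX remove d_g' in auto)
    \<comment> \<open>The correction \<open>h'\<close> lives on sets containing \<open>v i\<close>, which is not in \<open>Y\<close>, and comes from
      values of \<open>g'\<close>, which vanish on the sets meeting \<open>Y\<close>. So it does not disturb what \<open>h\<close> achieved.\<close>
    show ?case
    proof (intro exI[of _ "h + h'"] conjI ballI allI impI)
      show "W \<in> ?F" if "(h + h') W \<noteq> 0" for W
        using that h(1) h'(1) by (cases "h W = 0") auto
      show "?d (h + h') W = g W" if W: "W \<in> ?F" "W \<inter> insert x Y \<noteq> {}" for W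
      proof (cases "x \<in> W")
        case True
        then show ?thesis
          using W h'(2) by (simp add: ed_add g'_def)
      next
        case False
        then have Y: "W \<inter> Y \<noteq> {}"
          using W by auto
        have "?d h' W = 0"
          unfolding ed_def
        proof (rule sum.neutral, rule ballI)
          fix w assume "w \<in> - W"
          have "h' (Set.insert w W) = 0"
          proof (rule ccontr)
            assume *: "h' (Set.insert w W) \<noteq> 0"
            let ?W = "Set.insert w W - {v i}"
            have "g' ?W \<noteq> 0" "?W \<inter> Y \<noteq> {}"
              using h'(1)[OF *] Y vX(2) by auto
            then show False
              using h(2)[of ?W] by (auto simp: g'_def split: if_splits)
          qed
          then show "inv_sign {w} W * (1 * h' (Set.insert w W)) = 0"
            by simp
        qed
        then show ?thesis
          using h(2)[OF W(1) Y] by (simp add: ed_add)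
      qed
    qed
  qed
  obtain h where h: "\<And>W. h W \<noteq> 0 \<Longrightarrow> W \<in> ?F"
      "\<And>W. W \<in> ?F \<Longrightarrow> W \<inter> (N - v ` U) \<noteq> {} \<Longrightarrow> ?d h W = g W"
    using main[OF subset_refl] by (elim exE conjE) (use that in metis)
  show ?thesis
  proof (rule that[OF h])
    fix W assume W: "W \<in> ?F" "W \<noteq> v ` U"
    \<comment> \<open>\<open>v i\<close> is the only element of \<open>v ` U\<close> in \<open>A i\<close>, so a hitting set inside \<open>v ` U\<close> is all of it.\<close>
    have "v ` U \<subseteq> W" if sub_v: "W \<subseteq> v ` U"
    proof
      fix y assume "y \<in> v ` U"
      then obtain i where i: "i \<in> U" "y = v i"
        by auto
      have "W \<inter> A i \<noteq> {}"
        using W(1) i(1) by (simp add: hitting_sets_def)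
      then obtain z where "z \<in> W" "z \<in> A i"
        by blast
      then obtain j where "j \<in> U" "v j \<in> W" "v j \<in> A i"
        using sub_v by blast
      then show "y \<in> W"
        using v(2)[of j i] i by (cases "j = i") auto
    qed
    then show "W \<inter> (N - v ` U) \<noteq> {}"
      using W sub[OF W(1)] by auto
  qed
qed

text \<open>By the reduction, \<open>g\<close> agrees away from \<open>v ` U\<close> with a boundary, and the value at \<open>v ` U\<close> of a
differential depends only on the larger sets; so it is a value of the square of the differential, which is zero.\<close>

lemma hitting_set_not_boundary:
  fixes g :: "'n::{finite,linorder} set \<Rightarrow> 'r::comm_ring_1"
  assumes A: "\<And>i. i \<in> U \<Longrightarrow> A i \<subseteq> N" "N \<subseteq> (\<Union>i\<in>U. A i)"
    and v: "\<And>i. i \<in> U \<Longrightarrow> v i \<in> A i" "\<And>i j. i \<in> U \<Longrightarrow> j \<in> U \<Longrightarrow> i \<noteq> j \<Longrightarrow> v i \<notin> A j"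
    and supp: "\<And>W. g W \<noteq> 0 \<Longrightarrow> W \<in> hitting_sets N U A"
    and cycle: "\<And>W. W \<in> hitting_sets N U A \<Longrightarrow> W \<noteq> v ` U \<Longrightarrow> ed (\<lambda>_. 1) g W = 0"
  shows "ed (\<lambda>_. 1) g (v ` U) = 0"
proof -
  let ?F = "hitting_sets N U A" and ?d = "ed (\<lambda>_. 1 :: 'r)"
  obtain h where h: "\<And>W. h W \<noteq> 0 \<Longrightarrow> W \<in> ?F"
      "\<And>W. W \<in> ?F \<Longrightarrow> W \<noteq> v ` U \<Longrightarrow> ?d h W = g W"
    using hitting_set_reduction[where g = g and U = U and A = A and N = N and v = v, OF A v supp cycle]
    by blast
  have "g (insert w (v ` U)) = ?d h (insert w (v ` U))" if "w \<notin> v ` U" for w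
  proof (cases "w \<in> N")
    case True
    then have "insert w (v ` U) \<in> ?F"
      using A(1) v(1) by (auto simp: hitting_sets_def)
    moreover have "insert w (v ` U) \<noteq> v ` U"
      using that by blast
    ultimately show ?thesis
      using h(2) by simp
  next
    case False
    then have "insert w (v ` U) \<notin> ?F" "?d h (insert w (v ` U)) = 0"
      using h(1) by (auto simp: hitting_sets_def intro!: ed_eq_0_outside[of h N])
    then show ?thesis
      using supp by auto
  qed
  then have "?d g (v ` U) = ?d (?d h) (v ` U)"
    unfolding ed_def[of _ g] ed_def[of _ "?d h"] by (intro sum.cong) auto
  then show ?thesis
    by (simp add: ed_ed)
qed

section \<open>Monomials and multidegrees\<close>

abbreviation "single \<equiv> Poly_Mapping.single"
abbreviation "lookup \<equiv> Poly_Mapping.lookup"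
abbreviation "keys \<equiv> Poly_Mapping.keys"

abbreviation expo :: "'n mono \<Rightarrow> 'n \<Rightarrow> nat"
  where "expo \<equiv> lookup"

definition mono_dvd :: "'n mono \<Rightarrow> 'n mono \<Rightarrow> bool"
  where "mono_dvd a b \<longleftrightarrow> (\<forall>x. expo a x \<le> expo b x)"

definition sqfree_mono :: "'n::finite set \<Rightarrow> 'n mono"
  where "sqfree_mono W = (\<Sum>x\<in>W. single x 1)"

lemma expo_sqfree_mono [simp]: "expo (sqfree_mono W) x = (if x \<in> W then 1 else 0)"
proof -
  have "expo (sqfree_mono W) x = (\<Sum>y\<in>W. if y = x then 1 else 0)"
    unfolding sqfree_mono_def lookup_sum by (rule sum.cong) (auto simp: lookup_single when_def)
  then show ?thesis
    by simp
qed

lemma expo_mono_lcm [simp]: "expo (mono_lcm m S) x = Max (insert 0 ((\<lambda>i. expo (m i) x) ` S))"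
  unfolding mono_lcm_def by (subst lookup_Abs_poly_mapping) simp_all

lemma expo_mono_gcd [simp]: "expo (mono_gcd m S) x = Min ((\<lambda>i. expo (m i) x) ` S)"
  unfolding mono_gcd_def by (subst lookup_Abs_poly_mapping) simp_all

lemma expo_le_mono_lcm: "finite S \<Longrightarrow> i \<in> S \<Longrightarrow> expo (m i) x \<le> expo (mono_lcm m S) x"
  by simp

lemma expo_mono_lcm_cases:
  assumes "finite S"
  obtains "expo (mono_lcm m S) x = 0" | i where "i \<in> S" "expo (mono_lcm m S) x = expo (m i) x"
proof -
  have "Max (insert 0 ((\<lambda>i. expo (m i) x) ` S)) \<in> insert 0 ((\<lambda>i. expo (m i) x) ` S)"
    using assms by (intro Max_in) auto
  then show ?thesis
    using that by auto
qed

lemma expo_diff [simp]: "expo (a - b) x = expo a x - expo b x"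
  by (simp add: lookup_minus)

lemma expo_add [simp]: "expo (a + b) x = expo a x + expo b x"
  by (simp add: lookup_add)

lemma mono_eqI: "(\<And>x. expo a x = expo b x) \<Longrightarrow> a = b"
  by (rule poly_mapping_eqI) simp

lemma keys_mono: "x \<in> keys a \<longleftrightarrow> 0 < expo a x"
  by (simp add: in_keys_iff)

lemma mono_add_sqfree_diff: "a + sqfree_mono W - sqfree_mono W = a"
  by (rule mono_eqI) simp

lemma mono_diff_sqfree_add:
  "W \<subseteq> keys u \<Longrightarrow> u - sqfree_mono W + sqfree_mono W = u"
  by (rule mono_eqI) (auto simp: keys_mono subset_iff Suc_leI)

lemma lookup_single_mult:
  "lookup (single a c * p) b =
    (if mono_dvd a b then c * lookup p (b - a) else 0)"
  for p :: "('n, 'k::field) mpoly"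
proof -
  have "lookup (single a c * p) b =
      (\<Sum>l. (c * (\<Sum>q. lookup p q when b = a + q)) when a = l)"
    unfolding lookup_mult lookup_single by (rule Sum_any.cong) (simp add: when_def)
  also have "\<dots> = c * (\<Sum>q. lookup p q when b = a + q)"
    by (rule Sum_any_when_equal')
  also have "(\<Sum>q. lookup p q when b = a + q) =
      (if mono_dvd a b then lookup p (b - a) else 0)"
  proof (cases "mono_dvd a b")
    case True
    then have "b = a + q \<longleftrightarrow> b - a = q" for q
      by (auto simp: mono_dvd_def intro!: mono_eqI)
    then show ?thesis
      using True by (simp add: Sum_any_when_equal')
  next
    case False
    then have "b \<noteq> a + q" for q
      by (auto simp: mono_dvd_def)
    then show ?thesis
      using False by simp
  qed
  finally show ?thesis
    by simp
qed

lemma inv_sign_cases: "(inv_sign U V :: 'r::comm_ring_1) = 1 \<and> (inv_sign U V :: 's::comm_ring_1) = 1 \<or>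
    (inv_sign U V :: 'r) = - 1 \<and> (inv_sign U V :: 's) = - 1"
  by (cases "even (card {(u, v). u \<in> U \<and> v \<in> V \<and> v < u})") (simp_all add: inv_sign_def)

lemma lookup_inv_sign_mult:
  "lookup (inv_sign U V * p) a = inv_sign U V * lookup p a"
  for p :: "('n, 'k::field) mpoly"
  using inv_sign_cases[of U V, where ?'r = "('n, 'k) mpoly" and ?'s = 'k] by auto

text \<open>The part of multidegree \<open>u\<close>: the summand \<open>c x\<^sup>a T\<^sub>W\<close> has multidegree \<open>a\<close> plus the exponent of the
  product of the variables in \<open>W\<close>.\<close>

definition strand :: "'n::finite mono \<Rightarrow> ('n set \<Rightarrow> ('n, 'k::field) mpoly) \<Rightarrow> 'n set \<Rightarrow> 'k"
  where "strand u z W =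
    (if W \<subseteq> keys u then lookup (z W) (u - sqfree_mono W) else 0)"

definition from_strand :: "'n::finite mono \<Rightarrow> ('n set \<Rightarrow> 'k) \<Rightarrow> 'n set \<Rightarrow> ('n, 'k::field) mpoly"
  where "from_strand u g W =
    (if W \<subseteq> keys u then single (u - sqfree_mono W) (g W) else 0)"

lemma strand_ed:
  assumes "W \<subseteq> keys u"
  shows "strand u (ed var z) W = ed (\<lambda>_. 1) (strand u z) W"
proof -
  have *: "lookup (var w * z (insert w W)) (u - sqfree_mono W) = strand u z (insert w W)"
    if w: "w \<notin> W" for w
  proof -
    have "mono_dvd (single w 1) (u - sqfree_mono W) \<longleftrightarrow> insert w W \<subseteq> keys u"
    proof
      assume "mono_dvd (single w 1) (u - sqfree_mono W)"
      then have "expo (single w 1) w \<le> expo (u - sqfree_mono W) w"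
        unfolding mono_dvd_def by blast
      then show "insert w W \<subseteq> keys u"
        using w assms by (simp add: keys_mono)
    next
      assume "insert w W \<subseteq> keys u"
      then show "mono_dvd (single w 1) (u - sqfree_mono W)"
        using w by (auto simp: mono_dvd_def keys_mono lookup_single when_def)
    qed
    moreover have "u - sqfree_mono W - single w 1 = u - sqfree_mono (insert w W)"
      using w by (intro mono_eqI) (auto simp: lookup_single when_def)
    ultimately show ?thesis
      by (simp add: var_def mono_poly_def lookup_single_mult strand_def)
  qed
  have "strand u (ed var z) W =
      (\<Sum>w\<in>- W. inv_sign {w} W * lookup (var w * z (insert w W)) (u - sqfree_mono W))"
    using assms by (simp add: strand_def ed_def lookup_sum lookup_inv_sign_mult)
  also have "\<dots> = ed (\<lambda>_. 1) (strand u z) W"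
    unfolding ed_def by (rule sum.cong) (simp_all add: *)
  finally show ?thesis .
qed

lemma single_inv_sign_mult:
  "single a (inv_sign U V * c) = inv_sign U V * (single a c :: ('n, 'k::field) mpoly)"
  using inv_sign_cases[of U V, where ?'r = "('n, 'k) mpoly" and ?'s = 'k]
  by (auto simp: single_uminus)

lemma single_sum: "single a (\<Sum>x\<in>A. f x) = (\<Sum>x\<in>A. single a (f x))"
  by (rule poly_mapping_eqI) (simp add: lookup_sum lookup_single when_def)

lemma ed_from_strand:
  assumes supp: "\<And>W. g W \<noteq> 0 \<Longrightarrow> W \<subseteq> keys u"
  shows "ed var (from_strand u g) = from_strand u (ed (\<lambda>_. 1) g)"
proof
  fix W
  show "ed var (from_strand u g) W = from_strand u (ed (\<lambda>_. 1) g) W"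
  proof (cases "W \<subseteq> keys u")
    case False
    then show ?thesis
      by (subst ed_eq_0_outside[of _ "keys u"]) (auto simp: from_strand_def split: if_splits)
  next
    case True
    have *: "var w * from_strand u g (insert w W) = single (u - sqfree_mono W) (g (insert w W))"
      if w: "w \<notin> W" for w
    proof (cases "w \<in> keys u")
      case T: True
      have "single w 1 + (u - sqfree_mono (insert w W)) = u - sqfree_mono W"
        using w T by (intro mono_eqI) (auto simp: lookup_single when_def keys_mono)
      then show ?thesis
        using True T by (simp add: from_strand_def var_def mono_poly_def mult_single)
    next
      case False
      then have "g (insert w W) = 0"
        using supp by blast
      then show ?thesis
        using False by (simp add: from_strand_def)
    qed
    have "ed var (from_strand u g) W =
        (\<Sum>w\<in>- W. inv_sign {w} W * single (u - sqfree_mono W) (g (insert w W)))"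
      unfolding ed_def by (rule sum.cong) (simp_all add: *)
    also have "\<dots> = from_strand u (ed (\<lambda>_. 1) g) W"
      using True by (simp add: from_strand_def ed_def single_sum single_inv_sign_mult)
    finally show ?thesis .
  qed
qed

lemma sum_strands:
  obtains D where "finite D" "z = (\<Sum>u\<in>D. from_strand u (strand u z))"
proof
  define D where "D = (\<Union>W. (\<lambda>a. a + sqfree_mono W) ` keys (z W))"
  show D: "finite D"
    by (auto simp: D_def)
  show "z = (\<Sum>u\<in>D. from_strand u (strand u z))"
  proof (rule ext, rule poly_mapping_eqI)
    fix W a
    have sum_apply: "(\<Sum>u\<in>D. f u) W = (\<Sum>u\<in>D. f u W)" for f :: "'a mono \<Rightarrow> 'a set \<Rightarrow> ('a, 'b) mpoly"
      by (induction D rule: infinite_finite_induct) auto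
    have "lookup (from_strand u (strand u z) W) a =
        (if u = a + sqfree_mono W then lookup (z W) a else 0)" for u
    proof -
      have "W \<subseteq> keys (a + sqfree_mono W)"
        by (auto simp: keys_mono)
      then show ?thesis
        by (auto simp: from_strand_def strand_def lookup_single when_def mono_diff_sqfree_add
            mono_add_sqfree_diff)
    qed
    then have "lookup ((\<Sum>u\<in>D. from_strand u (strand u z)) W) a =
        (if a + sqfree_mono W \<in> D then lookup (z W) a else 0)"
      using D by (simp add: sum_apply lookup_sum)
    also have "\<dots> = lookup (z W) a"
    proof (cases "a \<in> keys (z W)")
      case True
      then have "a + sqfree_mono W \<in> D"
        unfolding D_def by blast
      then show ?thesis
        by simp
    qed (simp add: in_keys_iff)
    finally show "lookup (z W) a =
        lookup ((\<Sum>u\<in>D. from_strand u (strand u z)) W) a" by simp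
  qed
qed

text \<open>The Taylor resolution is minimal if and only if every generator has such a variable.\<close>

locale private_variables =
  fixes m :: "nat \<Rightarrow> 'n::{finite,linorder} mono" and v :: "nat \<Rightarrow> 'n" and t :: nat
  assumes v_pos: "i \<in> {1..t} \<Longrightarrow> 0 < expo (m i) (v i)"
    and v_max: "i \<in> {1..t} \<Longrightarrow> j \<in> {1..t} \<Longrightarrow> j \<noteq> i \<Longrightarrow> expo (m j) (v i) < expo (m i) (v i)"
begin

definition in_mono_ideal :: "'n mono \<Rightarrow> bool"
  where "in_mono_ideal a \<longleftrightarrow> (\<exists>i\<in>{1..t}. mono_dvd (m i) a)"

definition poly_ideal :: "('n, 'k::field) mpoly set"
  where "poly_ideal = {p. \<forall>a\<in>keys p. in_mono_ideal a}"

text \<open>These sets index the \<open>T\<^sub>W\<close> whose coefficient in multidegree \<open>u\<close> is not zero in the quotient. They are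
the non-faces of the upper Koszul simplicial complex of the ideal at \<open>u\<close>.\<close>

definition koszul_support :: "'n mono \<Rightarrow> 'n set set"
  where "koszul_support u = {W. W \<subseteq> keys u \<and> \<not> in_mono_ideal (u - sqfree_mono W)}"

definition tops :: "'n mono \<Rightarrow> nat set"
  where "tops u = {i \<in> {1..t}. mono_dvd (m i) u}"

definition attained :: "'n mono \<Rightarrow> nat \<Rightarrow> 'n set"
  where "attained u i = {x. 0 < expo u x \<and> expo (m i) x = expo u x}"

lemma v_inj: "i \<in> {1..t} \<Longrightarrow> j \<in> {1..t} \<Longrightarrow> v i = v j \<Longrightarrow> i = j"
  using v_max[of i j] v_max[of j i] by fastforce

lemma inj_on_v: "S \<subseteq> {1..t} \<Longrightarrow> inj_on v S"
  by (meson inj_onI subsetD v_inj)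

lemma expo_lcm_v:
  assumes "S \<subseteq> {1..t}" "i \<in> S"
  shows "expo (mono_lcm m S) (v i) = expo (m i) (v i)"
proof -
  have fin: "finite S"
    using assms(1) finite_subset by blast
  have "expo (m j) (v i) \<le> expo (m i) (v i)" if "j \<in> S" for j
    using v_max[of i j] assms that by (cases "j = i") (force simp: less_imp_le)+
  then show ?thesis
    using fin assms(2) by (auto intro!: Max_eqI)
qed

lemma v_image_subset_keys: "S \<subseteq> {1..t} \<Longrightarrow> v ` S \<subseteq> keys (mono_lcm m S)"
proof -
  assume S: "S \<subseteq> {1..t}"
  have "0 < expo (mono_lcm m S) (v i)" if "i \<in> S" for i
    using expo_lcm_v[OF S that] v_pos[of i] S that by (metis subsetD)
  then show ?thesis
    by (auto simp: keys_mono simp del: expo_mono_lcm)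
qed

lemma tops_lcm:
  assumes "S \<subseteq> {1..t}"
  shows "tops (mono_lcm m S) = S"
proof
  have fin: "finite S"
    using assms(1) finite_subset by blast
  show "S \<subseteq> tops (mono_lcm m S)"
    using assms expo_le_mono_lcm[OF fin] unfolding tops_def mono_dvd_def by blast
  show "tops (mono_lcm m S) \<subseteq> S"
  proof
    fix i assume i: "i \<in> tops (mono_lcm m S)"
    then have i': "i \<in> {1..t}" "expo (m i) (v i) \<le> expo (mono_lcm m S) (v i)"
      unfolding tops_def mono_dvd_def by blast+
    consider "expo (mono_lcm m S) (v i) = 0"
      | j where "j \<in> S" "expo (mono_lcm m S) (v i) = expo (m j) (v i)"
      using expo_mono_lcm_cases[OF fin] by metis
    then show "i \<in> S"
    proof cases
      case 1
      then show ?thesis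
        using i' v_pos[of i] by linarith
    next
      case (2 j)
      then show ?thesis
        using i' assms v_max[of i j] by (metis linorder_not_le subsetD)
    qed
  qed
qed

lemma lcm_inj: "S \<subseteq> {1..t} \<Longrightarrow> S' \<subseteq> {1..t} \<Longrightarrow> mono_lcm m S = mono_lcm m S' \<Longrightarrow> S = S'"
  using tops_lcm by metis

text \<open>A generator \<open>m i\<close> dividing \<open>u\<close> fails to divide \<open>u - sqfree_mono W\<close> exactly if the exponent of some
variable in \<open>W\<close> cannot be lowered.\<close>

lemma koszul_support_eq_hitting_sets:
  "koszul_support u = hitting_sets (keys u) (tops u) (attained u)"
proof -
  have "mono_dvd (m i) (u - sqfree_mono W) \<longleftrightarrow> mono_dvd (m i) u \<and> W \<inter> attained u i = {}"
    if W: "W \<subseteq> keys u" for W i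
  proof
    assume L: "mono_dvd (m i) (u - sqfree_mono W)"
    then have le: "expo (m i) x \<le> expo u x - (if x \<in> W then 1 else 0)" for x
      by (simp add: mono_dvd_def)
    have "expo (m i) x \<noteq> expo u x" if "x \<in> W" for x
      using le[of x] W that by (force simp: keys_mono)
    moreover have "mono_dvd (m i) u"
      unfolding mono_dvd_def using le by (meson diff_le_self order_trans)
    ultimately show "mono_dvd (m i) u \<and> W \<inter> attained u i = {}"
      by (auto simp: attained_def)
  next
    assume R: "mono_dvd (m i) u \<and> W \<inter> attained u i = {}"
    have "expo (m i) x \<le> expo u x - (if x \<in> W then 1 else 0)" for x
    proof -
      have "expo (m i) x \<le> expo u x" "x \<in> W \<Longrightarrow> 0 < expo u x"
        using R W by (auto simp: mono_dvd_def keys_mono)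
      moreover have "x \<in> W \<Longrightarrow> expo (m i) x \<noteq> expo u x"
        using R W by (force simp: attained_def keys_mono)
      ultimately show ?thesis
        by auto
    qed
    then show "mono_dvd (m i) (u - sqfree_mono W)"
      by (simp add: mono_dvd_def)
  qed
  then show ?thesis
    by (auto simp: koszul_support_def hitting_sets_def in_mono_ideal_def tops_def)
qed

text \<open>The variable \<open>v i\<close> divides \<open>u\<close>, so its exponent in \<open>u\<close> is attained by some generator; a generator other
than \<open>m i\<close> has a smaller exponent there.\<close>

lemma v_attained:
  assumes cover: "keys u \<subseteq> (\<Union>i\<in>tops u. attained u i)"
  shows "i \<in> tops u \<Longrightarrow> v i \<in> attained u i"
    and "i \<in> tops u \<Longrightarrow> j \<in> tops u \<Longrightarrow> i \<noteq> j \<Longrightarrow> v i \<notin> attained u j"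
proof -
  have lt: "expo (m j) (v i) < expo u (v i)" if "i \<in> tops u" "j \<in> tops u" "i \<noteq> j" for i j
  proof -
    have "expo (m j) (v i) < expo (m i) (v i)" "expo (m i) (v i) \<le> expo u (v i)"
      using that v_max[of i j] by (auto simp: tops_def mono_dvd_def)
    then show ?thesis
      by simp
  qed
  then show "i \<in> tops u \<Longrightarrow> j \<in> tops u \<Longrightarrow> i \<noteq> j \<Longrightarrow> v i \<notin> attained u j"
    unfolding attained_def by fastforce
  show "v i \<in> attained u i" if i: "i \<in> tops u"
  proof -
    have "0 < expo (m i) (v i)" "expo (m i) (v i) \<le> expo u (v i)"
      using i v_pos by (auto simp: tops_def mono_dvd_def)
    then have "v i \<in> keys u"
      by (simp add: keys_mono)
    then obtain j where "j \<in> tops u" "v i \<in> attained u j"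
      using cover by blast
    then show ?thesis
      using lt[OF i, of j] unfolding attained_def by fastforce
  qed
qed

lemma attained_subset_keys: "attained u i \<subseteq> keys u"
  by (auto simp: attained_def keys_mono)

lemma cover_imp_lcm:
  assumes cover: "keys u \<subseteq> (\<Union>i\<in>tops u. attained u i)"
  shows "u = mono_lcm m (tops u)"
proof (rule mono_eqI)
  fix x
  have fin: "finite (tops u)"
    by (simp add: tops_def)
  have le: "\<forall>i\<in>tops u. expo (m i) x \<le> expo u x"
    by (simp add: tops_def mono_dvd_def)
  have "expo u x \<in> insert 0 ((\<lambda>i. expo (m i) x) ` tops u)"
  proof (cases "expo u x = 0")
    case False
    then obtain i where "i \<in> tops u" "x \<in> attained u i"
      using cover by (auto simp: keys_mono subset_iff)
    then show ?thesis
      unfolding attained_def by (metis (mono_tags, lifting) imageI insertCI mem_Collect_eq)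
  qed simp
  then show "expo u x = expo (mono_lcm m (tops u)) x"
    using fin le by (auto intro!: Max_eqI[symmetric])
qed

lemma lcm_imp_cover:
  assumes "S \<subseteq> {1..t}" "u = mono_lcm m S"
  shows "keys u \<subseteq> (\<Union>i\<in>tops u. attained u i)"
proof
  fix x assume x: "x \<in> keys u"
  have "finite S"
    using assms(1) finite_subset by blast
  then consider "expo (mono_lcm m S) x = 0"
    | i where "i \<in> S" "expo (mono_lcm m S) x = expo (m i) x"
    using expo_mono_lcm_cases by metis
  then show "x \<in> (\<Union>i\<in>tops u. attained u i)"
  proof cases
    case 1
    then show ?thesis
      using x assms(2) by (simp add: keys_mono del: expo_mono_lcm)
  next
    case (2 i)
    then show ?thesis
      using x assms tops_lcm[OF assms(1)] unfolding attained_def keys_mono by auto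
  qed
qed

text \<open>If the sets \<open>attained u i\<close> cover the variables of \<open>u\<close>, the chain is concentrated on one set.
Otherwise an uncovered variable can be toggled freely, so that there is no homology.\<close>

lemma koszul_support_homology:
  fixes g :: "'n set \<Rightarrow> 'r::comm_ring_1"
  assumes supp: "\<And>W. g W \<noteq> 0 \<Longrightarrow> W \<in> koszul_support u"
    and cycle: "\<And>W. W \<in> koszul_support u \<Longrightarrow> ed (\<lambda>_. 1) g W = 0"
  obtains h c where "\<And>W. h W \<noteq> 0 \<Longrightarrow> W \<in> koszul_support u"
    and "\<And>W. W \<in> koszul_support u \<Longrightarrow> g W = ed (\<lambda>_. 1) h W +
      (if u = mono_lcm m (tops u) \<and> W = v ` tops u then c else 0)"
proof (cases "keys u \<subseteq> (\<Union>i\<in>tops u. attained u i)")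
  case True
  show ?thesis
  proof (rule hitting_set_reduction[of "tops u" "attained u" "keys u" v g,
        folded koszul_support_eq_hitting_sets])
    fix h :: "'n set \<Rightarrow> 'r"
    assume h: "\<And>W. h W \<noteq> 0 \<Longrightarrow> W \<in> koszul_support u"
      "\<And>W. W \<in> koszul_support u \<Longrightarrow> W \<noteq> v ` tops u \<Longrightarrow> ed (\<lambda>_. 1) h W = g W"
    show ?thesis
      by (rule that[of h "g (v ` tops u) - ed (\<lambda>_. 1) h (v ` tops u)"])
        (use h cover_imp_lcm[OF True] in auto)
  qed (use attained_subset_keys True v_attained[OF True] supp cycle in blast)+
next
  case False
  then obtain z where z: "z \<in> keys u" "\<And>i. i \<in> tops u \<Longrightarrow> z \<notin> attained u i"
    by blast
  obtain h where h: "\<And>W. h W \<noteq> 0 \<Longrightarrow> W \<in> koszul_support u \<and> True \<and> z \<in> W \<and> g (W - {z}) \<noteq> 0"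
      "\<And>W. W \<in> koszul_support u \<Longrightarrow> True \<Longrightarrow> ed (\<lambda>_. 1) h W = g W"
  proof (rule toggle_homotopy[of "koszul_support u" z "\<lambda>_. True" g])
    show "insert z W \<in> koszul_support u" if "W \<in> koszul_support u" for W
      using that z by (auto simp: koszul_support_eq_hitting_sets hitting_sets_def)
    show "W - {z} \<in> koszul_support u" if "W \<in> koszul_support u" for W
    proof -
      have "(W - {z}) \<inter> attained u i = W \<inter> attained u i" if "i \<in> tops u" for i
        using z(2)[OF that] by auto
      then show ?thesis
        using that by (auto simp: koszul_support_eq_hitting_sets hitting_sets_def)
    qed
  qed (use supp cycle in auto)
  have "tops u \<subseteq> {1..t}"
    by (auto simp: tops_def)
  then have "u \<noteq> mono_lcm m (tops u)"
    using False lcm_imp_cover[of "tops u" u] by blast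
  then show ?thesis
    using that[of h 0] h by auto
qed

lemma koszul_support_not_boundary:
  fixes g :: "'n set \<Rightarrow> 'r::comm_ring_1"
  assumes S: "S \<subseteq> {1..t}"
    and supp: "\<And>W. g W \<noteq> 0 \<Longrightarrow> W \<in> koszul_support (mono_lcm m S)"
    and cycle: "\<And>W. W \<in> koszul_support (mono_lcm m S) \<Longrightarrow> W \<noteq> v ` S \<Longrightarrow> ed (\<lambda>_. 1) g W = 0"
  shows "ed (\<lambda>_. 1) g (v ` S) = 0"
proof -
  define u where "u = mono_lcm m S"
  have cover: "keys u \<subseteq> (\<Union>i\<in>tops u. attained u i)" and tops: "tops u = S"
    using lcm_imp_cover[OF S] tops_lcm[OF S] by (simp_all add: u_def)
  have "ed (\<lambda>_. 1) g (v ` tops u) = 0"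
    by (rule hitting_set_not_boundary[OF attained_subset_keys cover v_attained[OF cover],
          folded koszul_support_eq_hitting_sets])
      (use supp cycle in \<open>simp_all add: tops flip: u_def\<close>)
  then show ?thesis
    by (simp add: tops)
qed

lemma v_image_in_koszul_support:
  assumes S: "S \<subseteq> {1..t}"
  shows "v ` S \<in> koszul_support (mono_lcm m S)"
proof -
  define u where "u = mono_lcm m S"
  have cover: "keys u \<subseteq> (\<Union>i\<in>tops u. attained u i)" and tops: "tops u = S"
    using lcm_imp_cover[OF S] tops_lcm[OF S] by (simp_all add: u_def)
  have "v ` tops u \<in> koszul_support u"
    using v_attained(1)[OF cover] v_image_subset_keys[OF S] tops
    unfolding koszul_support_eq_hitting_sets hitting_sets_def u_def by blast
  then show ?thesis
    using tops u_def by simp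
qed

end

section \<open>A basis of the homology\<close>

lemma ed_ebasis_remove:
  assumes "w \<in> V"
  shows "ed xs (ebasis V r) (V - {w}) = inv_sign {w} (V - {w}) * (xs w * r)"
proof -
  have "ed xs (ebasis V r) (V - {w}) =
      (\<Sum>y\<in>- (V - {w}). if y = w then inv_sign {w} (V - {w}) * (xs w * r) else 0)"
    unfolding ed_def by (rule sum.cong) (use assms in \<open>auto simp: ebasis_def insert_absorb\<close>)
  then show ?thesis
    by simp
qed

lemma ed_ebasis_other:
  assumes "\<And>w. w \<in> V \<Longrightarrow> W \<noteq> V - {w}"
  shows "ed xs (ebasis V r) W = 0"
  unfolding ed_def
proof (rule sum.neutral, rule ballI)
  fix w assume "w \<in> - W"
  then have "insert w W \<noteq> V"
    using assms[of w] by auto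
  then show "inv_sign {w} W * (xs w * ebasis V r (insert w W)) = 0"
    by (simp add: ebasis_def)
qed

lemma sum_fun_apply: "(\<Sum>x\<in>A. f x) y = (\<Sum>x\<in>A. f x y)"
  for f :: "'i \<Rightarrow> 'a \<Rightarrow> 'b::comm_monoid_add"
  by (induction A rule: infinite_finite_induct) auto

context private_variables
begin

lemma in_mono_ideal_add: "in_mono_ideal b \<Longrightarrow> in_mono_ideal (a + b)"
  by (auto simp: in_mono_ideal_def mono_dvd_def intro: trans_le_add2)

lemma poly_ideal_single: "c = 0 \<or> in_mono_ideal a \<Longrightarrow> single a c \<in> poly_ideal"
  by (auto simp: poly_ideal_def)

lemma poly_ideal_lookup: "p \<in> poly_ideal \<Longrightarrow> \<not> in_mono_ideal a \<Longrightarrow> lookup p a = 0"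
  unfolding poly_ideal_def by (metis (mono_tags, lifting) in_keys_iff mem_Collect_eq)

lemma poly_ideal_zero [simp]: "0 \<in> poly_ideal"
  by (simp add: poly_ideal_def)

lemma poly_ideal_add: "p \<in> poly_ideal \<Longrightarrow> q \<in> poly_ideal \<Longrightarrow> p + q \<in> poly_ideal"
  using keys_add[of p q] by (auto simp: poly_ideal_def)

lemma poly_ideal_minus: "p \<in> poly_ideal \<Longrightarrow> - p \<in> poly_ideal"
  by (simp add: poly_ideal_def in_keys_iff)

lemma poly_ideal_diff: "p \<in> poly_ideal \<Longrightarrow> q \<in> poly_ideal \<Longrightarrow> p - q \<in> poly_ideal"
  using poly_ideal_add[of p "- q"] poly_ideal_minus[of q] by simp

lemma poly_ideal_mult: "q \<in> poly_ideal \<Longrightarrow> p * q \<in> poly_ideal"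
  using keys_mult[of p q] in_mono_ideal_add by (auto simp: poly_ideal_def)

lemma poly_ideal_mult_right: "q \<in> poly_ideal \<Longrightarrow> q * p \<in> poly_ideal"
  using poly_ideal_mult[of q p] by (simp add: mult.commute)

lemma poly_ideal_sum: "(\<And>x. x \<in> A \<Longrightarrow> f x \<in> poly_ideal) \<Longrightarrow> (\<Sum>x\<in>A. f x) \<in> poly_ideal"
  by (induction A rule: infinite_finite_induct) (auto intro: poly_ideal_add)

text \<open>The chains of the quotient complex are the chains over the polynomial ring modulo \<open>ext_ideal\<close>. The
cycles and boundaries of the quotient are therefore those modulo \<open>ext_ideal\<close>.\<close>

definition ext_ideal :: "('n set \<Rightarrow> ('n, 'k::field) mpoly) set"
  where "ext_ideal = {y. \<forall>W. y W \<in> poly_ideal}"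

definition cycles :: "('n set \<Rightarrow> ('n, 'k::field) mpoly) set"
  where "cycles = {z. ed var z \<in> ext_ideal}"

definition boundaries :: "('n set \<Rightarrow> ('n, 'k::field) mpoly) set"
  where "boundaries = {b. \<exists>h. b - ed var h \<in> ext_ideal}"

lemma ext_ideal_zero [simp]: "0 \<in> ext_ideal"
  by (simp add: ext_ideal_def)

lemma ext_ideal_add: "y \<in> ext_ideal \<Longrightarrow> y' \<in> ext_ideal \<Longrightarrow> y + y' \<in> ext_ideal"
  by (simp add: ext_ideal_def poly_ideal_add)

lemma ext_ideal_minus: "y \<in> ext_ideal \<Longrightarrow> - y \<in> ext_ideal"
  by (simp add: ext_ideal_def poly_ideal_minus)

lemma ext_ideal_emul_left: "y \<in> ext_ideal \<Longrightarrow> emul f y \<in> ext_ideal"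
  by (simp add: ext_ideal_def emul_def poly_ideal_sum poly_ideal_mult)

lemma ext_ideal_emul_right: "y \<in> ext_ideal \<Longrightarrow> emul y f \<in> ext_ideal"
  by (simp add: ext_ideal_def emul_def poly_ideal_sum poly_ideal_mult poly_ideal_mult_right)

lemma ext_ideal_ed: "y \<in> ext_ideal \<Longrightarrow> ed var y \<in> ext_ideal"
  by (simp add: ext_ideal_def ed_def poly_ideal_sum poly_ideal_mult)

lemma ext_ideal_grade_twist: "y \<in> ext_ideal \<Longrightarrow> grade_twist y \<in> ext_ideal"
  by (simp add: ext_ideal_def grade_twist_def poly_ideal_mult)

lemma ext_ideal_subset_boundaries: "ext_ideal \<subseteq> boundaries"
  by (auto simp: boundaries_def intro!: exI[of _ 0])

lemma ed_in_boundaries: "ed var h \<in> boundaries"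
  by (auto simp: boundaries_def intro!: exI[of _ h])

lemma boundaries_zero [simp]: "0 \<in> boundaries"
  using ext_ideal_subset_boundaries by auto

lemma boundaries_add: "b \<in> boundaries \<Longrightarrow> b' \<in> boundaries \<Longrightarrow> b + b' \<in> boundaries"
proof -
  assume "b \<in> boundaries" "b' \<in> boundaries"
  then obtain h h' where "b - ed var h \<in> ext_ideal" "b' - ed var h' \<in> ext_ideal"
    by (auto simp: boundaries_def)
  then have "(b - ed var h) + (b' - ed var h') \<in> ext_ideal"
    by (rule ext_ideal_add)
  also have "(b - ed var h) + (b' - ed var h') = b + b' - ed var (h + h')"
    by (simp add: ed_add)
  finally show ?thesis
    unfolding boundaries_def by blast
qed

lemma boundaries_minus: "b \<in> boundaries \<Longrightarrow> - b \<in> boundaries"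
proof -
  assume "b \<in> boundaries"
  then obtain h where "b - ed var h \<in> ext_ideal"
    by (auto simp: boundaries_def)
  then have "- b - ed var (- h) \<in> ext_ideal"
    using ext_ideal_minus by (fastforce simp: ed_minus)
  then show ?thesis
    unfolding boundaries_def by blast
qed

lemma boundaries_diff: "b \<in> boundaries \<Longrightarrow> b' \<in> boundaries \<Longrightarrow> b - b' \<in> boundaries"
  using boundaries_add[of b "- b'"] boundaries_minus[of b'] by simp

lemma cycles_add: "z \<in> cycles \<Longrightarrow> z' \<in> cycles \<Longrightarrow> z + z' \<in> cycles"
  by (simp add: cycles_def ed_add ext_ideal_add)

lemma cycles_minus: "z \<in> cycles \<Longrightarrow> - z \<in> cycles"
  by (simp add: cycles_def ed_minus ext_ideal_minus)

lemma cycles_emul: "z \<in> cycles \<Longrightarrow> z' \<in> cycles \<Longrightarrow> emul z z' \<in> cycles"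
  by (simp add: cycles_def ed_emul ext_ideal_add ext_ideal_emul_left ext_ideal_emul_right)

lemma boundaries_subset_cycles: "boundaries \<subseteq> cycles"
proof
  fix b assume "b \<in> boundaries"
  then obtain h where "b - ed var h \<in> ext_ideal"
    by (auto simp: boundaries_def)
  then have "ed var (b - ed var h) \<in> ext_ideal"
    by (rule ext_ideal_ed)
  then show "b \<in> cycles"
    by (simp add: cycles_def ed_diff ed_ed)
qed

lemma grade_twist_grade_twist [simp]: "grade_twist (grade_twist f) = f"
  by (simp add: grade_twist_def fun_eq_iff flip: mult.assoc power_mult_distrib)

lemma ed_grade_twist: "ed xs (grade_twist f) = - grade_twist (ed xs f)"
proof
  fix W
  have "ed xs (grade_twist f) W = (\<Sum>w\<in>- W. - ((- 1) ^ card W * (inv_sign {w} W * (xs w * f (insert w W)))))"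
    unfolding ed_def by (rule sum.cong) (simp_all add: grade_twist_def ac_simps)
  then show "ed xs (grade_twist f) W = (- grade_twist (ed xs f)) W"
    by (simp add: grade_twist_def ed_def sum_negf sum_distrib_left)
qed

lemma boundaries_emul_right:
  assumes "b \<in> boundaries" "z \<in> cycles"
  shows "emul b z \<in> boundaries"
proof -
  obtain h where h: "b - ed var h \<in> ext_ideal"
    using assms(1) by (auto simp: boundaries_def)
  have "ed var (emul h z) = emul (ed var h) z + emul (grade_twist h) (ed var z)"
    by (rule ed_emul)
  then have "emul b z = emul (b - ed var h) z + ed var (emul h z) - emul (grade_twist h) (ed var z)"
    using emul_add_left[of "b - ed var h" "ed var h" z] by simp
  moreover have "emul (b - ed var h) z \<in> ext_ideal" "emul (grade_twist h) (ed var z) \<in> ext_ideal"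
    using h assms(2) by (simp_all add: cycles_def ext_ideal_emul_left ext_ideal_emul_right)
  then have "emul (b - ed var h) z \<in> boundaries" "emul (grade_twist h) (ed var z) \<in> boundaries"
    using ext_ideal_subset_boundaries by blast+
  ultimately show ?thesis
    using boundaries_add boundaries_diff ed_in_boundaries by metis
qed

lemma boundaries_emul_left:
  assumes "b \<in> boundaries" "z \<in> cycles"
  shows "emul z b \<in> boundaries"
proof -
  obtain h where h: "b - ed var h \<in> ext_ideal"
    using assms(1) by (auto simp: boundaries_def)
  \<comment> \<open>The Leibniz rule twists the left factor. To obtain \<open>z\<close> in front of \<open>ed var h\<close> it is applied to
    the twisted \<open>z\<close>, which is a cycle as well.\<close>
  let ?z = "grade_twist z"
  have "ed var ?z \<in> ext_ideal"
    using assms(2) by (simp add: cycles_def ed_grade_twist ext_ideal_minus ext_ideal_grade_twist)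
  moreover have "ed var (emul ?z h) = emul (ed var ?z) h + emul z (ed var h)"
    by (simp add: ed_emul)
  then have "emul z b = emul z (b - ed var h) + ed var (emul ?z h) - emul (ed var ?z) h"
    using emul_add_right[of z "b - ed var h" "ed var h"] by simp
  moreover have "emul z (b - ed var h) \<in> boundaries"
    using h by (intro subsetD[OF ext_ideal_subset_boundaries] ext_ideal_emul_left)
  ultimately show ?thesis
    using boundaries_add boundaries_diff ed_in_boundaries
      subsetD[OF ext_ideal_subset_boundaries ext_ideal_emul_right] by metis
qed

text \<open>The scalar multiples of \<open>f\<^sub>S\<close> up to the sign caused by the order of the variables \<open>v i\<close>; this
form is insensitive to that order.\<close>

definition taylor_cycle :: "nat set \<Rightarrow> 'k \<Rightarrow> 'n set \<Rightarrow> ('n, 'k::field) mpoly"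
  where "taylor_cycle S c = ebasis (v ` S) (single (mono_lcm m S - sqfree_mono (v ` S)) c)"

lemma taylor_cycle_add: "taylor_cycle S (c + c') = taylor_cycle S c + taylor_cycle S c'"
  by (simp add: taylor_cycle_def ebasis_def fun_eq_iff single_add)

lemma taylor_cycle_zero [simp]: "taylor_cycle S 0 = 0"
  by (simp add: taylor_cycle_def ebasis_def fun_eq_iff)

text \<open>Removing \<open>v i\<close> from \<open>T\<^bsub>v ` S\<^esub>\<close> restores the full exponent of \<open>v i\<close> in the coefficient. Its exponents
at the other \<open>v j\<close> drop by one, but \<open>m i\<close> is smaller than \<open>m j\<close> there; so \<open>m i\<close> divides it.\<close>

lemma taylor_cycle_in_cycles:
  assumes S: "S \<subseteq> {1..t}"
  shows "taylor_cycle S c \<in> cycles"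
proof -
  let ?u = "mono_lcm m S"
  have fin: "finite S"
    using S finite_subset by blast
  have "ed var (taylor_cycle S c) W \<in> poly_ideal" for W
  proof (cases "\<exists>i\<in>S. W = v ` S - {v i}")
    case False
    then show ?thesis
      unfolding taylor_cycle_def by (subst ed_ebasis_other) auto
  next
    case True
    then obtain i where i: "i \<in> S" "W = v ` S - {v i}"
      by blast
    have ge1: "0 < expo ?u (v i)"
      using v_image_subset_keys[OF S] i(1) unfolding keys_mono[symmetric] by blast
    have "single (v i) 1 + (?u - sqfree_mono (v ` S)) = ?u - sqfree_mono W"
      using i ge1 by (intro mono_eqI) (auto simp: lookup_single when_def simp del: expo_mono_lcm)
    moreover have "mono_dvd (m i) (?u - sqfree_mono W)"
      unfolding mono_dvd_def
    proof
      fix x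
      show "expo (m i) x \<le> expo (?u - sqfree_mono W) x"
      proof (cases "x \<in> W")
        case True
        then obtain j where j: "j \<in> S" "x = v j" "j \<noteq> i"
          using i by auto
        have "expo (m i) x < expo (m j) x"
          using v_max[of j i] i(1) j S by (metis subsetD)
        then have "expo (m i) x < expo ?u x"
          using expo_le_mono_lcm[OF fin j(1), of m x] by linarith
        then show ?thesis
          using True by (simp del: expo_mono_lcm)
      next
        case False
        then show ?thesis
          using expo_le_mono_lcm[OF fin i(1), of m x] by (simp del: expo_mono_lcm)
      qed
    qed
    then have "in_mono_ideal (?u - sqfree_mono W)"
      using i(1) S by (auto simp: in_mono_ideal_def)
    ultimately show ?thesis
      using i unfolding taylor_cycle_def i(2)
      by (subst ed_ebasis_remove)
        (auto simp: var_def mono_poly_def mult_single intro!: poly_ideal_mult poly_ideal_single)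
  qed
  then show ?thesis
    by (simp add: cycles_def ext_ideal_def)
qed

text \<open>The coefficients whose monomials are not in the ideal. Restricting to them is compatible with the
differential on \<open>koszul_support u\<close> because this family is closed under adding variables of \<open>u\<close>.\<close>

definition surviving_strand :: "'n mono \<Rightarrow> ('n set \<Rightarrow> ('n, 'k::field) mpoly) \<Rightarrow> 'n set \<Rightarrow> 'k"
  where "surviving_strand u z W = (if W \<in> koszul_support u then strand u z W else 0)"

lemma koszul_support_subset_keys: "W \<in> koszul_support u \<Longrightarrow> W \<subseteq> keys u"
  by (simp add: koszul_support_def)

lemma surviving_strand_supp: "surviving_strand u z W \<noteq> 0 \<Longrightarrow> W \<in> koszul_support u"
  by (auto simp: surviving_strand_def split: if_splits)

lemma ed_surviving_strand:
  assumes W: "W \<in> koszul_support u"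
  shows "ed (\<lambda>_. 1) (surviving_strand u z) W = lookup (ed var z W) (u - sqfree_mono W)"
proof -
  have "insert w W \<in> koszul_support u" if "w \<in> keys u" for w
    using that W unfolding koszul_support_eq_hitting_sets by (auto simp: hitting_sets_def)
  then have "surviving_strand u z (insert w W) = strand u z (insert w W)" for w
    by (auto simp: surviving_strand_def strand_def)
  then have "ed (\<lambda>_. 1) (surviving_strand u z) W = ed (\<lambda>_. 1) (strand u z) W"
    by (simp add: ed_def)
  also have "\<dots> = lookup (ed var z W) (u - sqfree_mono W)"
    using strand_ed[OF koszul_support_subset_keys[OF W], of z] koszul_support_subset_keys[OF W]
    by (simp add: strand_def)
  finally show ?thesis .
qed

lemma from_strand_in_span:
  fixes z :: "'n set \<Rightarrow> ('n, 'k::field) mpoly"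
  assumes z: "z \<in> cycles"
  shows "\<exists>c. from_strand u (strand u z) - (\<Sum>S\<in>Pow {1..t}. taylor_cycle S (c S)) \<in> boundaries"
proof -
  let ?g = "surviving_strand u z"
  have g_supp: "W \<in> koszul_support u" if "?g W \<noteq> 0" for W
    using that by (rule surviving_strand_supp)
  have cycle: "ed (\<lambda>_. 1) ?g W = 0" if W: "W \<in> koszul_support u" for W
    unfolding ed_surviving_strand[OF W] using z W unfolding cycles_def ext_ideal_def koszul_support_def
    by (simp add: poly_ideal_lookup)
  obtain h c where h: "\<And>W. h W \<noteq> 0 \<Longrightarrow> W \<in> koszul_support u"
      "\<And>W. W \<in> koszul_support u \<Longrightarrow> ?g W = ed (\<lambda>_. 1) h W +
        (if u = mono_lcm m (tops u) \<and> W = v ` tops u then c else 0)"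
    using koszul_support_homology[OF g_supp cycle] by blast
  define S where "S = tops u"
  define c' where "c' = (if u = mono_lcm m S then c else 0)"
  have "S \<in> Pow {1..t}"
    by (auto simp: S_def tops_def)
  then have sum: "(\<Sum>T\<in>Pow {1..t}. taylor_cycle T (if T = S then c' else 0)) = taylor_cycle S c'"
    by (subst sum.remove[of _ S]) (auto intro!: sum.neutral)
  have "from_strand u (strand u z) - taylor_cycle S c' - ed var (from_strand u h) \<in> ext_ideal"
    unfolding ext_ideal_def
  proof (rule CollectI, rule allI)
    fix W
    show "(from_strand u (strand u z) - taylor_cycle S c' - ed var (from_strand u h)) W \<in> poly_ideal"
    proof (cases "W \<in> koszul_support u")
      case True
      have "taylor_cycle S c' W = single (u - sqfree_mono W) (if W = v ` S then c' else 0)"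
        by (auto simp: taylor_cycle_def ebasis_def c'_def)
      moreover have "ed var (from_strand u h) W = single (u - sqfree_mono W) (ed (\<lambda>_. 1) h W)"
        using koszul_support_subset_keys[OF True] by (subst ed_from_strand) (auto dest!: h(1) koszul_support_subset_keys simp: from_strand_def)
      moreover have "from_strand u (strand u z) W =
          single (u - sqfree_mono W) (ed (\<lambda>_. 1) h W + (if W = v ` S then c' else 0))"
        using h(2)[OF True] True koszul_support_subset_keys[OF True] by (auto simp: surviving_strand_def from_strand_def S_def c'_def)
      ultimately show ?thesis
        by (simp add: single_add)
    next
      case False
      have F: "from_strand u f W \<in> poly_ideal" for f :: "'n set \<Rightarrow> 'k"
        using False by (auto simp: from_strand_def koszul_support_def intro: poly_ideal_single)
      have "taylor_cycle S c' W = 0"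
        using False v_image_in_koszul_support[of S] \<open>S \<in> Pow {1..t}\<close>
        by (auto simp: taylor_cycle_def ebasis_def c'_def)
      moreover have "ed var (from_strand u h) W \<in> poly_ideal"
        by (subst ed_from_strand) (auto dest!: h(1) koszul_support_subset_keys intro: F)
      ultimately show ?thesis
        using poly_ideal_diff[OF F[of "strand u z"]] by simp
    qed
  qed
  then have "from_strand u (strand u z) - (\<Sum>T\<in>Pow {1..t}. taylor_cycle T (if T = S then c' else 0)) \<in> boundaries"
    unfolding sum boundaries_def by blast
  then show ?thesis
    by (rule exI[of _ "\<lambda>T. if T = S then c' else 0"])
qed

theorem taylor_cycles_span:
  fixes z :: "'n set \<Rightarrow> ('n, 'k::field) mpoly"
  assumes z: "z \<in> cycles"
  shows "\<exists>c. z - (\<Sum>S\<in>Pow {1..t}. taylor_cycle S (c S)) \<in> boundaries"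
proof -
  obtain D where D: "finite D" "z = (\<Sum>u\<in>D. from_strand u (strand u z))"
    by (rule sum_strands)
  have "\<exists>c. (\<Sum>u\<in>D. from_strand u (strand u z)) - (\<Sum>S\<in>Pow {1..t}. taylor_cycle S (c S)) \<in> boundaries"
    using D(1)
  proof (induction D rule: finite_induct)
    case empty
    show ?case
      by (rule exI[of _ "\<lambda>_. 0"]) (simp flip: zero_fun_def)
  next
    case (insert u D)
    obtain c c' where c: "(\<Sum>u\<in>D. from_strand u (strand u z)) - (\<Sum>S\<in>Pow {1..t}. taylor_cycle S (c S)) \<in> boundaries"
        "from_strand u (strand u z) - (\<Sum>S\<in>Pow {1..t}. taylor_cycle S (c' S)) \<in> boundaries"
      using insert.IH from_strand_in_span[OF z, of u] by blast
    have "(\<Sum>u\<in>insert u D. from_strand u (strand u z)) - (\<Sum>S\<in>Pow {1..t}. taylor_cycle S (c S + c' S)) =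
        ((\<Sum>u\<in>D. from_strand u (strand u z)) - (\<Sum>S\<in>Pow {1..t}. taylor_cycle S (c S))) +
        (from_strand u (strand u z) - (\<Sum>S\<in>Pow {1..t}. taylor_cycle S (c' S)))"
      using insert.hyps by (simp add: taylor_cycle_add sum.distrib)
    also have "\<dots> \<in> boundaries"
      using c by (rule boundaries_add)
    finally show ?case
      by (rule exI[of _ "\<lambda>S. c S + c' S"])
  qed
  then show ?thesis
    using D(2) by simp
qed

text \<open>Only the summand of \<open>S\<close> contributes to the multidegree \<open>mono_lcm m S\<close>. There it is concentrated on
the set \<open>v ` S\<close>, where a boundary that vanishes on all other sets has to vanish, too.\<close>

theorem taylor_cycles_independent:
  fixes c :: "nat set \<Rightarrow> 'k::field"
  assumes b: "(\<Sum>S\<in>Pow {1..t}. taylor_cycle S (c S)) \<in> boundaries" and S: "S \<subseteq> {1..t}"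
  shows "c S = 0"
proof -
  define u where "u = mono_lcm m S"
  obtain h where h: "(\<Sum>T\<in>Pow {1..t}. taylor_cycle T (c T)) - ed var h \<in> ext_ideal"
    using b by (auto simp: boundaries_def)
  let ?g = "surviving_strand u h"
  have ed_g: "ed (\<lambda>_. 1) ?g W = (if W = v ` S then c S else 0)" if W: "W \<in> koszul_support u" for W
  proof -
    have "ed (\<lambda>_. 1) ?g W = lookup (ed var h W) (u - sqfree_mono W)"
      by (rule ed_surviving_strand[OF W])
    also have "\<dots> = lookup ((\<Sum>T\<in>Pow {1..t}. taylor_cycle T (c T)) W) (u - sqfree_mono W)"
    proof -
      have "((\<Sum>T\<in>Pow {1..t}. taylor_cycle T (c T)) - ed var h) W \<in> poly_ideal"
        using h unfolding ext_ideal_def by blast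
      then have "lookup (((\<Sum>T\<in>Pow {1..t}. taylor_cycle T (c T)) - ed var h) W)
          (u - sqfree_mono W) = 0"
        using W unfolding koszul_support_def by (blast intro: poly_ideal_lookup)
      then show ?thesis
        by (simp add: lookup_minus)
    qed
    also have "\<dots> = (\<Sum>T\<in>Pow {1..t}. lookup (taylor_cycle T (c T) W) (u - sqfree_mono W))"
      by (simp add: sum_fun_apply lookup_sum)
    also have "\<dots> = (\<Sum>T\<in>Pow {1..t}. if T = S then (if W = v ` S then c S else 0) else 0)"
    proof (rule sum.cong[OF refl])
      fix T assume T: "T \<in> Pow {1..t}"
      have "T = S" if "W = v ` T" "mono_lcm m T - sqfree_mono W = u - sqfree_mono W"
      proof -
        have "mono_lcm m T = u"
          using mono_diff_sqfree_add[OF koszul_support_subset_keys[OF W]] mono_diff_sqfree_add[of W "mono_lcm m T"]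
            v_image_subset_keys[of T] T that by auto
        then show ?thesis
          using lcm_inj S T by (auto simp: u_def)
      qed
      then show "lookup (taylor_cycle T (c T) W) (u - sqfree_mono W) =
          (if T = S then (if W = v ` S then c S else 0) else 0)"
        by (auto simp: taylor_cycle_def ebasis_def lookup_single when_def u_def)
    qed
    also have "\<dots> = (if W = v ` S then c S else 0)"
      using S by simp
    finally show ?thesis .
  qed
  have "ed (\<lambda>_. 1) ?g (v ` S) = 0"
  proof (rule koszul_support_not_boundary[OF S])
    show "W \<in> koszul_support (mono_lcm m S)" if "?g W \<noteq> 0" for W
      using surviving_strand_supp[OF that] by (simp add: u_def)
  qed (use ed_g u_def in auto)
  then show ?thesis
    using ed_g[of "v ` S"] v_image_in_koszul_support[OF S] by (simp add: u_def)
qed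

end

section \<open>Products of the basis cycles\<close>

lemma emul_ebasis_commute:
  "emul (ebasis U a) (ebasis V b) = (\<lambda>W. (- 1) ^ (card U * card V) * emul (ebasis V b) (ebasis U a) W)"
  by (cases "U \<inter> V = {}")
    (simp_all add: emul_ebasis ebasis_apply fun_eq_iff Int_commute[of V U] Un_commute[of V U]
      inv_sign_swap[of U V] ac_simps)

lemma product_of_generators:
  assumes "distinct (map v xs)"
  shows "foldr emul (map (\<lambda>i. ebasis {v i} 1) xs) (ebasis {} 1) = ebasis (v ` set xs) (1 :: 'r::comm_ring_1) \<or>
    foldr emul (map (\<lambda>i. ebasis {v i} 1) xs) (ebasis {} 1) = ebasis (v ` set xs) (- 1 :: 'r)"
  using assms
proof (induction xs)
  case (Cons i xs)
  have "v i \<notin> v ` set xs"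
    using Cons.prems by auto
  moreover have "(inv_sign {v i} (v ` set xs) :: 'r) = 1 \<or> (inv_sign {v i} (v ` set xs) :: 'r) = - 1"
    using inv_sign_cases[of "{v i}" "v ` set xs", where ?'r = 'r and ?'s = 'r] by auto
  ultimately show ?case
    using Cons.IH Cons.prems by (auto simp: emul_ebasis)
qed simp

context private_variables
begin

definition koszul_cycle :: "nat set \<Rightarrow> 'n set \<Rightarrow> ('n, 'k::field) mpoly"
  where "koszul_cycle S =
    emul (ebasis {} (mono_poly (mono_lcm m S - (\<Sum>i\<in>S. single (v i) 1))))
      (foldr emul (map (\<lambda>i. ebasis {v i} 1) (sorted_list_of_set S)) (ebasis {} 1))"

lemma sum_single_v: "S \<subseteq> {1..t} \<Longrightarrow> (\<Sum>i\<in>S. single (v i) 1) = sqfree_mono (v ` S)"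
  by (simp add: sqfree_mono_def sum.reindex inj_on_v)

lemma koszul_cycle_eq_taylor_cycle:
  assumes S: "S \<subseteq> {1..t}"
  obtains e :: "'k::field" where "e * e = 1" "koszul_cycle S = taylor_cycle S e"
proof -
  have fin: "finite S"
    using S finite_subset by blast
  have "distinct (map v (sorted_list_of_set S))"
    using inj_on_v[OF S] fin by (simp add: distinct_map)
  from product_of_generators[OF this, where 'r = "('n, 'k) mpoly"]
  have "koszul_cycle S = taylor_cycle S (1 :: 'k) \<or> koszul_cycle S = taylor_cycle S (- 1 :: 'k)"
    using fin unfolding koszul_cycle_def sum_single_v[OF S] taylor_cycle_def
    by (auto simp: emul_ebasis mono_poly_def single_uminus)
  then show ?thesis
    using that[of 1] that[of "- 1"] by auto
qed

lemma scalar_taylor_cycle: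
  "emul (ebasis {} (const_poly c)) (taylor_cycle S e) = taylor_cycle S (c * e)"
  by (simp add: taylor_cycle_def emul_ebasis const_poly_def mult_single)

lemma koszul_cycle_in_cycles: "S \<subseteq> {1..t} \<Longrightarrow> koszul_cycle S \<in> cycles"
  using koszul_cycle_eq_taylor_cycle[of S] taylor_cycle_in_cycles by metis

lemma koszul_cycle_empty: "koszul_cycle {} = ebasis {} 1"
proof -
  have "mono_lcm m {} = 0"
    by (rule mono_eqI) simp
  then show ?thesis
    by (simp add: koszul_cycle_def mono_poly_def)
qed

lemma koszul_cycle_commute:
  assumes S: "S \<subseteq> {1..t}" and T: "T \<subseteq> {1..t}"
  shows "emul (koszul_cycle S) (koszul_cycle T :: 'n set \<Rightarrow> ('n, 'k::field) mpoly) =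
    emul (ebasis {} (const_poly ((- 1) ^ (card S * card T)))) (emul (koszul_cycle T) (koszul_cycle S))"
    (is "_ = emul (ebasis {} (const_poly ?e)) _")
proof -
  obtain a where a: "koszul_cycle S = taylor_cycle S (a :: 'k)"
    using koszul_cycle_eq_taylor_cycle[OF S] by metis
  obtain b where b: "koszul_cycle T = taylor_cycle T (b :: 'k)"
    using koszul_cycle_eq_taylor_cycle[OF T] by metis
  have cards: "card (v ` S) = card S" "card (v ` T) = card T"
    using inj_on_v[OF S] inj_on_v[OF T] by (simp_all add: card_image)
  have "const_poly ?e = ((- 1) ^ (card S * card T) :: ('n, 'k) mpoly)"
    by (cases "even (card S * card T)") (simp_all add: const_poly_def single_uminus)
  then show ?thesis
    unfolding a b taylor_cycle_def emul_ebasis_empty_left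
    by (subst emul_ebasis_commute) (simp add: cards)
qed

text \<open>No variable divides both a generator in \<open>S\<close> and a generator in \<open>T\<close>, so at each variable one of the two
exponents is \<open>0\<close>, and their maximum is their sum.\<close>

lemma mono_lcm_Un_coprime:
  assumes fin: "finite S" "finite T"
    and coprime: "\<And>i j x. i \<in> S \<Longrightarrow> j \<in> T \<Longrightarrow> expo (m i) x = 0 \<or> expo (m j) x = 0"
  shows "mono_lcm m (S \<union> T) = mono_lcm m S + mono_lcm m T"
proof (rule mono_eqI)
  fix x
  let ?M = "\<lambda>S. Max (insert 0 ((\<lambda>i. expo (m i) x) ` S))"
  have "?M (S \<union> T) = max (?M S) (?M T)"
    using fin by (subst Max_Un[symmetric]) (auto simp: image_Un intro!: arg_cong[of _ _ Max])
  moreover have "?M S = 0 \<or> ?M T = 0"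
  proof (cases "\<exists>i\<in>S. expo (m i) x \<noteq> 0")
    case True
    then obtain i where "i \<in> S" "expo (m i) x \<noteq> 0"
      by blast
    then have "expo (m j) x = 0" if "j \<in> T" for j
      using coprime[of i j x] that by simp
    then have "insert 0 ((\<lambda>i. expo (m i) x) ` T) = {0}"
      by auto
    then show ?thesis
      by (simp only: Max_singleton simp_thms)
  next
    case False
    then have "insert 0 ((\<lambda>i. expo (m i) x) ` S) = {0}"
      by auto
    then show ?thesis
      by (simp only: Max_singleton simp_thms)
  qed
  ultimately show "expo (mono_lcm m (S \<union> T)) x = expo (mono_lcm m S + mono_lcm m T) x"
    by auto
qed

text \<open>There is no sign because the indices of \<open>S\<close> precede those of \<open>T\<close>: the generators are multiplied in
the order of their indices in both factors and in the product.\<close>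

lemma koszul_cycle_concat:
  assumes S: "S \<subseteq> {1..t}" and T: "T \<subseteq> {1..t}"
    and less: "\<And>i j. i \<in> S \<Longrightarrow> j \<in> T \<Longrightarrow> i < j"
    and coprime: "\<And>i j x. i \<in> S \<Longrightarrow> j \<in> T \<Longrightarrow> expo (m i) x = 0 \<or> expo (m j) x = 0"
  shows "emul (koszul_cycle S) (koszul_cycle T) = (koszul_cycle (S \<union> T) :: 'n set \<Rightarrow> ('n, 'k::field) mpoly)"
proof -
  have fin: "finite S" "finite T"
    using S T finite_subset by blast+
  have disj: "S \<inter> T = {}"
    using less by blast
  let ?g = "\<lambda>i. ebasis {v i} 1" and ?sq = "\<lambda>S. \<Sum>i\<in>S. single (v i) (1::nat)"
  have sorted: "sorted_list_of_set (S \<union> T) = sorted_list_of_set S @ sorted_list_of_set T"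
    by (rule sorted_distinct_set_unique)
      (use fin less disj in \<open>auto simp: sorted_append less_imp_le\<close>)
  have append: "foldr emul (xs @ ys) (ebasis {} 1) =
      emul (foldr emul xs (ebasis {} 1)) (foldr emul ys (ebasis {} 1))" for xs ys :: "('n set \<Rightarrow> ('n, 'k) mpoly) list"
    by (induction xs) (simp_all add: emul_assoc)
  have le: "expo (?sq U) x \<le> expo (mono_lcm m U) x" if "U \<subseteq> {1..t}" for U x
  proof -
    have "x \<in> v ` U \<Longrightarrow> 0 < expo (mono_lcm m U) x"
      using v_image_subset_keys[OF that] unfolding keys_mono[symmetric] by blast
    then show ?thesis
      unfolding sum_single_v[OF that] by (simp add: Suc_leI del: expo_mono_lcm)
  qed
  have lcm_Un: "mono_lcm m (S \<union> T) = mono_lcm m S + mono_lcm m T"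
    using fin by (rule mono_lcm_Un_coprime) (rule coprime)
  have "mono_lcm m (S \<union> T) - ?sq (S \<union> T) = (mono_lcm m S - ?sq S) + (mono_lcm m T - ?sq T)"
  proof (rule mono_eqI)
    fix x
    have "expo (?sq (S \<union> T)) x = expo (?sq S) x + expo (?sq T) x"
      using fin disj by (simp add: sum.union_disjoint)
    then show "expo (mono_lcm m (S \<union> T) - ?sq (S \<union> T)) x =
        expo ((mono_lcm m S - ?sq S) + (mono_lcm m T - ?sq T)) x"
      using le[OF S, of x] le[OF T, of x]
      unfolding lcm_Un by (simp del: expo_mono_lcm)
  qed
  then have "mono_poly (mono_lcm m (S \<union> T) - ?sq (S \<union> T)) =
      mono_poly (mono_lcm m S - ?sq S) * (mono_poly (mono_lcm m T - ?sq T) :: ('n, 'k) mpoly)"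
    by (simp add: mono_poly_def mult_single)
  moreover have "emul (emul (ebasis {} a) f) (emul (ebasis {} b) g) = emul (ebasis {} (a * b)) (emul f g)"
    for a b and f g :: "'n set \<Rightarrow> ('n, 'k) mpoly"
  proof -
    have "emul (emul (ebasis {} a) f) (emul (ebasis {} b) g) = emul (ebasis {} a) (emul (emul f (ebasis {} b)) g)"
      by (simp only: emul_assoc)
    also have "emul f (ebasis {} b) = emul (ebasis {} b) f"
      by (simp only: emul_ebasis_empty_left emul_ebasis_empty_right)
    also have "emul (ebasis {} a) (emul (emul (ebasis {} b) f) g) =
        emul (emul (ebasis {} a) (ebasis {} b)) (emul f g)"
      by (simp only: emul_assoc)
    finally show ?thesis
      by (simp add: emul_ebasis)
  qed
  ultimately show ?thesis
    unfolding koszul_cycle_def sorted map_append append by simp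
qed

text \<open>Let \<open>y\<close> divide both \<open>m i\<close> and \<open>m j\<close>. With \<open>D = v ` (S \<union> T)\<close> the product is a multiple of
\<open>x\<^sup>u\<^sup>-\<^sup>D T\<^sub>D\<close>, where \<open>u\<close> is the sum of the two exponents of the least common multiples. All generators in
\<open>S \<union> T\<close> have a smaller exponent at \<open>y\<close> than \<open>u\<close>. So \<open>y\<close> can be used up without
leaving the ideal: if \<open>y \<in> D\<close> the product is zero, and otherwise it is the differential of a multiple of
\<open>x\<^sup>u\<^sup>-\<^sup>D\<^sup>-\<^sup>y T\<^sub>y T\<^sub>D\<close>, all of whose other terms have a coefficient divisible by some \<open>m k\<close>.\<close>

lemma taylor_cycle_product_boundary:
  assumes S: "S \<subseteq> {1..t}" and T: "T \<subseteq> {1..t}"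
    and ij: "i \<in> S" "j \<in> T" "0 < expo (m i) y" "0 < expo (m j) y"
  shows "emul (taylor_cycle S a) (taylor_cycle T (b :: 'k::field)) \<in> boundaries"
proof (cases "S \<inter> T = {}")
  case False
  then have "v ` S \<inter> v ` T \<noteq> {}"
    by blast
  then show ?thesis
    by (simp add: taylor_cycle_def emul_ebasis)
next
  case True
  have fin: "finite S" "finite T"
    using S T finite_subset by blast+
  define u where "u = mono_lcm m S + mono_lcm m T"
  define D where "D = v ` (S \<union> T)"
  have disj: "v ` S \<inter> v ` T = {}"
    using True inj_on_image_Int[OF inj_on_v[of "{1..t}"] S T] by simp
  have le: "expo (m k) x \<le> expo u x" if "k \<in> S \<union> T" for k x
    using that expo_le_mono_lcm[OF fin(1), of k m x] expo_le_mono_lcm[OF fin(2), of k m x]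
    unfolding u_def by (auto simp del: expo_mono_lcm)
  have less_v: "expo (m k) (v r) < expo u (v r)" if "k \<in> S \<union> T" "r \<in> S \<union> T" "k \<noteq> r" for k r
  proof -
    have "expo (m k) (v r) < expo (m r) (v r)"
      by (rule v_max) (use that S T in auto)
    then show ?thesis
      using le[OF that(2), of "v r"] by linarith
  qed
  have less_y: "expo (m k) y < expo u y" if "k \<in> S \<union> T" for k
  proof -
    have "0 < expo (mono_lcm m S) y" "0 < expo (mono_lcm m T) y"
      using ij expo_le_mono_lcm[OF fin(1) ij(1), of m y] expo_le_mono_lcm[OF fin(2) ij(2), of m y]
      by linarith+
    then show ?thesis
      using that expo_le_mono_lcm[OF fin(1), of k m y] expo_le_mono_lcm[OF fin(2), of k m y]
      unfolding u_def by (auto simp del: expo_mono_lcm)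
  qed
  have keys: "D \<subseteq> keys u"
    using v_image_subset_keys[OF S] v_image_subset_keys[OF T]
    unfolding D_def u_def by (auto simp: keys_mono image_Un subset_iff simp del: expo_mono_lcm)
  have in_ideal: "in_mono_ideal (u - sqfree_mono W)"
    if k: "k \<in> S \<union> T" "v k \<notin> W \<or> v k = y" and W: "W \<subseteq> insert y D" for k W
  proof -
    have "expo (m k) x \<le> expo (u - sqfree_mono W) x" for x
    proof (cases "x \<in> W")
      case True
      then consider "x = y" | r where "r \<in> S \<union> T" "x = v r" "r \<noteq> k"
        using W k unfolding D_def by blast
      then have "expo (m k) x < expo u x"
        using less_y less_v k(1) by cases auto
      then show ?thesis
        using True by simp
    qed (use le k(1) in simp)
    then show ?thesis
      using k(1) S T unfolding in_mono_ideal_def mono_dvd_def by blast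
  qed
  obtain e where e: "emul (taylor_cycle S a) (taylor_cycle T b) =
      ebasis D (single (u - sqfree_mono D) e)"
  proof -
    have "mono_lcm m S - sqfree_mono (v ` S) + (mono_lcm m T - sqfree_mono (v ` T)) = u - sqfree_mono D"
    proof (rule mono_eqI)
      fix x
      have "x \<in> v ` S \<Longrightarrow> 0 < expo (mono_lcm m S) x" "x \<in> v ` T \<Longrightarrow> 0 < expo (mono_lcm m T) x"
        using v_image_subset_keys[OF S] v_image_subset_keys[OF T] unfolding keys_mono[symmetric] by blast+
      moreover have "x \<notin> v ` S \<or> x \<notin> v ` T"
        using disj by blast
      ultimately show "expo (mono_lcm m S - sqfree_mono (v ` S) + (mono_lcm m T - sqfree_mono (v ` T))) x =
          expo (u - sqfree_mono D) x"
        by (auto simp: u_def D_def image_Un simp del: expo_mono_lcm)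
    qed
    then show ?thesis
      using that[of "inv_sign (v ` S) (v ` T) * (a * b)"] disj
      by (simp add: taylor_cycle_def emul_ebasis mult_single single_inv_sign_mult D_def image_Un)
  qed
  show ?thesis
  proof (cases "y \<in> D")
    case True
    then obtain k where "k \<in> S \<union> T" "v k = y"
      unfolding D_def by blast
    then have "in_mono_ideal (u - sqfree_mono D)"
      by (intro in_ideal) auto
    then have "ebasis D (single (u - sqfree_mono D) e) \<in> ext_ideal"
      by (auto simp: ext_ideal_def ebasis_def intro: poly_ideal_single)
    then show ?thesis
      unfolding e using ext_ideal_subset_boundaries by blast
  next
    case False
    let ?V = "insert y D"
    define h where "h = ebasis ?V (single (u - sqfree_mono ?V) (inv_sign {y} D * e))"
    have y: "y \<in> keys u"
      using less_y[of i] ij(1) by (auto simp: keys_mono)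
    have times_var: "var w * single (u - sqfree_mono ?V) c =
        single (u - sqfree_mono (?V - {w})) c" if w: "w \<in> ?V" for w and c :: 'k
    proof -
      have "single w 1 + (u - sqfree_mono ?V) = u - sqfree_mono (?V - {w})"
        using w y keys by (intro mono_eqI) (auto simp: lookup_single when_def keys_mono subset_iff)
      then show ?thesis
        by (simp add: var_def mono_poly_def mult_single)
    qed
    have "(emul (taylor_cycle S a) (taylor_cycle T b) - ed var h) W \<in> poly_ideal" for W
    proof (cases "\<exists>w\<in>?V. W = ?V - {w}")
      case False
      then have "ed var h W = 0"
        unfolding h_def by (intro ed_ebasis_other) blast
      moreover have "W \<noteq> D"
        using False \<open>y \<notin> D\<close> by blast
      ultimately show ?thesis
        unfolding e by (simp add: ebasis_def)
    next
      case True
      then obtain w where w: "w \<in> ?V" "W = ?V - {w}"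
        by blast
      have ed_h: "ed var h W = inv_sign {w} W * single (u - sqfree_mono W) (inv_sign {y} D * e)"
        unfolding h_def w(2) ed_ebasis_remove[OF w(1)] times_var[OF w(1)] ..
      show ?thesis
      proof (cases "w = y")
        case True
        then have W: "W = D"
          using w \<open>y \<notin> D\<close> by blast
        then have "ed var h W = single (u - sqfree_mono D) e"
          using ed_h unfolding True W single_inv_sign_mult by simp
        then show ?thesis
          unfolding e W by (simp add: ebasis_def)
      next
        case False
        then obtain k where "k \<in> S \<union> T" "w = v k"
          using w unfolding D_def by blast
        then have "in_mono_ideal (u - sqfree_mono W)"
          using w by (intro in_ideal[of k]) auto
        then have "ed var h W \<in> poly_ideal"
          unfolding ed_h by (intro poly_ideal_mult poly_ideal_single disjI2)
        moreover have "W \<noteq> D"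
          using w False \<open>y \<notin> D\<close> by blast
        ultimately show ?thesis
          unfolding e by (simp add: ebasis_def poly_ideal_minus)
      qed
    qed
    then show ?thesis
      unfolding boundaries_def ext_ideal_def by blast
  qed
qed

lemma koszul_cycle_product_boundary:
  assumes "S \<subseteq> {1..t}" "T \<subseteq> {1..t}" "i \<in> S" "j \<in> T" "0 < expo (m i) y" "0 < expo (m j) y"
  shows "emul (koszul_cycle S) (koszul_cycle T) \<in> boundaries"
  using taylor_cycle_product_boundary[OF assms] koszul_cycle_eq_taylor_cycle[OF assms(1)]
    koszul_cycle_eq_taylor_cycle[OF assms(2)] by metis

end

section \<open>The Koszul homology algebra\<close>

lemma poly_ring_simps [simp]:
  "carrier poly_ring = UNIV" "p \<otimes>\<^bsub>poly_ring\<^esub> q = p * q" "p \<oplus>\<^bsub>poly_ring\<^esub> q = p + q"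
  "\<one>\<^bsub>poly_ring\<^esub> = 1" "\<zero>\<^bsub>poly_ring\<^esub> = 0"
  by (simp_all add: poly_ring_def ring_of_type_algebra_def)

lemma ring_poly_ring: "ring (poly_ring :: ('n, 'k::field) mpoly ring)"
  unfolding poly_ring_def by (rule ring_from_type_algebra)

lemma poly_ring_minus [simp]: "\<ominus>\<^bsub>poly_ring\<^esub> p = - (p :: ('n, 'k::field) mpoly)"
proof -
  interpret ring "poly_ring :: ('n, 'k) mpoly ring"
    by (rule ring_poly_ring)
  show ?thesis
    by (rule minus_equality) simp_all
qed

lemma sum_monomials: "p = (\<Sum>a\<in>keys p. single a (lookup p a))"
proof (rule poly_mapping_eqI)
  fix b
  show "lookup p b = lookup
      (\<Sum>a\<in>keys p. single a (lookup p a)) b"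
    by (cases "b \<in> keys p") (simp_all add: lookup_sum lookup_single when_def in_keys_iff)
qed

lemma ideal_image:
  assumes "ring_hom_ring R S h" "ideal J R" and surj: "h ` carrier R = carrier S"
  shows "ideal (h ` J) S"
proof -
  interpret ring_hom_ring R S h
    by fact
  interpret J: ideal J R
    by fact
  show ?thesis
  proof (rule idealI)
    show "subgroup (h ` J) (add_monoid S)"
      by (rule img_is_add_subgroup) (rule J.a_subgroup)
  next
    fix a x assume "a \<in> h ` J" "x \<in> carrier S"
    then obtain b y where b: "b \<in> J" "a = h b" and y: "y \<in> carrier R" "x = h y"
      using surj by blast
    then have "b \<in> carrier R"
      using J.Icarr by blast
    then show "x \<otimes>\<^bsub>S\<^esub> a \<in> h ` J" "a \<otimes>\<^bsub>S\<^esub> x \<in> h ` J"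
      using b y J.I_l_closed J.I_r_closed by (metis hom_mult imageI)+
  qed (rule S.ring_axioms)
qed

context private_variables
begin

lemma ideal_poly_ideal: "ideal poly_ideal (poly_ring :: ('n, 'k::field) mpoly ring)"
proof -
  interpret ring "poly_ring :: ('n, 'k) mpoly ring"
    by (rule ring_poly_ring)
  show ?thesis
  proof (rule idealI)
    show "subgroup poly_ideal (add_monoid (poly_ring :: ('n, 'k) mpoly ring))"
    proof (rule subgroup.intro, goal_cases)
      case (4 p)
      then show ?case
        unfolding a_inv_def[symmetric] by (simp add: poly_ideal_minus)
    qed (simp_all add: poly_ideal_add)
  qed (auto simp: poly_ideal_mult poly_ideal_mult_right ring_axioms)
qed

text \<open>The ideal in terms of exponents: a polynomial lies in it if each of its monomials is divisible by
a generator. This allows treating the monomials of a polynomial separately.\<close>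

lemma Idl_monomials: "Idl\<^bsub>poly_ring\<^esub> (mono_poly ` m ` {1..t}) = (poly_ideal :: ('n, 'k::field) mpoly set)"
proof -
  interpret ring "poly_ring :: ('n, 'k) mpoly ring"
    by (rule ring_poly_ring)
  let ?J = "Idl\<^bsub>poly_ring\<^esub> (mono_poly ` m ` {1..t}) :: ('n, 'k) mpoly set"
  have "mono_poly (m i) \<in> (poly_ideal :: ('n, 'k) mpoly set)" if "i \<in> {1..t}" for i
    unfolding mono_poly_def using that
    by (intro poly_ideal_single disjI2) (auto simp: in_mono_ideal_def mono_dvd_def)
  then have "?J \<subseteq> poly_ideal"
    by (intro genideal_minimal ideal_poly_ideal) auto
  moreover have "p \<in> ?J" if p: "p \<in> poly_ideal" for p
  proof -
    interpret J: ideal ?J poly_ring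
      by (rule genideal_ideal) simp
    have sum: "(\<Sum>a\<in>A. f a) \<in> ?J" if "\<And>a. a \<in> A \<Longrightarrow> f a \<in> ?J" for A and f :: "'n mono \<Rightarrow> ('n, 'k) mpoly"
      using that
    proof (induction A rule: infinite_finite_induct)
      case (insert a A)
      then show ?case
        using J.a_closed[of "f a" "\<Sum>a\<in>A. f a"] by simp
    qed (use J.zero_closed in auto)
    have "single a c \<in> ?J" if a: "a \<in> keys p" for a c
    proof -
      obtain i where i: "i \<in> {1..t}" "mono_dvd (m i) a"
        using p a by (auto simp: poly_ideal_def in_mono_ideal_def)
      then have "a - m i + m i = a"
        by (intro mono_eqI) (auto simp: mono_dvd_def)
      then have "single a c = single (a - m i) c * mono_poly (m i)"
        by (simp add: mono_poly_def mult_single)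
      moreover have "mono_poly (m i) \<in> ?J"
        using i(1) genideal_self[of "mono_poly ` m ` {1..t}"] by auto
      ultimately show ?thesis
        using J.I_l_closed[of "mono_poly (m i)" "single (a - m i) c"] by simp
    qed
    then show ?thesis
      by (subst sum_monomials[of p]) (rule sum)
  qed
  ultimately show ?thesis
    by blast
qed

abbreviation "Q \<equiv> quot_ring poly_ideal"
abbreviation "cls \<equiv> quot_cls poly_ideal"
abbreviation "KR \<equiv> koszul_ring poly_ideal"

lemma ring_Q: "ring (Q :: ('n, 'k::field) mpoly set ring)"
  unfolding quot_ring_def by (rule ideal.quotient_is_ring) (rule ideal_poly_ideal)

lemma ring_hom_cls: "ring_hom_ring poly_ring Q (cls :: ('n, 'k::field) mpoly \<Rightarrow> _)"
  unfolding quot_ring_def quot_cls_def[abs_def]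
  by (rule ideal.rcos_ring_hom_ring) (rule ideal_poly_ideal)

lemma cls_simps:
  "cls (p * q) = cls p \<otimes>\<^bsub>Q\<^esub> cls q" "cls (p + q) = cls p \<oplus>\<^bsub>Q\<^esub> cls q"
  "cls (- p) = \<ominus>\<^bsub>Q\<^esub> cls p" "cls p \<in> carrier Q"
  "cls (1 :: ('n, 'k) mpoly) = \<one>\<^bsub>Q\<^esub>" "cls (0 :: ('n, 'k) mpoly) = \<zero>\<^bsub>Q\<^esub>"
  for p q :: "('n, 'k::field) mpoly"
proof -
  interpret ring_hom_ring poly_ring Q "cls :: ('n, 'k) mpoly \<Rightarrow> _"
    by (rule ring_hom_cls)
  show "cls (p * q) = cls p \<otimes>\<^bsub>Q\<^esub> cls q" "cls (p + q) = cls p \<oplus>\<^bsub>Q\<^esub> cls q"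
      "cls (- p) = \<ominus>\<^bsub>Q\<^esub> cls p" "cls p \<in> carrier Q"
      "cls (1 :: ('n, 'k) mpoly) = \<one>\<^bsub>Q\<^esub>" "cls (0 :: ('n, 'k) mpoly) = \<zero>\<^bsub>Q\<^esub>"
    using hom_mult[of p q] hom_add[of p q] hom_a_inv[of p] hom_one hom_zero hom_closed[of p] by simp_all
qed

lemma cls_surj: "x \<in> carrier Q \<Longrightarrow> \<exists>p. x = cls p"
  by (auto simp: quot_ring_def FactRing_def A_RCOSETS_def' quot_cls_def)

lemma cls_eq_iff: "cls p = cls q \<longleftrightarrow> p - q \<in> poly_ideal" for p q :: "('n, 'k::field) mpoly"
proof -
  interpret ring "poly_ring :: ('n, 'k) mpoly ring"
    by (rule ring_poly_ring)
  show ?thesis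
    unfolding quot_cls_def using quotient_eq_iff_same_a_r_cos[OF ideal_poly_ideal, of p q]
    by (simp add: a_minus_def)
qed

lemma finsum_cls:
  "finite A \<Longrightarrow> finsum Q (\<lambda>x. cls (f x)) A = cls (\<Sum>x\<in>A. f x :: ('n, 'k::field) mpoly)"
proof -
  interpret Q: ring "Q :: ('n, 'k) mpoly set ring"
    by (rule ring_Q)
  show "finite A \<Longrightarrow> finsum Q (\<lambda>x. cls (f x)) A = cls (\<Sum>x\<in>A. f x)"
    by (induction A rule: finite_induct) (simp_all add: cls_simps Q.finsum_insert Pi_def)
qed

lemma signed_cls: "signed Q n (cls p) = cls ((- 1) ^ n * p)"
  by (cases "even n") (simp_all add: signed_def cls_simps(3))

text \<open>The Koszul complex over the quotient is the image of the one over the polynomial ring. Its ring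
axioms and those of its homology are transported along this map.\<close>

definition reduce :: "('n set \<Rightarrow> ('n, 'k::field) mpoly) \<Rightarrow> ('n, 'k) koszul"
  where "reduce f = (\<lambda>W. cls (f W))"

lemma KR_simps:
  "carrier KR = {f. \<forall>W. f W \<in> carrier Q}" "\<one>\<^bsub>KR\<^esub> = (\<lambda>W. if W = {} then \<one>\<^bsub>Q\<^esub> else \<zero>\<^bsub>Q\<^esub>)"
  "\<zero>\<^bsub>KR\<^esub> = (\<lambda>W. \<zero>\<^bsub>Q\<^esub>)" "f \<oplus>\<^bsub>KR\<^esub> g = (\<lambda>W. f W \<oplus>\<^bsub>Q\<^esub> g W)"
  by (simp_all add: koszul_ring_def ext_ring_def)

lemma carrier_KR: "carrier KR = range reduce"
proof
  show "carrier KR \<subseteq> range reduce"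
  proof
    fix f assume "f \<in> carrier KR"
    then have "\<forall>W. \<exists>p. f W = cls p"
      by (auto simp: KR_simps intro: cls_surj)
    then obtain g where "\<And>W. f W = cls (g W)"
      by metis
    then show "f \<in> range reduce"
      by (auto simp: reduce_def)
  qed
  show "range reduce \<subseteq> carrier KR"
    by (auto simp: KR_simps reduce_def cls_simps)
qed

lemma reduce_mult: "reduce (emul f g) = reduce f \<otimes>\<^bsub>KR\<^esub> reduce g"
  by (simp add: koszul_ring_def ext_ring_def reduce_def emul_def inv_sign_def signed_cls finsum_cls
      flip: cls_simps)

lemma reduce_add: "reduce (f + g) = reduce f \<oplus>\<^bsub>KR\<^esub> reduce g"
  by (simp add: KR_simps reduce_def cls_simps)

lemma reduce_zero: "reduce 0 = \<zero>\<^bsub>KR\<^esub>"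
  by (simp add: KR_simps reduce_def cls_simps)

lemma reduce_one: "reduce (ebasis {} 1) = \<one>\<^bsub>KR\<^esub>"
  by (simp add: KR_simps reduce_def cls_simps ebasis_def fun_eq_iff)

lemma reduce_eq_iff: "reduce f = reduce g \<longleftrightarrow> f - g \<in> ext_ideal"
  by (simp add: reduce_def fun_eq_iff cls_eq_iff ext_ideal_def)

lemma koszul_d_reduce: "koszul_d poly_ideal (reduce f) = reduce (ed var f)"
proof
  fix W :: "'n set"
  have "{(u, x). u = w \<and> x \<in> W \<and> x < u} = Pair w ` {u \<in> W. u < w}" for w
    by auto
  then have "card {(u, x). u \<in> {w} \<and> x \<in> W \<and> x < u} = card {u \<in> W. u < w}" for w
    by (simp add: card_image inj_on_def)
  then show "koszul_d poly_ideal (reduce f) W = reduce (ed var f) W"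
    by (simp add: koszul_d_def koszul_diff_def reduce_def ed_def inv_sign_def signed_cls finsum_cls
        flip: cls_simps)
qed

text \<open>The ring of chains whose reductions are cycles. Its quotient by \<open>boundaries\<close> is the
homology algebra, by \<open>hclass_hom\<close>, \<open>carrier_HK\<close> and \<open>hclass_eq_iff\<close>.\<close>

definition cycle_ring :: "('n set \<Rightarrow> ('n, 'k::field) mpoly) ring"
  where "cycle_ring = \<lparr>carrier = cycles, monoid.mult = emul, one = ebasis {} 1, ring.zero = 0, add = (+)\<rparr>"

lemma cycle_ring_simps [simp]:
  "carrier cycle_ring = cycles" "f \<otimes>\<^bsub>cycle_ring\<^esub> g = emul f g" "f \<oplus>\<^bsub>cycle_ring\<^esub> g = f + g"
  "\<one>\<^bsub>cycle_ring\<^esub> = ebasis {} 1" "\<zero>\<^bsub>cycle_ring\<^esub> = 0"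
  by (simp_all add: cycle_ring_def)

lemma ebasis_empty_in_cycles: "ebasis {} p \<in> cycles"
proof -
  have "ed var (ebasis {} p) = 0"
    unfolding fun_eq_iff zero_fun_apply by (intro allI ed_ebasis_other) simp
  then show ?thesis
    by (simp add: cycles_def)
qed

lemma cycles_zero: "0 \<in> cycles"
  by (simp add: cycles_def)

lemma ring_cycle_ring: "ring (cycle_ring :: ('n set \<Rightarrow> ('n, 'k::field) mpoly) ring)"
proof (rule ringI)
  show "abelian_group (cycle_ring :: ('n set \<Rightarrow> ('n, 'k) mpoly) ring)"
  proof (rule abelian_groupI)
    fix f :: "'n set \<Rightarrow> ('n, 'k) mpoly" assume "f \<in> carrier cycle_ring"
    then show "\<exists>g\<in>carrier cycle_ring. g \<oplus>\<^bsub>cycle_ring\<^esub> f = \<zero>\<^bsub>cycle_ring\<^esub>"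
      by (intro bexI[of _ "- f"]) (simp_all add: cycles_minus)
  qed (simp_all add: cycles_add cycles_zero add.assoc add.commute)
  show "Group.monoid (cycle_ring :: ('n set \<Rightarrow> ('n, 'k) mpoly) ring)"
    by (rule monoidI) (simp_all add: cycles_emul ebasis_empty_in_cycles emul_assoc)
qed (simp_all add: emul_add_left emul_add_right)

lemma ideal_boundaries: "ideal boundaries (cycle_ring :: ('n set \<Rightarrow> ('n, 'k::field) mpoly) ring)"
proof -
  interpret ring "cycle_ring :: ('n set \<Rightarrow> ('n, 'k) mpoly) ring"
    by (rule ring_cycle_ring)
  have minus: "\<ominus>\<^bsub>cycle_ring\<^esub> f = - f" if "f \<in> cycles" for f :: "'n set \<Rightarrow> ('n, 'k) mpoly"
    by (rule minus_equality) (use that cycles_minus in auto)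
  show ?thesis
  proof (rule idealI)
    show "subgroup boundaries (add_monoid (cycle_ring :: ('n set \<Rightarrow> ('n, 'k) mpoly) ring))"
    proof (rule subgroup.intro, goal_cases)
      case (4 b)
      then show ?case
        unfolding a_inv_def[symmetric] minus[OF subsetD[OF boundaries_subset_cycles 4]]
        by (rule boundaries_minus)
    qed (use boundaries_subset_cycles in \<open>simp_all add: boundaries_add\<close>)
  qed (simp_all add: boundaries_emul_left boundaries_emul_right ring_axioms)
qed

abbreviation "KZ \<equiv> KR\<lparr>carrier := {z \<in> carrier KR. koszul_d poly_ideal z = \<zero>\<^bsub>KR\<^esub>}\<rparr>"

lemma carrier_KZ: "carrier KZ = (reduce ` cycles :: ('n, 'k::field) koszul set)"
proof -
  have "reduce z \<in> carrier KZ \<longleftrightarrow> z \<in> cycles" for z :: "'n set \<Rightarrow> ('n, 'k::field) mpoly"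
    by (simp add: carrier_KR koszul_d_reduce reduce_eq_iff cycles_def rangeI flip: reduce_zero)
  moreover have "carrier KZ \<subseteq> (range reduce :: ('n, 'k) koszul set)"
    by (auto simp: carrier_KR)
  ultimately show ?thesis
    by blast
qed

lemma reduce_hom: "reduce \<in> ring_hom cycle_ring KZ"
  by (rule ring_hom_memI) (use carrier_KZ in \<open>auto simp: reduce_mult reduce_add reduce_one\<close>)

lemma ring_KZ: "ring (KZ :: ('n, 'k::field) koszul ring)"
proof -
  interpret ring "cycle_ring :: ('n set \<Rightarrow> ('n, 'k) mpoly) ring"
    by (rule ring_cycle_ring)
  have "ring (KZ\<lparr>carrier := reduce ` cycles, zero := reduce 0\<rparr> :: ('n, 'k) koszul ring)"
    using ring_hom_imp_img_ring[OF reduce_hom] by simp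
  also have "KZ\<lparr>carrier := reduce ` cycles, zero := reduce 0\<rparr> = (KZ :: ('n, 'k) koszul ring)"
    unfolding reduce_zero carrier_KZ[symmetric] by simp
  finally show ?thesis .
qed

lemma reduce_ring_hom: "ring_hom_ring cycle_ring KZ reduce"
  by (rule ring_hom_ringI2[OF ring_cycle_ring ring_KZ reduce_hom])

lemma image_koszul_d: "koszul_d poly_ideal ` carrier KR = reduce ` boundaries"
proof
  show "koszul_d poly_ideal ` carrier KR \<subseteq> reduce ` boundaries"
    by (auto simp: carrier_KR koszul_d_reduce intro: ed_in_boundaries)
  show "reduce ` boundaries \<subseteq> koszul_d poly_ideal ` carrier KR"
  proof
    fix x assume "x \<in> reduce ` boundaries"
    then obtain b h where "x = reduce b" "b - ed var h \<in> ext_ideal"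
      by (auto simp: boundaries_def)
    then have "x = koszul_d poly_ideal (reduce h)"
      by (simp add: koszul_d_reduce reduce_eq_iff)
    then show "x \<in> koszul_d poly_ideal ` carrier KR"
      by (auto simp: carrier_KR)
  qed
qed

lemma ideal_image_koszul_d: "ideal (koszul_d poly_ideal ` carrier KR) KZ"
  unfolding image_koszul_d
  by (rule ideal_image[OF reduce_ring_hom ideal_boundaries]) (simp only: carrier_KZ cycle_ring_simps)

definition hclass :: "('n set \<Rightarrow> ('n, 'k::field) mpoly) \<Rightarrow> ('n, 'k) koszul set"
  where "hclass z = homology_class KR (koszul_d poly_ideal) (reduce z)"

lemma hclass_coset: "hclass z = (koszul_d poly_ideal ` carrier KR) +>\<^bsub>KZ\<^esub> reduce z"
  by (simp add: hclass_def homology_class_def a_r_coset_def r_coset_def)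

lemma HK_eq_Quot: "HK poly_ideal = KZ Quot (koszul_d poly_ideal ` carrier KR)"
  by (simp add: HK_def homology_ring_def)

lemma ring_HK: "ring (HK poly_ideal :: ('n, 'k::field) koszul set ring)"
  unfolding HK_eq_Quot by (rule ideal.quotient_is_ring) (rule ideal_image_koszul_d)

lemma hclass_hom: "hclass \<in> ring_hom cycle_ring (HK poly_ideal)"
proof -
  have "(\<lambda>z. (koszul_d poly_ideal ` carrier KR) +>\<^bsub>KZ\<^esub> z) \<circ> reduce \<in>
      ring_hom cycle_ring (KZ Quot (koszul_d poly_ideal ` carrier KR))"
    by (rule ring_hom_trans[OF reduce_hom ideal.rcos_ring_hom[OF ideal_image_koszul_d]])
  then show ?thesis
    unfolding HK_eq_Quot by (simp add: comp_def flip: hclass_coset)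
qed

lemma carrier_HK: "carrier (HK poly_ideal) = hclass ` cycles"
proof -
  have "carrier (HK poly_ideal) =
      (\<lambda>z. (koszul_d poly_ideal ` carrier KR) +>\<^bsub>KZ\<^esub> z) ` carrier KZ"
    unfolding HK_eq_Quot FactRing_def A_RCOSETS_def' by auto
  also have "\<dots> = hclass ` cycles"
    unfolding carrier_KZ image_image hclass_coset ..
  finally show ?thesis .
qed

lemma hclass_eq_iff:
  fixes z z' :: "'n set \<Rightarrow> ('n, 'k::field) mpoly"
  assumes "z \<in> cycles" "z' \<in> cycles"
  shows "hclass z = hclass z' \<longleftrightarrow> z - z' \<in> boundaries"
proof -
  interpret KZ: ring "KZ :: ('n, 'k) koszul ring"
    by (rule ring_KZ)
  interpret ring_hom_ring cycle_ring "KZ :: ('n, 'k) koszul ring" reduce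
    by (rule reduce_ring_hom)
  have car: "reduce z \<in> carrier KZ" "reduce z' \<in> carrier KZ"
    using assms unfolding carrier_KZ by blast+
  have minus: "\<ominus>\<^bsub>cycle_ring\<^esub> z' = - z'"
    by (rule R.minus_equality) (use assms cycles_minus in auto)
  have "reduce z \<ominus>\<^bsub>KZ\<^esub> reduce z' = reduce (z - z')"
    using hom_add[of z "- z'"] hom_a_inv[of z'] assms cycles_minus[OF assms(2)] minus
    by (simp add: a_minus_def)
  then have "hclass z = hclass z' \<longleftrightarrow> reduce (z - z') \<in> reduce ` boundaries"
    using KZ.quotient_eq_iff_same_a_r_cos[OF ideal_image_koszul_d car]
    unfolding hclass_coset image_koszul_d by simp
  also have "\<dots> \<longleftrightarrow> z - z' \<in> boundaries"
  proof
    assume "reduce (z - z') \<in> reduce ` boundaries"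
    then obtain b where b: "b \<in> boundaries" "z - z' - b \<in> ext_ideal"
      by (auto simp: reduce_eq_iff)
    then have "(z - z' - b) + b \<in> boundaries"
      using ext_ideal_subset_boundaries by (intro boundaries_add) auto
    then show "z - z' \<in> boundaries"
      by simp
  qed blast
  finally show ?thesis .
qed

lemma HK_scalar_eq: "HK_scalar poly_ideal c = hclass (ebasis {} (const_poly c))"
proof -
  have "ext_const Q (cls (const_poly c)) = reduce (ebasis {} (const_poly c))"
    by (auto simp: ext_const_def reduce_def ebasis_def cls_simps fun_eq_iff)
  then show ?thesis
    by (simp add: HK_scalar_def hclass_def)
qed

lemma HK_f_eq: "HK_f poly_ideal m v S = (hclass (koszul_cycle S) :: ('n, 'k::field) koszul set)"
proof -
  have const: "ext_const Q (cls p) = reduce (ebasis {} p)" for p :: "('n, 'k) mpoly"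
    by (auto simp: ext_const_def reduce_def ebasis_def cls_simps fun_eq_iff)
  have gen: "ext_gen Q x = (reduce (ebasis {x} 1) :: ('n, 'k) koszul)" for x
    by (auto simp: ext_gen_def reduce_def ebasis_def cls_simps fun_eq_iff)
  have "ring_prod KR (map (\<lambda>i. ext_gen Q (v i)) xs) =
      (reduce (foldr emul (map (\<lambda>i. ebasis {v i} 1) xs) (ebasis {} 1)) :: ('n, 'k) koszul)" for xs
    by (induction xs) (simp_all add: ring_prod_def gen reduce_mult reduce_one)
  then show ?thesis
    by (simp add: HK_f_def hclass_def koszul_f_def koszul_cycle_def const reduce_mult)
qed

end

section \<open>Sets without large gaps and d-partitions\<close>

definition far :: "nat \<Rightarrow> nat set \<Rightarrow> nat set \<Rightarrow> bool"
  where "far d T U \<longleftrightarrow> T \<noteq> {} \<and> U \<noteq> {} \<and> (\<forall>i\<in>T. \<forall>j\<in>U. i + d \<le> j)"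

lemma far_trans: "far d T U \<Longrightarrow> far d U V \<Longrightarrow> far d T V"
  unfolding far_def by (metis add_leD1 add_le_mono1 all_not_in_conv order_trans)

lemma far_disjoint: "1 \<le> d \<Longrightarrow> far d T U \<Longrightarrow> T \<inter> U = {}"
  unfolding far_def by fastforce

lemma far_iff_Max_Min:
  "finite T \<Longrightarrow> finite U \<Longrightarrow> T \<noteq> {} \<Longrightarrow> U \<noteq> {} \<Longrightarrow> far d T U \<longleftrightarrow> Max T + d \<le> Min U"
proof
  assume *: "finite T" "finite U" "T \<noteq> {}" "U \<noteq> {}"
  then show "far d T U \<Longrightarrow> Max T + d \<le> Min U"
    unfolding far_def by (metis Max_in Min_in)
  assume le: "Max T + d \<le> Min U"
  have "i + d \<le> j" if "i \<in> T" "j \<in> U" for i j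
  proof -
    have "i \<le> Max T" "Min U \<le> j"
      using * that by simp_all
    then show ?thesis
      using le by linarith
  qed
  then show "far d T U"
    using * by (simp add: far_def)
qed

text \<open>Take the first element of \<open>T\<close> after \<open>a\<close> and then the last element of \<open>S\<close> before it: they are
consecutive in the union.\<close>

lemma small_gap_crossing:
  assumes fin: "finite S" "finite T" and gaps: "gaps_lt d (S \<union> T)"
    and ab: "a \<in> S" "b \<in> T" "a < b"
  obtains a' b' where "a' \<in> S" "b' \<in> T" "a' < b'" "b' - a' \<le> d - 1"
proof -
  define b' where "b' = Min {x \<in> T. a < x}"
  define a' where "a' = Max {x \<in> S. x < b'}"
  have b': "b' \<in> T" "a < b'"
  proof -
    have "b' \<in> {x \<in> T. a < x}"
      unfolding b'_def using fin ab by (intro Min_in) auto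
    then show "b' \<in> T" "a < b'"
      by simp_all
  qed
  have a': "a' \<in> S" "a' < b'"
  proof -
    have "a' \<in> {x \<in> S. x < b'}"
      unfolding a'_def using fin ab b' by (intro Max_in) auto
    then show "a' \<in> S" "a' < b'"
      by simp_all
  qed
  have "a \<le> a'"
    using fin ab b' by (simp add: a'_def)
  have "{a'<..<b'} \<inter> (S \<union> T) = {}"
  proof -
    have "x \<le> a'" if "x \<in> S" "x < b'" for x
      using fin that by (simp add: a'_def)
    moreover have "b' \<le> x" if "x \<in> T" "a' < x" for x
      unfolding b'_def using fin that \<open>a \<le> a'\<close> by (intro Min_le) auto
    ultimately show ?thesis
      by fastforce
  qed
  then have "b' - a' \<le> d - 1"
    using gaps a' b' unfolding gaps_lt_def by blast
  then show ?thesis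
    using that a' b' by blast
qed

lemma BB_finite: "S \<in> BB d t \<Longrightarrow> finite S"
  unfolding BB_def using finite_subset by blast

lemma BB_close_pair:
  assumes d: "1 \<le> d" and S: "S \<in> BB d t" and T: "T \<in> BB d t"
    and close: "S \<union> T \<in> BB d t \<or> S \<inter> T \<noteq> {}"
  obtains i j where "i \<in> S" "j \<in> T" "i < j + d" "j < i + d"
proof (cases "S \<inter> T = {}")
  case False
  then obtain i where "i \<in> S" "i \<in> T"
    by blast
  then show ?thesis
    using that d by fastforce
next
  case True
  have fin: "finite S" "finite T"
    using S T BB_finite by blast+
  obtain a b where ab: "a \<in> S" "b \<in> T"
    using S T unfolding BB_def by blast
  then have "a \<noteq> b"
    using True by blast
  have gaps: "gaps_lt d (S \<union> T)"
    using close True by (simp add: BB_def)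
  show ?thesis
  proof (cases "a < b")
    case True
    then obtain a' b' where "a' \<in> S" "b' \<in> T" "a' < b'" "b' - a' \<le> d - 1"
      using small_gap_crossing[OF fin gaps ab] by blast
    then show ?thesis
      using that[of a' b'] d by linarith
  next
    case False
    then have "b < a"
      using \<open>a \<noteq> b\<close> by simp
    moreover have "gaps_lt d (T \<union> S)"
      using gaps by (simp add: Un_commute)
    ultimately obtain a' b' where "b' \<in> T" "a' \<in> S" "b' < a'" "a' - b' \<le> d - 1"
      using small_gap_crossing[OF fin(2,1) _ ab(2,1)] by blast
    then show ?thesis
      using that[of a' b'] d by linarith
  qed
qed

text \<open>A set without large gaps cannot jump over an interval of length \<open>d\<close>.\<close>

lemma gaps_lt_one_side:
  assumes d: "1 \<le> d" and fin: "finite U" and gaps: "gaps_lt d U"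
    and ab: "{a<..<b} \<inter> U = {}" "a + d \<le> b"
  shows "(\<forall>x\<in>U. x \<le> a) \<or> (\<forall>x\<in>U. b \<le> x)"
proof (rule ccontr)
  assume "\<not> ?thesis"
  then obtain x y where xy: "x \<in> U" "x < b" "y \<in> U" "a < y"
    by (meson linorder_not_le)
  have split: "z \<le> a \<or> b \<le> z" if "z \<in> U" for z
    using ab(1) that by (meson disjoint_iff greaterThanLessThan_iff linorder_not_le)
  have U: "{z \<in> U. z \<le> a} \<union> {z \<in> U. b \<le> z} = U"
    using split by blast
  have gaps': "gaps_lt d ({z \<in> U. z \<le> a} \<union> {z \<in> U. b \<le> z})"
    unfolding U by (rule gaps)
  have x: "x \<in> {z \<in> U. z \<le> a}" and y: "y \<in> {z \<in> U. b \<le> z}"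
    using xy split by fastforce+
  have "x < y"
    using x y ab(2) d by simp
  then obtain a' b' where "a' \<in> {z \<in> U. z \<le> a}" "b' \<in> {z \<in> U. b \<le> z}" "b' - a' \<le> d - 1" "a' < b'"
    using small_gap_crossing[OF _ _ gaps' x y] fin by (metis (no_types, lifting) finite_Un U)
  then have "a' \<le> a" "b \<le> b'" "b' - a' \<le> d - 1"
    by simp_all
  then show False
    using ab(2) d by linarith
qed

text \<open>The union has a large gap, and each of the two sets lies entirely on one side of it.\<close>

lemma BB_far_if_not_close:
  assumes d: "1 \<le> d" and S: "S \<in> BB d t" and T: "T \<in> BB d t" and union: "S \<union> T \<notin> BB d t"
  shows "far d S T \<or> far d T S"
proof -
  have fin: "finite S" "finite T"
    using S T BB_finite by blast+
  have ne: "S \<noteq> {}" "T \<noteq> {}"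
    using S T by (auto simp: BB_def)
  have "\<not> gaps_lt d (S \<union> T)"
    using S T union by (auto simp: BB_def)
  then obtain a b where ab: "a \<in> S \<union> T" "b \<in> S \<union> T" "a < b" "{a<..<b} \<inter> (S \<union> T) = {}" "\<not> b - a \<le> d - 1"
    unfolding gaps_lt_def by blast
  then have gap: "a + d \<le> b"
    by linarith
  have side: "(\<forall>x\<in>U. x \<le> a) \<or> (\<forall>x\<in>U. b \<le> x)" if "U = S \<or> U = T" for U
  proof (rule gaps_lt_one_side[OF d])
    show "finite U" "gaps_lt d U" "{a<..<b} \<inter> U = {}"
      using that fin S T ab(4) by (auto simp: BB_def)
  qed (rule gap)
  have "far d U V" if "\<forall>x\<in>U. x \<le> a" "\<forall>x\<in>V. b \<le> x" "U \<noteq> {}" "V \<noteq> {}" for U V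
    using that gap unfolding far_def by (meson add_le_mono1 order_trans)
  moreover have "\<not> ((\<forall>x\<in>S. x \<le> a) \<and> (\<forall>x\<in>T. x \<le> a))" "\<not> ((\<forall>x\<in>S. b \<le> x) \<and> (\<forall>x\<in>T. b \<le> x))"
    using ab by auto
  ultimately show ?thesis
    using side[of S] side[of T] ne by blast
qed

lemma BB_far_imp_not_close:
  assumes d: "1 \<le> d" and S: "S \<in> BB d t" and T: "T \<in> BB d t" and far: "far d S T"
  shows "S \<union> T \<notin> BB d t" "S \<inter> T = {}"
proof -
  have "\<not> (S \<union> T \<in> BB d t \<or> S \<inter> T \<noteq> {})"
  proof
    assume "S \<union> T \<in> BB d t \<or> S \<inter> T \<noteq> {}"
    then obtain i j where "i \<in> S" "j \<in> T" "i < j + d" "j < i + d"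
      using BB_close_pair[OF d S T] by blast
    then show False
      using far unfolding far_def by fastforce
  qed
  then show "S \<union> T \<notin> BB d t" "S \<inter> T = {}"
    by blast+
qed

text \<open>Since \<open>far d\<close> is transitive, comparing consecutive blocks amounts to comparing all blocks; this
form is easier to use in inductions on lists.\<close>

lemma d_partition_iff:
  assumes d: "1 \<le> d" and fin: "finite S"
  shows "d_partition d S P \<longleftrightarrow>
    \<Union> (set P) = S \<and> {} \<notin> set P \<and> (\<forall>T\<in>set P. gaps_lt d T) \<and> sorted_wrt (far d) P"
proof (cases "\<Union> (set P) = S \<and> {} \<notin> set P")
  case False
  then show ?thesis
    by (auto simp: d_partition_def strictly_ordered_partition_def)
next
  case True
  then have Pfin: "finite T" if "T \<in> set P" for T
    using that fin by (metis Union_upper finite_subset)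
  have "far d (P ! i) (P ! Suc i) \<longleftrightarrow> Max (P ! i) + d \<le> Min (P ! Suc i)" if "Suc i < length P" for i
    using that True Pfin by (intro far_iff_Max_Min) (metis Suc_lessD nth_mem)+
  moreover have "transp (far d)"
    by (rule transpI) (rule far_trans)
  ultimately have sorted: "sorted_wrt (far d) P \<longleftrightarrow>
      (\<forall>j. Suc j < length P \<longrightarrow> Max (P ! j) + d \<le> Min (P ! Suc j))"
    by (simp add: sorted_wrt_iff_nth_Suc_transp)
  have "strictly_ordered_partition S P" if "sorted_wrt (far d) P"
  proof -
    have "P ! i \<inter> P ! j = {}" if "i < length P" "j < length P" "i \<noteq> j" for i j
      using that sorted_wrt_nth_less[OF \<open>sorted_wrt (far d) P\<close>] far_disjoint[OF d]
      by (metis Int_commute linorder_neqE_nat)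
    moreover have "Max (P ! i) < Min (P ! Suc i)" if "Suc i < length P" for i
      using sorted \<open>sorted_wrt (far d) P\<close> that d by fastforce
    ultimately show ?thesis
      using True by (simp add: strictly_ordered_partition_def)
  qed
  then show ?thesis
    using True sorted by (auto simp: d_partition_def)
qed

text \<open>A new least element \<open>b\<close> is added to the first block if it is close to it, and forms a block of its
own otherwise.\<close>

lemma d_partition_exists:
  assumes d: "1 \<le> d" and "finite S"
  shows "\<exists>P. d_partition d S P"
  using \<open>finite S\<close>
proof (induction S rule: finite_linorder_min_induct)
  case empty
  show ?case
    using d by (intro exI[of _ "[]"]) (simp add: d_partition_iff)
next
  case (insert b A)
  then obtain P where P: "\<Union> (set P) = A" "{} \<notin> set P" "\<forall>T\<in>set P. gaps_lt d T" "sorted_wrt (far d) P"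
    using d d_partition_iff by blast
  have single: "gaps_lt d {b}"
    by (auto simp: gaps_lt_def)
  show ?case
  proof (cases P)
    case Nil
    then have "d_partition d (Set.insert b A) [{b}]"
      using P d single by (simp add: d_partition_iff)
    then show ?thesis ..
  next
    case (Cons L Q)
    have L: "L \<noteq> {}" "finite L" "\<forall>x\<in>L. b < x"
      using P Cons insert.hyps finite_subset by auto
    show ?thesis
    proof (cases "b + d \<le> Min L")
      case True
      then have far: "far d {b} L"
        using L by (subst far_iff_Max_Min) auto
      then have "far d {b} T" if "T \<in> set P" for T
        using that far_trans[OF far] P(4) Cons by auto
      then have "d_partition d (Set.insert b A) ({b} # P)"
        using P d single insert.hyps(1) by (auto simp: d_partition_iff)
      then show ?thesis ..
    next
      case False
      have "gaps_lt d (Set.insert b L)"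
        unfolding gaps_lt_def
      proof (intro ballI impI; elim conjE)
        fix x y assume xy: "x \<in> Set.insert b L" "y \<in> Set.insert b L" "x < y"
          "{x<..<y} \<inter> Set.insert b L = {}"
        then have y: "y \<in> L"
          using L(3) by auto
        show "y - x \<le> d - 1"
        proof (cases "x = b")
          case True
          have "Min L \<in> L" "Min L \<le> y"
            using L y by simp_all
          then have "y = Min L"
            using xy(4) L(3) True by (metis IntI emptyE greaterThanLessThan_iff insertI2 le_neq_implies_less)
          then show ?thesis
            using False True by linarith
        next
          case False
          then have "x \<in> L" "{x<..<y} \<inter> L = {}"
            using xy by auto
          then show ?thesis
            using P(3) Cons y xy(3) unfolding gaps_lt_def by auto
        qed
      qed
      moreover have "far d (Set.insert b L) T" if "T \<in> set Q" for T
      proof -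
        have LT: "far d L T"
          using that P(4) Cons by simp
        obtain l where "l \<in> L"
          using L(1) by blast
        then have "b + d \<le> j" if "j \<in> T" for j
          using LT L(3) that unfolding far_def by (meson add_le_mono1 less_imp_le order_trans)
        then show ?thesis
          using LT by (auto simp: far_def)
      qed
      ultimately have "d_partition d (Set.insert b A) (Set.insert b L # Q)"
        using P d Cons insert.hyps(1) by (auto simp: d_partition_iff)
      then show ?thesis ..
    qed
  qed
qed

text \<open>If the first blocks differed, one of them would reach from their common part to an element outside
the other one, without a large gap in between; but everything outside a first block is far from it.\<close>

lemma d_partition_head_eq:
  assumes d: "1 \<le> d" and fin: "finite S"
    and P: "d_partition d S (T # P)" and Q: "d_partition d S (U # Q)"
  shows "T = U"
proof -
  have main: "A \<subseteq> C" if A: "d_partition d S (A # P)" and C: "d_partition d S (C # Q)" for A C P Q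
  proof
    fix x assume x: "x \<in> A"
    note A' = A[unfolded d_partition_iff[OF d fin]] and C' = C[unfolded d_partition_iff[OF d fin]]
    have sep: "i + d \<le> j" if "i \<in> A" "j \<in> S" "j \<notin> A" for i j
      using A' that by (fastforce simp: far_def)
    have sepC: "i + d \<le> j" if "i \<in> C" "j \<in> S" "j \<notin> C" for i j
      using C' that by (fastforce simp: far_def)
    obtain a c where ac: "a \<in> A" "c \<in> C"
      using A' C' by fastforce
    have "A \<subseteq> S" "C \<subseteq> S"
      using A' C' by auto
    show "x \<in> C"
    proof (rule ccontr)
      assume "x \<notin> C"
      have "\<exists>y. y \<in> A \<inter> C"
      proof (cases "c \<in> A \<or> a \<in> C")
        case False
        then have "a + d \<le> c" "c + d \<le> a"
          using sep[of a c] sepC[of c a] ac \<open>A \<subseteq> S\<close> \<open>C \<subseteq> S\<close> by blast+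
        then show ?thesis
          using d by linarith
      qed (use ac in blast)
      then obtain y where y: "y \<in> A \<inter> C"
        by blast
      have "y + d \<le> x"
        using sepC y x \<open>x \<notin> C\<close> \<open>A \<subseteq> S\<close> by blast
      then have less: "y < x"
        using d by linarith
      have "(A \<inter> C) \<union> (A - C) = A"
        by blast
      then have gaps: "gaps_lt d ((A \<inter> C) \<union> (A - C))"
        using A' by simp
      have fins: "finite (A \<inter> C)" "finite (A - C)"
        using \<open>A \<subseteq> S\<close> fin finite_subset by blast+
      have xAC: "x \<in> A - C"
        using x \<open>x \<notin> C\<close> by blast
      obtain a' b' where "a' \<in> A \<inter> C" "b' \<in> A - C" "b' - a' \<le> d - 1"
        using small_gap_crossing[OF fins gaps y xAC less] by blast
      then show False
        using sepC[of a' b'] \<open>A \<subseteq> S\<close> d by fastforce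
    qed
  qed
  show ?thesis
    using main[OF P Q] main[OF Q P] by blast
qed

lemma d_partition_unique:
  assumes d: "1 \<le> d"
  shows "finite S \<Longrightarrow> d_partition d S P \<Longrightarrow> d_partition d S Q \<Longrightarrow> P = Q"
proof (induction P arbitrary: S Q)
  case Nil
  then have "S = {}"
    by (simp add: d_partition_iff[OF d])
  then show ?case
    using Nil.prems by (cases Q) (auto simp: d_partition_iff[OF d])
next
  case (Cons T P)
  then obtain U Q' where Q: "Q = U # Q'"
    by (cases Q) (auto simp: d_partition_iff[OF d])
  have tail: "d_partition d (S - A) R" if "d_partition d S (A # R)" for A R
  proof -
    have R: "\<Union> (set (A # R)) = S" "{} \<notin> set R" "\<forall>T\<in>set R. gaps_lt d T" "sorted_wrt (far d) R"
        "\<forall>T\<in>set R. far d A T"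
      using that Cons.prems(1) by (auto simp: d_partition_iff[OF d])
    then have "\<Union> (set R) = S - A"
      using far_disjoint[OF d, of A] by auto
    then show ?thesis
      using R Cons.prems(1) by (simp add: d_partition_iff[OF d])
  qed
  have "T = U"
    using d_partition_head_eq[OF d Cons.prems(1)] Cons.prems(2,3) unfolding Q by blast
  then show ?case
    using Cons.IH[of "S - T" Q'] tail Cons.prems unfolding Q by blast
qed

definition dpart :: "nat \<Rightarrow> nat set \<Rightarrow> nat set list"
  where "dpart d S = (THE P. d_partition d S P)"

lemma d_partition_dpart: "1 \<le> d \<Longrightarrow> finite S \<Longrightarrow> d_partition d S (dpart d S)"
  unfolding dpart_def using d_partition_exists d_partition_unique by (metis (no_types, lifting) theI')

lemma dpart_eqI: "1 \<le> d \<Longrightarrow> finite S \<Longrightarrow> d_partition d S P \<Longrightarrow> dpart d S = P"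
  using d_partition_dpart d_partition_unique by blast

lemma dpart_subset_BB:
  assumes d: "1 \<le> d" and S: "S \<subseteq> {1..t}"
  shows "set (dpart d S) \<subseteq> BB d t" "\<Union> (set (dpart d S)) = S" "sorted_wrt (far d) (dpart d S)"
proof -
  have fin: "finite S"
    using S finite_subset by blast
  show "set (dpart d S) \<subseteq> BB d t" "\<Union> (set (dpart d S)) = S" "sorted_wrt (far d) (dpart d S)"
    using d_partition_dpart[OF d fin] S unfolding d_partition_iff[OF d fin] BB_def by auto
qed

lemma dpart_BB:
  assumes "1 \<le> d" "S \<in> BB d t"
  shows "dpart d S = [S]"
  using assms BB_finite[OF assms(2)] by (intro dpart_eqI) (auto simp: d_partition_iff BB_def)

lemma dpart_empty: "1 \<le> d \<Longrightarrow> dpart d {} = []"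
  by (intro dpart_eqI) (auto simp: d_partition_iff)

lemma card_eq_sum_dpart:
  assumes d: "1 \<le> d" and fin: "finite S"
  shows "sum_list (map card (dpart d S)) = card S"
proof -
  have "sum_list (map card P) = card (\<Union> (set P))" if "sorted_wrt (far d) P" "finite (\<Union> (set P))" for P
    using that
  proof (induction P)
    case (Cons T P)
    then have "T \<inter> \<Union> (set P) = {}"
      using far_disjoint[OF d, of T] by auto
    then show ?case
      using Cons by (simp add: card_Un_disjoint)
  qed simp
  then show ?thesis
    using d_partition_dpart[OF d fin] fin unfolding d_partition_iff[OF d fin] by metis
qed

text \<open>The condition on two factors that makes a product a relation.\<close>

definition close_in :: "'a set set \<Rightarrow> 'a set \<Rightarrow> 'a set \<Rightarrow> bool"
  where "close_in \<B> S T \<longleftrightarrow> S \<union> T \<in> \<B> \<or> S \<inter> T \<noteq> {}"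

lemma sorted_wrt_sym_mset:
  assumes sym: "symp R" and "mset xs = mset ys" "sorted_wrt R xs"
  shows "sorted_wrt R ys"
  using assms(2,3)
proof (induction xs arbitrary: ys)
  case (Cons x xs)
  then have "x \<in> set ys"
    by (metis list.set_intros(1) mset_eq_setD)
  then obtain us vs where ys: "ys = us @ x # vs"
    by (meson split_list)
  then have "mset xs = mset (us @ vs)"
    using Cons.prems(1) by simp
  then have "sorted_wrt R (us @ vs)" "set xs = set us \<union> set vs"
    using Cons.IH[of "us @ vs"] Cons.prems(2) mset_eq_setD[of xs "us @ vs"] by simp_all
  then show ?case
    using Cons.prems(2) sympD[OF sym] unfolding ys by (auto simp: sorted_wrt_append)
qed simp

text \<open>Letters that are pairwise not close are pairwise far in one of the two directions. Sorting them by
their minima yields a list that satisfies the characterisation of the \<open>d\<close>-partition.\<close>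

lemma mset_dpart_if_not_close:
  assumes d: "1 \<le> d" and Ss: "set Ss \<subseteq> BB d t"
    and not_close: "sorted_wrt (\<lambda>S T. \<not> close_in (BB d t) S T) Ss"
  shows "mset (dpart d (\<Union> (set Ss))) = mset Ss"
proof -
  define P where "P = sort_key Min Ss"
  have P: "mset P = mset Ss" "set P = set Ss" "sorted (map Min P)"
    by (simp_all add: P_def)
  have "symp (\<lambda>S T. \<not> close_in (BB d t) S T)"
    by (rule sympI) (simp add: close_in_def Un_commute Int_commute)
  then have nc: "sorted_wrt (\<lambda>S T. \<not> close_in (BB d t) S T) P"
    using sorted_wrt_sym_mset not_close P(1) by metis
  have "sorted_wrt (far d) P"
    unfolding sorted_wrt_iff_nth_less
  proof (intro allI impI)
    fix i j assume ij: "i < j" "j < length P"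
    then have BB: "P ! i \<in> BB d t" "P ! j \<in> BB d t"
      using P(2) Ss by (metis nth_mem order_less_trans subsetD)+
    have "P ! i \<union> P ! j \<notin> BB d t"
      using sorted_wrt_nth_less[OF nc ij] by (simp add: close_in_def)
    then have "far d (P ! i) (P ! j) \<or> far d (P ! j) (P ! i)"
      using BB_far_if_not_close[OF d BB] by blast
    moreover have "\<not> far d (P ! j) (P ! i)"
    proof
      assume "far d (P ! j) (P ! i)"
      moreover have "Min (P ! j) \<in> P ! j" "Min (P ! i) \<in> P ! i"
        using BB BB_finite[OF BB(1)] BB_finite[OF BB(2)] by (simp_all add: BB_def)
      ultimately have "Min (P ! j) + d \<le> Min (P ! i)"
        unfolding far_def by blast
      moreover have "Min (P ! i) \<le> Min (P ! j)"
        using sorted_nth_mono[OF P(3), of i j] ij by simp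
      ultimately show False
        using d by linarith
    qed
    ultimately show "far d (P ! i) (P ! j)"
      by blast
  qed
  moreover have "finite (\<Union> (set Ss))"
    using Ss BB_finite by blast
  ultimately have "d_partition d (\<Union> (set Ss)) P"
    using Ss P(2) by (auto simp: d_partition_iff[OF d] BB_def)
  then show ?thesis
    using dpart_eqI[OF d] \<open>finite (\<Union> (set Ss))\<close> P(1) by metis
qed

lemma ex_partition_not_close:
  assumes d: "1 \<le> d" and S: "S \<subseteq> {1..t}"
  shows "\<exists>P. partition_on S P \<and> P \<subseteq> BB d t \<and> (\<forall>T\<in>P. \<forall>U\<in>P. T \<noteq> U \<longrightarrow> T \<union> U \<notin> BB d t)"
proof (intro exI conjI ballI impI)
  note dp = dpart_subset_BB[OF d S]
  have far: "far d T U \<or> far d U T" if "T \<in> set (dpart d S)" "U \<in> set (dpart d S)" "T \<noteq> U" for T U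
    using that sorted_wrt_nth_less[OF dp(3)] by (metis in_set_conv_nth linorder_neqE_nat)
  show "partition_on S (set (dpart d S))"
  proof (rule partition_onI)
    show "disjnt T U" if "T \<in> set (dpart d S)" "U \<in> set (dpart d S)" "T \<noteq> U" for T U
      using far[OF that] far_disjoint[OF d] unfolding disjnt_def by blast
  qed (use dp in \<open>auto simp: BB_def\<close>)
  show "set (dpart d S) \<subseteq> BB d t"
    by (rule dp)
  show "T \<union> U \<notin> BB d t" if "T \<in> set (dpart d S)" "U \<in> set (dpart d S)" "T \<noteq> U" for T U
    using far[OF that] BB_far_imp_not_close(1)[OF d, of T t U] BB_far_imp_not_close(1)[OF d, of U t T] that dp(1)
    by (metis Un_commute subsetD)
qed

lemma weight_count_eq:
  assumes "1 \<le> d"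
  shows "weight_count d t ns = card {S. S \<subseteq> {1..t} \<and> map card (dpart d S) = ns}"
proof -
  have "(\<exists>P. d_partition d S P \<and> map card P = ns) \<longleftrightarrow> map card (dpart d S) = ns" if "S \<subseteq> {1..t}" for S
    using that assms d_partition_dpart dpart_eqI finite_subset[OF that] by (metis finite_atLeastAtMost)
  then have "{S. S \<subseteq> {1..t} \<and> (\<exists>P. d_partition d S P \<and> map card P = ns)} =
      {S. S \<subseteq> {1..t} \<and> map card (dpart d S) = ns}"
    by blast
  then show ?thesis
    by (simp add: weight_count_def)
qed

lemma dpart_weight_bounds:
  assumes d: "1 \<le> d" and S: "S \<subseteq> {1..t}"
  shows "set (map card (dpart d S)) \<subseteq> {1..t}" "length (dpart d S) \<le> t"
proof -
  have fin: "finite S"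
    using S finite_subset by blast
  note dp = dpart_subset_BB[OF d S]
  show "set (map card (dpart d S)) \<subseteq> {1..t}"
  proof
    fix n assume "n \<in> set (map card (dpart d S))"
    then obtain T where T: "T \<in> BB d t" "n = card T"
      using dp(1) by auto
    then have "T \<noteq> {}" "T \<subseteq> {1..t}"
      by (simp_all add: BB_def)
    then have "card T \<noteq> 0" "card T \<le> card {1..t}"
      using BB_finite[OF T(1)] card_mono[of "{1..t}" T] by auto
    then show "n \<in> {1..t}"
      using T by simp
  qed
  have "length (dpart d S) \<le> sum_list (map card (dpart d S))"
  proof -
    have "length P \<le> sum_list (map card P)" if "\<forall>T\<in>set P. 1 \<le> card T" for P :: "nat set list"
      using that by (induction P) auto
    moreover have "\<forall>T\<in>set (dpart d S). 1 \<le> card T"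
      using \<open>set (map card (dpart d S)) \<subseteq> {1..t}\<close> by auto
    ultimately show ?thesis
      by blast
  qed
  also have "\<dots> = card S"
    by (rule card_eq_sum_dpart[OF d fin])
  also have "\<dots> \<le> card {1..t}"
    using S by (intro card_mono) auto
  finally show "length (dpart d S) \<le> t"
    by simp
qed

section \<open>Free associative and free graded-commutative algebras\<close>

text \<open>With concatenation as addition of exponents, the free associative algebra is the ring of finitely
supported functions on words, and its ring laws are instances of those of that type.\<close>

instantiation list :: (type) monoid_add
begin

definition zero_list_def: "0 = []"

definition plus_list_def: "xs + ys = xs @ ys"

instance
  by standard (simp_all add: zero_list_def plus_list_def)

end

lemma free_alg_simps [simp]:
  "carrier (free_alg B) = {p. keys p \<subseteq> lists B}"
  "\<one>\<^bsub>free_alg B\<^esub> = 1" "\<zero>\<^bsub>free_alg B\<^esub> = 0" "p \<oplus>\<^bsub>free_alg B\<^esub> q = p + q"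
  "p \<otimes>\<^bsub>free_alg B\<^esub> q = p * q"
proof -
  have "p * q = (\<Sum>u\<in>keys p. single u (lookup p u)) *
      (\<Sum>w\<in>keys q. single w (lookup q w))"
    by (simp flip: sum_monomials)
  then show "p \<otimes>\<^bsub>free_alg B\<^esub> q = p * q"
    by (simp add: free_alg_def sum_product mult_single plus_list_def)
  show "\<one>\<^bsub>free_alg B\<^esub> = 1"
    by (simp add: free_alg_def flip: zero_list_def)
qed (simp_all add: free_alg_def)

lemma mult_word: "single u a * single w b = single (u @ w) (a * b)"
  by (simp add: mult_single plus_list_def)

lemma lists_monomial: "w \<in> lists B \<Longrightarrow> single w c \<in> carrier (free_alg B)"
  by simp

lemma ring_free_alg: "ring (free_alg B :: ('x list \<Rightarrow>\<^sub>0 'k::field) ring)"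
proof (rule ringI)
  have add: "keys (p + q) \<subseteq> lists B"
    if "keys p \<subseteq> lists B" "keys q \<subseteq> lists B" for p q :: "'x list \<Rightarrow>\<^sub>0 'k"
    using keys_add[of p q] that by blast
  show "abelian_group (free_alg B :: ('x list \<Rightarrow>\<^sub>0 'k) ring)"
  proof (rule abelian_groupI)
    fix p :: "'x list \<Rightarrow>\<^sub>0 'k" assume "p \<in> carrier (free_alg B)"
    then show "\<exists>q\<in>carrier (free_alg B). q \<oplus>\<^bsub>free_alg B\<^esub> p = \<zero>\<^bsub>free_alg B\<^esub>"
      by (intro bexI[of _ "- p"]) (simp_all add: subset_iff in_keys_iff)
  qed (simp_all add: add add.assoc add.commute)
  have mult: "keys (p * q) \<subseteq> lists B"
    if "keys p \<subseteq> lists B" "keys q \<subseteq> lists B" for p q :: "'x list \<Rightarrow>\<^sub>0 'k"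
    using keys_mult[of p q] that by (fastforce simp: plus_list_def)
  show "Group.monoid (free_alg B :: ('x list \<Rightarrow>\<^sub>0 'k) ring)"
    by (rule monoidI) (simp_all add: mult mult.assoc zero_list_def)
qed (simp_all add: distrib_left distrib_right)

lemma free_alg_minus [simp]:
  "p \<in> carrier (free_alg B) \<Longrightarrow> \<ominus>\<^bsub>free_alg B\<^esub> p = - (p :: 'x list \<Rightarrow>\<^sub>0 'k::field)"
proof -
  interpret ring "free_alg B :: ('x list \<Rightarrow>\<^sub>0 'k) ring"
    by (rule ring_free_alg)
  show "p \<in> carrier (free_alg B) \<Longrightarrow> \<ominus>\<^bsub>free_alg B\<^esub> p = - p"
    by (rule minus_equality) (simp_all add: subset_iff in_keys_iff)
qed

lemma free_alg_induct [consumes 1, case_names word add]: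
  assumes p: "p \<in> carrier (free_alg B)"
    and word: "\<And>w c. w \<in> lists B \<Longrightarrow> P (single w c)"
    and add: "\<And>p q. p \<in> carrier (free_alg B) \<Longrightarrow> q \<in> carrier (free_alg B) \<Longrightarrow> P p \<Longrightarrow> P q \<Longrightarrow> P (p + q)"
  shows "P (p :: 'x list \<Rightarrow>\<^sub>0 'k::field)"
proof -
  interpret ring "free_alg B :: ('x list \<Rightarrow>\<^sub>0 'k) ring"
    by (rule ring_free_alg)
  have "P (\<Sum>w\<in>A. single w (f w)) \<and>
      (\<Sum>w\<in>A. single w (f w)) \<in> carrier (free_alg B)" if "finite A" "A \<subseteq> lists B" for A f
    using that
  proof (induction A rule: finite_induct)
    case empty
    then show ?case
      using word[of "[]" 0] by simp
  next
    case (insert w A)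
    then have w: "single w (f w) \<in> carrier (free_alg B)"
      by (intro lists_monomial) simp
    then show ?case
      using insert word[of w "f w"] add[OF w] a_closed[OF w] by simp
  qed
  from this[of "keys p" "lookup p"] show ?thesis
    using p by (simp flip: sum_monomials)
qed

lemma gc_relations_subset: "gc_relations B dg \<subseteq> carrier (free_alg B :: ('x list \<Rightarrow>\<^sub>0 'k::field) ring)"
proof -
  interpret ring "free_alg B :: ('x list \<Rightarrow>\<^sub>0 'k) ring"
    by (rule ring_free_alg)
  have rel: "single [a, b] (1 :: 'k) - single [b, a] c \<in> carrier (free_alg B)"
    if "a \<in> B" "b \<in> B" for a b c
  proof -
    have *: "single [a, b] (1 :: 'k) \<in> carrier (free_alg B)"
        "single [b, a] (- c) \<in> carrier (free_alg B)"
      using that by (simp_all add: lists_monomial del: free_alg_simps(1))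
    from a_closed[OF *] show ?thesis
      by (simp add: single_uminus)
  qed
  then show ?thesis
    unfolding gc_relations_def
    by (auto simp del: free_alg_simps(1) intro!: rel lists_monomial)
qed

lemma ideal_gc_ideal: "ideal (gc_ideal B dg) (free_alg B :: ('x list \<Rightarrow>\<^sub>0 'k::field) ring)"
  unfolding gc_ideal_def by (rule ring.genideal_ideal[OF ring_free_alg gc_relations_subset])

lemma gc_ideal_add: "p \<in> gc_ideal B dg \<Longrightarrow> q \<in> gc_ideal B dg \<Longrightarrow> p + q \<in> gc_ideal B dg"
  for p :: "'x list \<Rightarrow>\<^sub>0 'k::field"
  using additive_subgroup.a_closed[OF ideal.axioms(1)[OF ideal_gc_ideal], of p B dg q] by simp

lemma gc_ideal_mult:
  assumes "p \<in> gc_ideal B dg" "u \<in> lists B" "w \<in> lists B"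
  shows "single u c * p * single w (c' :: 'k::field) \<in> gc_ideal B dg"
proof -
  interpret ideal "gc_ideal B dg" "free_alg B :: (_ list \<Rightarrow>\<^sub>0 'k) ring"
    by (rule ideal_gc_ideal)
  show ?thesis
    using I_r_closed[OF I_l_closed[OF assms(1) lists_monomial[OF assms(2), of c]]
        lists_monomial[OF assms(3), of c']] by simp
qed

lemma gc_ideal_zero: "0 \<in> gc_ideal B dg"
  using additive_subgroup.zero_closed[OF ideal.axioms(1)[OF ideal_gc_ideal]] by simp

lemma gc_swap:
  fixes c :: "'k::field"
  assumes "u \<in> lists B" "w \<in> lists B" "a \<in> B" "b \<in> B"
  shows "single (u @ [a, b] @ w) c -
    single (u @ [b, a] @ w) ((- 1) ^ (dg a * dg b) * c) \<in> gc_ideal B dg"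
proof -
  have "single [a, b] 1 - single [b, a] ((- 1) ^ (dg a * dg b)) \<in> gc_relations B dg"
    using assms(3,4) unfolding gc_relations_def by blast
  also have "gc_relations B dg \<subseteq> gc_ideal B dg"
    unfolding gc_ideal_def by (rule ring.genideal_self[OF ring_free_alg gc_relations_subset])
  finally have "single u c *
      (single [a, b] 1 - single [b, a] ((- 1) ^ (dg a * dg b))) *
      single w 1 \<in> gc_ideal B dg"
    using assms(1,2) by (intro gc_ideal_mult)
  then show ?thesis
    by (simp add: left_diff_distrib right_diff_distrib mult_word mult.commute)
qed

lemma gc_move:
  assumes "set ys \<subseteq> B" "a \<in> B" "w \<in> lists B"
  shows "u \<in> lists B \<Longrightarrow> \<exists>e. (e = 1 \<or> e = - 1) \<and> (\<forall>c :: 'k::field.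
    single (u @ a # ys @ w) c - single (u @ ys @ a # w) (e * c) \<in> gc_ideal B dg)"
  using assms(1)
proof (induction ys arbitrary: u)
  case Nil
  show ?case
    by (rule exI[of _ 1]) (simp add: gc_ideal_zero)
next
  case (Cons y ys)
  obtain e where e: "e = 1 \<or> e = - 1" "\<And>c :: 'k. single ((u @ [y]) @ a # ys @ w) c -
      single ((u @ [y]) @ ys @ a # w) (e * c) \<in> gc_ideal B dg"
    using Cons.IH[of "u @ [y]"] Cons.prems by auto
  define s where "s = ((- 1) ^ (dg a * dg y) :: 'k)"
  have "single (u @ a # (y # ys) @ w) c - single (u @ (y # ys) @ a # w) (e * s * c)
      \<in> gc_ideal B dg" for c
  proof -
    have "single (u @ [a, y] @ (ys @ w)) c -
        single (u @ [y, a] @ (ys @ w)) (s * c) \<in> gc_ideal B dg"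
      unfolding s_def using Cons.prems assms by (intro gc_swap) auto
    from gc_ideal_add[OF this e(2)[of "s * c"]] show ?thesis
      by (simp add: mult.assoc)
  qed
  moreover have "e * s = 1 \<or> e * s = - 1"
    using e(1) by (cases "even (dg a * dg y)") (auto simp: s_def)
  ultimately show ?case
    by blast
qed

text \<open>Rearranging the letters changes a word only by a sign modulo graded commutativity. The sign depends on
the rearrangement; only that it is invertible matters below.\<close>

lemma gc_permute:
  assumes "set xs \<subseteq> B" "mset xs = mset ys"
  shows "\<exists>e. (e = 1 \<or> e = - 1) \<and> (\<forall>c :: 'k::field.
    single xs c - single ys (e * c) \<in> gc_ideal B dg)"
  using assms
proof (induction xs arbitrary: ys)
  case Nil
  then show ?case
    by (intro exI[of _ 1]) (simp add: gc_ideal_zero)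
next
  case (Cons a xs)
  then have "a \<in> set ys"
    by (metis list.set_intros(1) mset_eq_setD)
  then obtain us vs where ys: "ys = us @ a # vs"
    by (meson split_list)
  then have mset: "mset xs = mset (us @ vs)"
    using Cons.prems(2) by simp
  then obtain e where e: "e = 1 \<or> e = - 1"
      "\<And>c :: 'k. single xs c - single (us @ vs) (e * c) \<in> gc_ideal B dg"
    using Cons.IH[OF _ mset] Cons.prems(1) by (auto simp del: mset_append)
  have sets: "set us \<subseteq> B" "set vs \<subseteq> B" "a \<in> B"
    using Cons.prems(1) mset_eq_setD[OF mset] by auto
  then obtain e' where e': "e' = 1 \<or> e' = - 1" "\<And>c :: 'k. single ([] @ a # us @ vs) c -
      single ([] @ us @ a # vs) (e' * c) \<in> gc_ideal B dg"
    using gc_move[of us B a vs "[]" dg] by auto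
  have "single (a # xs) c - single ys (e' * e * c) \<in> gc_ideal B dg" for c
  proof -
    have "single [a] 1 * (single xs c - single (us @ vs) (e * c)) *
        single [] 1 \<in> gc_ideal B dg"
      using sets by (intro gc_ideal_mult e(2)) auto
    then have "single (a # xs) c - single (a # us @ vs) (e * c) \<in> gc_ideal B dg"
      by (simp add: left_diff_distrib right_diff_distrib mult_word)
    from gc_ideal_add[OF this e'(2)[of "e * c", simplified]] show ?thesis
      by (simp add: ys mult.assoc)
  qed
  moreover have "e' * e = 1 \<or> e' * e = - 1"
    using e(1) e'(1) by auto
  ultimately show ?case
    by blast
qed

section \<open>Presentation of an algebra with multiplicative basis\<close>

lemma ring_iso_from_common_kernel:
  assumes f: "ring_hom_ring R S f" "f ` carrier R = carrier S"
    and g: "ring_hom_ring R T g" "g ` carrier R = carrier T"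
    and ker: "\<And>x. x \<in> carrier R \<Longrightarrow> f x = \<zero>\<^bsub>S\<^esub> \<longleftrightarrow> g x = \<zero>\<^bsub>T\<^esub>"
  obtains h where "h \<in> ring_iso S T" "\<And>x. x \<in> carrier R \<Longrightarrow> h (f x) = g x"
proof -
  interpret f: ring_hom_ring R S f
    by (rule f(1))
  interpret g: ring_hom_ring R T g
    by (rule g(1))
  have eq: "f x = f y \<longleftrightarrow> g x = g y" if "x \<in> carrier R" "y \<in> carrier R" for x y
  proof -
    have "f x = f y \<longleftrightarrow> f (x \<ominus>\<^bsub>R\<^esub> y) = \<zero>\<^bsub>S\<^esub>"
      using that by (simp add: a_minus_def f.S.r_right_minus_eq[unfolded a_minus_def])
    also have "\<dots> \<longleftrightarrow> g (x \<ominus>\<^bsub>R\<^esub> y) = \<zero>\<^bsub>T\<^esub>"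
      using that ker by simp
    also have "\<dots> \<longleftrightarrow> g x = g y"
      using that by (simp add: a_minus_def g.S.r_right_minus_eq[unfolded a_minus_def])
    finally show ?thesis .
  qed
  define h where "h = (\<lambda>s. g (SOME x. x \<in> carrier R \<and> f x = s))"
  have h: "h (f x) = g x" if "x \<in> carrier R" for x
  proof -
    have "(SOME y. y \<in> carrier R \<and> f y = f x) \<in> carrier R \<and> f (SOME y. y \<in> carrier R \<and> f y = f x) = f x"
      by (rule someI[of "\<lambda>y. y \<in> carrier R \<and> f y = f x" x]) (use that in simp)
    then show ?thesis
      using eq that unfolding h_def by blast
  qed
  have "h \<in> ring_iso S T"
  proof (rule ring_iso_memI)
    fix s s' assume "s \<in> carrier S" "s' \<in> carrier S"
    then obtain x y where xy: "x \<in> carrier R" "y \<in> carrier R" "s = f x" "s' = f y"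
      using f(2) by blast
    show "h s \<in> carrier T"
      using xy h by simp
    have "h (f (x \<otimes>\<^bsub>R\<^esub> y)) = g (x \<otimes>\<^bsub>R\<^esub> y)" "h (f (x \<oplus>\<^bsub>R\<^esub> y)) = g (x \<oplus>\<^bsub>R\<^esub> y)"
      using xy by (simp_all add: h del: f.hom_mult g.hom_mult f.hom_add g.hom_add)
    then show "h (s \<otimes>\<^bsub>S\<^esub> s') = h s \<otimes>\<^bsub>T\<^esub> h s'" "h (s \<oplus>\<^bsub>S\<^esub> s') = h s \<oplus>\<^bsub>T\<^esub> h s'"
      using xy h by simp_all
  next
    show "h \<one>\<^bsub>S\<^esub> = \<one>\<^bsub>T\<^esub>"
      using h[OF f.R.one_closed] by simp
    show "bij_betw h (carrier S) (carrier T)"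
      unfolding bij_betw_def
    proof
      show "inj_on h (carrier S)"
        unfolding f(2)[symmetric] by (rule inj_onI) (use h eq in auto)
      show "h ` carrier S = carrier T"
        unfolding f(2)[symmetric] g(2)[symmetric] using h by (force simp: image_image)
    qed
  qed
  then show ?thesis
    using that h by blast
qed

lemma (in ring) finsum_in:
  assumes "finite I" "\<zero> \<in> V" "\<And>a b. a \<in> V \<Longrightarrow> b \<in> V \<Longrightarrow> a \<oplus> b \<in> V"
    and "\<And>i. i \<in> I \<Longrightarrow> f i \<in> V" "f \<in> I \<rightarrow> carrier R"
  shows "finsum R f I \<in> V"
  using assms by (induction I rule: finite_induct) (auto simp: Pi_def)

text \<open>The algebraic properties of the Koszul homology that determine it: a basis indexed by the subsets
of \<open>{1..t}\<close>, and the products of basis elements that are far apart or close.\<close>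

locale taylor_homology = H: ring H for H :: "'h ring" (structure) +
  fixes \<sigma> :: "'k::field \<Rightarrow> 'h" and F :: "nat set \<Rightarrow> 'h" and d t :: nat
  assumes d: "1 \<le> d"
    and \<sigma>_closed: "\<sigma> a \<in> carrier H"
    and \<sigma>_add: "\<sigma> (a + b) = \<sigma> a \<oplus> \<sigma> b"
    and \<sigma>_mult: "\<sigma> (a * b) = \<sigma> a \<otimes> \<sigma> b"
    and \<sigma>_one: "\<sigma> 1 = \<one>"
    and \<sigma>_central: "h \<in> carrier H \<Longrightarrow> \<sigma> a \<otimes> h = h \<otimes> \<sigma> a"
    and F_closed: "S \<subseteq> {1..t} \<Longrightarrow> F S \<in> carrier H"
    and F_empty: "F {} = \<one>"
    and F_span: "h \<in> carrier H \<Longrightarrow> \<exists>c. h = (\<Oplus>S\<in>Pow {1..t}. \<sigma> (c S) \<otimes> F S)"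
    and F_independent: "(\<Oplus>S\<in>Pow {1..t}. \<sigma> (c S) \<otimes> F S) = \<zero> \<Longrightarrow> S \<subseteq> {1..t} \<Longrightarrow> c S = 0"
    and F_concat: "S \<subseteq> {1..t} \<Longrightarrow> T \<subseteq> {1..t} \<Longrightarrow> (\<And>i j. i \<in> S \<Longrightarrow> j \<in> T \<Longrightarrow> i + d \<le> j) \<Longrightarrow>
      F S \<otimes> F T = F (S \<union> T)"
    and F_close: "S \<in> BB d t \<Longrightarrow> T \<in> BB d t \<Longrightarrow> close_in (BB d t) S T \<Longrightarrow> F S \<otimes> F T = \<zero>"
    and F_commute: "S \<in> BB d t \<Longrightarrow> T \<in> BB d t \<Longrightarrow>
      F S \<otimes> F T = \<sigma> ((- 1) ^ (card S * card T)) \<otimes> (F T \<otimes> F S)"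
begin

abbreviation "B \<equiv> BB d t"
abbreviation "A \<equiv> free_alg B :: (nat set list \<Rightarrow>\<^sub>0 'k) ring"
abbreviation "A\<^sub>1 \<equiv> free_gc_alg B card :: (nat set list \<Rightarrow>\<^sub>0 'k) set ring"
abbreviation "A\<^sub>2 \<equiv> A\<^sub>1 Quot rel_ideal d t"

lemma \<sigma>_zero: "\<sigma> 0 = \<zero>"
proof -
  have "\<sigma> 0 \<oplus> \<sigma> 0 = \<sigma> 0"
    by (simp flip: \<sigma>_add)
  then show ?thesis
    using H.add.r_cancel_one[OF \<sigma>_closed \<sigma>_closed] by simp
qed

lemma \<sigma>_minus: "\<sigma> (- a) = \<ominus> \<sigma> a"
proof -
  have "\<sigma> (- a) \<oplus> \<sigma> a = \<zero>"
    by (simp add: \<sigma>_zero flip: \<sigma>_add)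
  then show ?thesis
    using H.minus_equality \<sigma>_closed by metis
qed

lemma B_subset: "S \<in> B \<Longrightarrow> S \<subseteq> {1..t}"
  by (simp add: BB_def)

lemma F_B_closed: "S \<in> B \<Longrightarrow> F S \<in> carrier H"
  using F_closed B_subset by blast

subsection \<open>Coordinates\<close>

text \<open>The element with coordinates \<open>c\<close>. Only the values at subsets of \<open>{1..t}\<close> matter.\<close>

definition comb :: "(nat set \<Rightarrow> 'k) \<Rightarrow> 'h"
  where "comb c = (\<Oplus>S\<in>Pow {1..t}. \<sigma> (c S) \<otimes> F S)"

lemma comb_terms: "(\<lambda>S. \<sigma> (c S) \<otimes> F S) \<in> Pow {1..t} \<rightarrow> carrier H"
  using \<sigma>_closed F_closed by auto

lemma comb_closed: "comb c \<in> carrier H"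
  unfolding comb_def by (rule H.finsum_closed[OF comb_terms])

lemma comb_add: "comb (\<lambda>S. c S + c' S) = comb c \<oplus> comb c'"
  unfolding comb_def H.finsum_addf[OF comb_terms comb_terms, symmetric]
  by (rule H.finsum_cong') (use \<sigma>_closed F_closed in \<open>auto simp: \<sigma>_add H.l_distr\<close>)

lemma comb_scale: "comb (\<lambda>S. a * c S) = \<sigma> a \<otimes> comb c"
  unfolding comb_def
  by (subst H.finsum_rdistr[OF _ \<sigma>_closed comb_terms], simp, rule H.finsum_cong')
    (use \<sigma>_closed F_closed in \<open>auto simp: \<sigma>_mult H.m_assoc\<close>)

lemma comb_zero: "comb (\<lambda>_. 0) = \<zero>"
  using comb_scale[of 0 "\<lambda>_. 0"] by (simp add: \<sigma>_zero comb_closed)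

lemma comb_minus: "comb (\<lambda>S. - c S) = \<ominus> comb c"
  using comb_scale[of "- 1" c] comb_closed by (simp add: \<sigma>_minus \<sigma>_one H.l_minus)

lemma comb_cong: "(\<And>S. S \<subseteq> {1..t} \<Longrightarrow> c S = c' S) \<Longrightarrow> comb c = comb c'"
  unfolding comb_def by (rule H.finsum_cong') (use comb_terms in auto)

lemma comb_single:
  assumes "S \<subseteq> {1..t}"
  shows "comb (\<lambda>T. if T = S then a else 0) = \<sigma> a \<otimes> F S"
proof -
  have "comb (\<lambda>T. if T = S then a else 0) = (\<Oplus>T\<in>Pow {1..t}. if S = T then \<sigma> a \<otimes> F T else \<zero>)"
    unfolding comb_def by (rule H.finsum_cong') (use F_closed \<sigma>_closed in \<open>auto simp: \<sigma>_zero\<close>)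
  also have "\<dots> = \<sigma> a \<otimes> F S"
    by (rule H.add.finprod_singleton) (use assms F_closed \<sigma>_closed in auto)
  finally show ?thesis .
qed

lemma comb_eq_zero: "comb c = \<zero> \<Longrightarrow> S \<subseteq> {1..t} \<Longrightarrow> c S = 0"
  unfolding comb_def by (rule F_independent)

lemma comb_inj:
  assumes "comb c = comb c'" "S \<subseteq> {1..t}"
  shows "c S = c' S"
proof -
  have "comb (\<lambda>S. c S + - c' S) = \<zero>"
    unfolding comb_add comb_minus assms(1) by (rule H.r_neg) (rule comb_closed)
  from comb_eq_zero[OF this assms(2)] show ?thesis
    by simp
qed

lemma comb_surj: "h \<in> carrier H \<Longrightarrow> \<exists>c. h = comb c"
  unfolding comb_def by (rule F_span)

lemma F_eq_comb: "S \<subseteq> {1..t} \<Longrightarrow> F S = comb (\<lambda>T. if T = S then 1 else 0)"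
  using comb_single[of S 1] F_closed by (simp add: \<sigma>_one)

lemma \<sigma>_eq_comb: "\<sigma> a = comb (\<lambda>T. if T = {} then a else 0)"
  using comb_single[of "{}" a] \<sigma>_closed by (simp add: F_empty)

lemma \<sigma>_eq_zero: "\<sigma> a = \<zero> \<Longrightarrow> a = 0"
  using comb_eq_zero[of "\<lambda>T. if T = {} then a else 0" "{}"] by (simp add: \<sigma>_eq_comb)

subsection \<open>Words\<close>

definition word_prod :: "nat set list \<Rightarrow> 'h"
  where "word_prod w = ring_prod H (map F w)"

lemma word_prod_simps [simp]: "word_prod [] = \<one>" "word_prod (S # w) = F S \<otimes> word_prod w"
  by (simp_all add: word_prod_def ring_prod_def)

lemma word_prod_closed: "w \<in> lists B \<Longrightarrow> word_prod w \<in> carrier H"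
  by (induction w) (auto simp: F_B_closed)

lemma word_prod_append: "u \<in> lists B \<Longrightarrow> w \<in> lists B \<Longrightarrow> word_prod (u @ w) = word_prod u \<otimes> word_prod w"
  by (induction u) (auto simp: F_B_closed word_prod_closed H.m_assoc)

lemma word_prod_far:
  "set w \<subseteq> B \<Longrightarrow> sorted_wrt (far d) w \<Longrightarrow> word_prod w = F (\<Union> (set w))"
proof (induction w)
  case (Cons S w)
  have "F S \<otimes> F (\<Union> (set w)) = F (S \<union> \<Union> (set w))"
    by (rule F_concat) (use Cons.prems B_subset in \<open>fastforce simp: far_def\<close>)+
  then show ?case
    using Cons by simp
qed (simp add: F_empty)

lemma word_prod_dpart: "S \<subseteq> {1..t} \<Longrightarrow> word_prod (dpart d S) = F S"
  using word_prod_far[of "dpart d S"] dpart_subset_BB[OF d, of S t] by simp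

text \<open>The homomorphism from the free associative algebra that sends the letter \<open>S\<close> to \<open>F S\<close>.\<close>

definition eval_alg :: "(nat set list \<Rightarrow>\<^sub>0 'k) \<Rightarrow> 'h"
  where "eval_alg p = (\<Oplus>w\<in>keys p. \<sigma> (lookup p w) \<otimes> word_prod w)"

lemma eval_terms:
  "W \<subseteq> lists B \<Longrightarrow> (\<lambda>w. \<sigma> (f w) \<otimes> word_prod w) \<in> W \<rightarrow> carrier H"
  by (intro Pi_I H.m_closed \<sigma>_closed word_prod_closed) blast

lemma eval_alg_superset:
  assumes "finite W" "keys p \<subseteq> W" "W \<subseteq> lists B"
  shows "eval_alg p = (\<Oplus>w\<in>W. \<sigma> (lookup p w) \<otimes> word_prod w)"
  unfolding eval_alg_def
proof (rule H.add.finprod_mono_neutral_cong_left)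
  show "(\<lambda>w. \<sigma> (lookup p w) \<otimes> word_prod w) \<in> W \<rightarrow> carrier H"
    by (rule eval_terms[OF assms(3)])
  show "\<sigma> (lookup p w) \<otimes> word_prod w = \<zero>" if "w \<in> W - keys p" for w
  proof -
    have "w \<in> lists B"
      using that assms(3) by blast
    then show ?thesis
      using that word_prod_closed by (simp add: in_keys_iff \<sigma>_zero)
  qed
qed (use assms in auto)

lemma eval_closed: "p \<in> carrier A \<Longrightarrow> eval_alg p \<in> carrier H"
  unfolding eval_alg_def by (rule H.finsum_closed[OF eval_terms]) simp

lemma eval_word: "w \<in> lists B \<Longrightarrow> eval_alg (single w c) = \<sigma> c \<otimes> word_prod w"
  using eval_alg_superset[of "{w}" "single w c"] word_prod_closed[of w] \<sigma>_closed
  by (simp add: H.finsum_insert[of "{}"])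

lemma eval_add:
  assumes "p \<in> carrier A" "q \<in> carrier A"
  shows "eval_alg (p + q) = eval_alg p \<oplus> eval_alg q"
proof -
  let ?W = "keys p \<union> keys q"
  have W: "finite ?W" "?W \<subseteq> lists B" "keys (p + q) \<subseteq> ?W"
    using assms keys_add[of p q] by auto
  have "eval_alg (p + q) = (\<Oplus>w\<in>?W. \<sigma> (lookup p w) \<otimes> word_prod w \<oplus>
      \<sigma> (lookup q w) \<otimes> word_prod w)"
    unfolding eval_alg_superset[OF W(1,3,2)]
    by (rule H.finsum_cong')
      (use W(2) \<sigma>_closed word_prod_closed in \<open>auto simp: lookup_add \<sigma>_add H.l_distr subset_iff\<close>)
  also have "\<dots> = eval_alg p \<oplus> eval_alg q"
    unfolding H.finsum_addf[OF eval_terms[OF W(2)] eval_terms[OF W(2)]]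
    using eval_alg_superset[of ?W p] eval_alg_superset[of ?W q] W by simp
  finally show ?thesis .
qed

lemma eval_mult:
  assumes "p \<in> carrier A" "q \<in> carrier A"
  shows "eval_alg (p * q) = eval_alg p \<otimes> eval_alg q"
  using assms(1)
proof (induction p rule: free_alg_induct)
  case (word u a)
  note u = this
  interpret A: ring A
    by (rule ring_free_alg)
  from assms(2) show ?case
  proof (induction q rule: free_alg_induct)
    case (word w b)
    then show ?case
      using u \<sigma>_closed word_prod_closed[of u] word_prod_closed[of w]
        \<sigma>_central[of "word_prod u" b]
      by (simp add: mult_word eval_word word_prod_append \<sigma>_mult H.m_assoc)
        (simp flip: H.m_assoc)
  next
    case (add q q')
    then show ?case
      using A.m_closed[OF lists_monomial[OF u, of a]] eval_closed lists_monomial[OF u, of a]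
      by (simp add: distrib_left eval_add H.r_distr del: free_alg_simps(1))
  qed
next
  case (add p p')
  interpret A: ring A
    by (rule ring_free_alg)
  show ?case
    using add assms(2) A.m_closed[of p q] A.m_closed[of p' q] eval_closed
    by (simp add: distrib_right eval_add H.l_distr del: free_alg_simps(1))
qed

lemma eval_hom: "ring_hom_ring A H eval_alg"
proof (rule ring_hom_ringI[OF ring_free_alg H.ring_axioms])
  have "eval_alg (single [] 1) = \<one>"
    by (subst eval_word) (simp_all add: \<sigma>_one)
  then show "eval_alg \<one>\<^bsub>A\<^esub> = \<one>"
    by (simp flip: zero_list_def)
qed (use eval_closed eval_mult eval_add in \<open>simp_all del: free_alg_simps(1)\<close>)

lemma eval_kernel_ideal: "ideal {p \<in> carrier A. eval_alg p = \<zero>} A"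
  using ring_hom_ring.kernel_is_ideal[OF eval_hom] by (simp add: a_kernel_def' del: free_alg_simps)

lemma eval_gc_ideal:
  assumes "p \<in> gc_ideal B card"
  shows "p \<in> carrier A" "eval_alg p = \<zero>"
proof -
  interpret A: ring A
    by (rule ring_free_alg)
  interpret ring_hom_ring A H eval_alg
    by (rule eval_hom)
  have pair: "eval_alg (single [a, b] c) = \<sigma> c \<otimes> (F a \<otimes> F b)" if "a \<in> B" "b \<in> B" for a b c
    using that by (simp add: eval_word F_B_closed)
  have "eval_alg p = \<zero>" if "p \<in> gc_relations B card" for p
    using that unfolding gc_relations_def
  proof (elim UnE CollectE exE conjE)
    fix a b assume p: "a \<in> B" "b \<in> B"
      "p = single [a, b] 1 - single [b, a] ((- 1) ^ (card a * card b))"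
    let ?e = "(- 1) ^ (card a * card b) :: 'k"
    have car: "single [a, b] (1 :: 'k) \<in> carrier A" "single [b, a] (- ?e) \<in> carrier A"
      using p by (simp_all add: lists_monomial del: free_alg_simps(1))
    have "p = single [a, b] 1 + single [b, a] (- ?e)"
      using p by (simp add: single_uminus)
    then have "eval_alg p = \<sigma> 1 \<otimes> (F a \<otimes> F b) \<oplus> \<sigma> (- ?e) \<otimes> (F b \<otimes> F a)"
      by (simp only: eval_add[OF car] pair[OF p(1,2)] pair[OF p(2,1)])
    also have "\<dots> = \<zero>"
      using F_commute[OF p(1,2)] F_B_closed p(1,2) \<sigma>_closed
      by (simp add: \<sigma>_one \<sigma>_minus H.l_minus H.r_neg)
    finally show ?thesis .
  next
    fix a assume p: "a \<in> B" "odd (card a)" "p = single [a, a] 1"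
    have "F a \<otimes> F a = \<zero>"
      using p(1) by (intro F_close) (simp_all add: close_in_def)
    then show ?thesis
      using p by (simp add: pair \<sigma>_one)
  qed
  then have "gc_relations B card \<subseteq> {p \<in> carrier A. eval_alg p = \<zero>}"
    using gc_relations_subset[of B card] by blast
  then have "gc_ideal B card \<subseteq> {p \<in> carrier A. eval_alg p = \<zero>}"
    unfolding gc_ideal_def by (rule A.genideal_minimal[OF eval_kernel_ideal])
  then show "p \<in> carrier A" "eval_alg p = \<zero>"
    using assms by blast+
qed

definition to_gc :: "(nat set list \<Rightarrow>\<^sub>0 'k) \<Rightarrow> (nat set list \<Rightarrow>\<^sub>0 'k) set"
  where "to_gc p = gc_ideal B card +>\<^bsub>A\<^esub> p"

definition to_pres :: "(nat set list \<Rightarrow>\<^sub>0 'k) \<Rightarrow> (nat set list \<Rightarrow>\<^sub>0 'k) set set"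
  where "to_pres p = rel_ideal d t +>\<^bsub>A\<^sub>1\<^esub> to_gc p"

lemma to_gc_hom: "ring_hom_ring A A\<^sub>1 to_gc"
  unfolding free_gc_alg_def to_gc_def[abs_def] by (rule ideal.rcos_ring_hom_ring[OF ideal_gc_ideal])

lemma ring_A\<^sub>1: "ring A\<^sub>1"
  using to_gc_hom by (rule ring_hom_ring.axioms)

lemma to_gc_surj: "to_gc ` carrier A = carrier A\<^sub>1"
  unfolding free_gc_alg_def FactRing_def A_RCOSETS_def' to_gc_def by auto

lemma to_gc_eq_iff:
  assumes "p \<in> carrier A" "q \<in> carrier A"
  shows "to_gc p = to_gc q \<longleftrightarrow> p - q \<in> gc_ideal B card"
  unfolding to_gc_def
  using ring.quotient_eq_iff_same_a_r_cos[OF ring_free_alg ideal_gc_ideal assms] assms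
  by (simp add: a_minus_def)

lemma to_gc_mult:
  assumes "p \<in> carrier A" "q \<in> carrier A"
  shows "to_gc (p * q) = to_gc p \<otimes>\<^bsub>A\<^sub>1\<^esub> to_gc q"
proof -
  interpret ring_hom_ring A A\<^sub>1 to_gc
    by (rule to_gc_hom)
  show ?thesis
    using hom_mult[OF assms] by simp
qed

lemma to_gc_one: "to_gc 1 = \<one>\<^bsub>A\<^sub>1\<^esub>"
proof -
  interpret ring_hom_ring A A\<^sub>1 to_gc
    by (rule to_gc_hom)
  show ?thesis
    using hom_one by simp
qed

lemma ring_prod_gc_var:
  "set Ss \<subseteq> B \<Longrightarrow> ring_prod A\<^sub>1 (map (gc_var B card) Ss) = to_gc (single Ss 1)"
proof (induction Ss)
  case Nil
  have "single ([] :: nat set list) (1 :: 'k) = 1"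
    by (simp flip: zero_list_def)
  then show ?case
    by (simp add: ring_prod_def to_gc_one)
next
  case (Cons S Ss)
  have "to_gc (single [S] 1 * single Ss 1) =
      to_gc (single [S] 1) \<otimes>\<^bsub>A\<^sub>1\<^esub> to_gc (single Ss 1)"
    using Cons.prems by (intro to_gc_mult lists_monomial) auto
  then show ?case
    using Cons by (simp add: ring_prod_def gc_var_def to_gc_def mult_word)
qed

definition rel_gens :: "(nat set list \<Rightarrow>\<^sub>0 'k) set set"
  where "rel_gens = {to_gc (single Ss 1) | Ss.
    set Ss \<subseteq> B \<and> \<not> sorted_wrt (\<lambda>S T. \<not> close_in B S T) Ss}"

lemma close_in_sym: "close_in \<B> S T \<longleftrightarrow> close_in \<B> T S"
  by (simp add: close_in_def Un_commute Int_commute)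

lemma rel_ideal_eq: "rel_ideal d t = Idl\<^bsub>A\<^sub>1\<^esub> rel_gens"
proof -
  have "(\<exists>i<length Ss. \<exists>j<length Ss. i \<noteq> j \<and> (Ss ! i \<union> Ss ! j \<in> B \<or> Ss ! i \<inter> Ss ! j \<noteq> {})) \<longleftrightarrow>
      \<not> sorted_wrt (\<lambda>S T. \<not> close_in B S T) Ss" (is "?L \<longleftrightarrow> ?R") for Ss
  proof
    assume ?L
    then obtain i j where ij: "i < length Ss" "j < length Ss" "i \<noteq> j" "close_in B (Ss ! i) (Ss ! j)"
      unfolding close_in_def by blast
    then have "close_in B (Ss ! j) (Ss ! i)"
      by (simp add: close_in_sym)
    then show ?R
      using ij unfolding sorted_wrt_iff_nth_less by (metis linorder_neqE_nat)
  next
    assume ?R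
    then obtain i j where "i < j" "j < length Ss" "close_in B (Ss ! i) (Ss ! j)"
      unfolding sorted_wrt_iff_nth_less by blast
    then show ?L
      unfolding close_in_def by (metis nat_neq_iff order_less_trans)
  qed
  then have "{ring_prod A\<^sub>1 (map (gc_var B card) Ss) | Ss. set Ss \<subseteq> B \<and>
      (\<exists>i<length Ss. \<exists>j<length Ss. i \<noteq> j \<and> (Ss ! i \<union> Ss ! j \<in> B \<or> Ss ! i \<inter> Ss ! j \<noteq> {}))} = rel_gens"
    unfolding rel_gens_def by (intro Collect_cong ex_cong1) (auto simp: ring_prod_gc_var)
  then show ?thesis
    unfolding rel_ideal_def by (rule arg_cong)
qed

lemma rel_gens_subset: "rel_gens \<subseteq> carrier A\<^sub>1"
  unfolding rel_gens_def to_gc_surj[symmetric] by (auto simp: subset_iff)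

lemma ideal_rel_ideal: "ideal (rel_ideal d t) A\<^sub>1"
  unfolding rel_ideal_eq by (rule ring.genideal_ideal[OF ring_A\<^sub>1 rel_gens_subset])

lemma to_pres_hom: "ring_hom_ring A A\<^sub>2 to_pres"
proof -
  interpret q: ring_hom_ring A\<^sub>1 A\<^sub>2 "\<lambda>x. rel_ideal d t +>\<^bsub>A\<^sub>1\<^esub> x"
    by (rule ideal.rcos_ring_hom_ring[OF ideal_rel_ideal])
  interpret g: ring_hom_ring A A\<^sub>1 to_gc
    by (rule to_gc_hom)
  show ?thesis
    by (rule ring_hom_ringI[OF g.R.ring_axioms q.S.ring_axioms])
      (simp_all add: to_pres_def del: free_alg_simps)
qed

lemma to_pres_surj: "to_pres ` carrier A = carrier A\<^sub>2"
  unfolding FactRing_def[of A\<^sub>1] A_RCOSETS_def' to_pres_def to_gc_surj[symmetric] by auto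

lemma to_pres_zero_iff:
  assumes "p \<in> carrier A"
  shows "to_pres p = \<zero>\<^bsub>A\<^sub>2\<^esub> \<longleftrightarrow> to_gc p \<in> rel_ideal d t"
proof -
  interpret ideal "rel_ideal d t" A\<^sub>1
    by (rule ideal_rel_ideal)
  have "to_gc p \<in> carrier A\<^sub>1"
    using assms to_gc_surj by blast
  then show ?thesis
    unfolding to_pres_def by (metis FactRing_def a_coset_join1 a_coset_join2 a_rcos_const
        a_rcos_self additive_subgroup_axioms a_subgroup ring_record_simps(11) ring.simps(1))
qed

text \<open>After a rearrangement the two close letters stand next to each other, and their product is zero.\<close>

lemma eval_close_word:
  assumes w: "set w \<subseteq> B" and close: "\<not> sorted_wrt (\<lambda>S T. \<not> close_in B S T) w"
  shows "eval_alg (single w c) = \<zero>"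
proof -
  obtain i j where ij: "i < j" "j < length w" "close_in B (w ! i) (w ! j)"
    using close unfolding sorted_wrt_iff_nth_less by blast
  define us where "us = take i w @ drop (Suc i) (take j w) @ drop (Suc j) w"
  have w_eq: "w = take i w @ w ! i # drop (Suc i) (take j w) @ w ! j # drop (Suc j) w"
  proof -
    have "w = take j w @ w ! j # drop (Suc j) w"
      using ij(2) by (simp add: id_take_nth_drop)
    moreover have "take j w = take i w @ w ! i # drop (Suc i) (take j w)"
      using ij id_take_nth_drop[of i "take j w"] by simp
    ultimately show ?thesis
      by (metis append.assoc append_Cons)
  qed
  have mset: "mset w = mset (w ! i # w ! j # us)"
    by (subst w_eq) (simp add: us_def)
  have sets: "w ! i \<in> B" "w ! j \<in> B" "set us \<subseteq> B"
    using mset_eq_setD[OF mset] w by auto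
  let ?w = "w ! i # w ! j # us"
  obtain e where e: "\<And>c :: 'k. single w c - single ?w (e * c) \<in> gc_ideal B card"
    using gc_permute[OF w mset] by blast
  have car: "single ?w (e * c) \<in> carrier A"
    using sets by (intro lists_monomial) auto
  have us: "us \<in> lists B" "?w \<in> lists B"
    using sets by auto
  have "eval_alg (single ?w (e * c)) = \<sigma> (e * c) \<otimes> (F (w ! i) \<otimes> F (w ! j) \<otimes> word_prod us)"
    using us sets by (simp add: eval_word F_B_closed word_prod_closed H.m_assoc)
  also have "\<dots> = \<zero>"
    using F_close[OF sets(1,2) ij(3)] word_prod_closed[OF us(1)] \<sigma>_closed by simp
  finally have "eval_alg ((single w c - single ?w (e * c)) +
      single ?w (e * c)) = \<zero>"
    using eval_add[OF eval_gc_ideal(1)[OF e[of c]] car] eval_gc_ideal(2)[OF e[of c]] by simp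
  then show ?thesis
    by simp
qed

text \<open>The image of the kernel of \<open>eval_alg\<close> in the free graded-commutative algebra is an ideal that contains
the defining relations, hence all of \<open>rel_ideal\<close>.\<close>

lemma eval_zero_if_to_pres_zero:
  assumes p: "p \<in> carrier A" "to_pres p = \<zero>\<^bsub>A\<^sub>2\<^esub>"
  shows "eval_alg p = \<zero>"
proof -
  let ?K = "{p \<in> carrier A. eval_alg p = \<zero>}"
  have "to_gc (single Ss 1) \<in> to_gc ` ?K"
    if "set Ss \<subseteq> B" "\<not> sorted_wrt (\<lambda>S T. \<not> close_in B S T) Ss" for Ss
    using that eval_close_word[OF that] by (intro imageI) auto
  then have "rel_gens \<subseteq> to_gc ` ?K"
    unfolding rel_gens_def by blast
  then have "rel_ideal d t \<subseteq> to_gc ` ?K"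
    unfolding rel_ideal_eq
    by (rule ring.genideal_minimal[OF ring_A\<^sub>1 ideal_image[OF to_gc_hom eval_kernel_ideal to_gc_surj]])
  then obtain p' where p': "p' \<in> carrier A" "eval_alg p' = \<zero>" "to_gc p = to_gc p'"
    using p to_pres_zero_iff by blast
  then have G: "p - p' \<in> gc_ideal B card"
    using to_gc_eq_iff p(1) by blast
  then have "eval_alg ((p - p') + p') = \<zero>"
    using eval_add[OF eval_gc_ideal(1)[OF G] p'(1)] eval_gc_ideal(2)[OF G] p'(2) by simp
  then show ?thesis
    by simp
qed


subsection \<open>Normal forms\<close>

lemma eval_eq_if_to_pres_eq:
  assumes "p \<in> carrier A" "q \<in> carrier A" "to_pres p = to_pres q"
  shows "eval_alg p = eval_alg q"
proof -
  interpret P: ring_hom_ring A A\<^sub>2 to_pres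
    by (rule to_pres_hom)
  have q: "- q \<in> carrier A"
    using P.R.a_inv_closed[OF assms(2)] free_alg_minus[OF assms(2)] by simp
  have "to_pres (p + - q) = \<zero>\<^bsub>A\<^sub>2\<^esub>"
    using P.hom_add[OF assms(1) q] P.hom_a_inv[OF assms(2)] free_alg_minus[OF assms(2)] assms
      P.hom_closed[OF assms(2)] by (simp add: P.S.r_neg)
  then have "eval_alg (p + - q) = \<zero>"
    using P.R.a_closed[OF assms(1) q] by (intro eval_zero_if_to_pres_zero) simp_all
  moreover have "p + - q \<in> carrier A"
    using P.R.a_closed[OF assms(1) q] by simp
  ultimately have "eval_alg ((p + - q) + q) = eval_alg q"
    using eval_add[of "p + - q" q] assms(2) eval_closed[OF assms(2)] by (simp del: free_alg_simps(1))
  then show ?thesis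
    by simp
qed

lemma to_pres_eq_if_gc:
  assumes "p - q \<in> gc_ideal B card" "p \<in> carrier A" "q \<in> carrier A"
  shows "to_pres p = to_pres q"
  using assms to_gc_eq_iff unfolding to_pres_def by metis

lemma to_pres_close_word:
  assumes w: "set w \<subseteq> B" and close: "\<not> sorted_wrt (\<lambda>S T. \<not> close_in B S T) w"
  shows "to_pres (single w c) = \<zero>\<^bsub>A\<^sub>2\<^esub>"
proof -
  interpret ideal "rel_ideal d t" A\<^sub>1
    by (rule ideal_rel_ideal)
  have car: "single w (1 :: 'k) \<in> carrier A" "single [] c \<in> carrier A"
    using w by (auto intro: lists_monomial simp del: free_alg_simps)
  have "to_gc (single w 1) \<in> rel_gens"
    using w close unfolding rel_gens_def by blast
  also have "rel_gens \<subseteq> rel_ideal d t"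
    unfolding rel_ideal_eq by (rule genideal_self[OF rel_gens_subset])
  finally have "to_gc (single w 1 * single [] c) \<in> rel_ideal d t"
    using car(2) to_gc_surj unfolding to_gc_mult[OF car] by (intro I_r_closed) blast+
  then have "to_gc (single w c) \<in> rel_ideal d t"
    by (simp add: mult_word)
  then show ?thesis
    using w by (subst to_pres_zero_iff) (auto intro: lists_monomial simp del: free_alg_simps)
qed

lemma to_pres_zero: "to_pres 0 = \<zero>\<^bsub>A\<^sub>2\<^esub>"
proof -
  interpret P: ring_hom_ring A A\<^sub>2 to_pres
    by (rule to_pres_hom)
  show ?thesis
    using P.hom_zero by simp
qed

lemma dpart_in_lists: "S \<subseteq> {1..t} \<Longrightarrow> dpart d S \<in> lists B"
  using dpart_subset_BB(1)[OF d] by blast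

lemma Union_subset: "w \<in> lists B \<Longrightarrow> \<Union> (set w) \<subseteq> {1..t}"
  using B_subset by blast

text \<open>The scalar is \<open>0\<close> for a word with two close letters and a sign otherwise. It is fixed to be \<open>1\<close> for a word
that is a \<open>d\<close>-partition itself, so that normal forms preserve the coefficients of single letters.\<close>

lemma word_normal_form:
  assumes w: "w \<in> lists B"
  obtains e where
    "\<And>c. to_pres (single w c) = to_pres (single (dpart d (\<Union> (set w))) (e * c))"
    "e \<noteq> 0 \<Longrightarrow> mset w = mset (dpart d (\<Union> (set w)))" "w = dpart d (\<Union> (set w)) \<Longrightarrow> e = 1"
proof -
  let ?V = "dpart d (\<Union> (set w))"
  have w': "set w \<subseteq> B"
    using w by blast
  consider "w = ?V" | "w \<noteq> ?V" "\<not> sorted_wrt (\<lambda>S T. \<not> close_in B S T) w"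
    | "w \<noteq> ?V" "sorted_wrt (\<lambda>S T. \<not> close_in B S T) w"
    by blast
  then show ?thesis
  proof cases
    case 1
    then show ?thesis
      by (intro that[of 1]) simp_all
  next
    case 2
    then show ?thesis
      using to_pres_close_word[OF w' 2(2)] by (intro that[of 0]) (simp_all add: to_pres_zero)
  next
    case 3
    have mset: "mset w = mset ?V"
      using mset_dpart_if_not_close[OF d w' 3(2)] by simp
    obtain e where "\<And>c :: 'k. single w c - single ?V (e * c) \<in> gc_ideal B card"
      using gc_permute[OF w' mset] by blast
    then have "to_pres (single w c) = to_pres (single ?V (e * c))" for c
      by (rule to_pres_eq_if_gc)
        (use w dpart_in_lists[OF Union_subset[OF w]] in \<open>auto intro: lists_monomial simp del: free_alg_simps\<close>)
    then show ?thesis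
      using that[of e] mset 3(1) by blast
  qed
qed

definition nf :: "(nat set \<Rightarrow> 'k) \<Rightarrow> nat set list \<Rightarrow>\<^sub>0 'k"
  where "nf c = (\<Sum>S\<in>Pow {1..t}. single (dpart d S) (c S))"

lemma nf_add: "nf (\<lambda>S. c S + c' S) = nf c + nf c'"
  by (simp add: nf_def single_add sum.distrib)

lemma nf_single:
  assumes "S \<subseteq> {1..t}"
  shows "nf (\<lambda>T. if T = S then a else 0) = single (dpart d S) a"
proof -
  have "nf (\<lambda>T. if T = S then a else 0) = (\<Sum>T\<in>Pow {1..t}. if T = S then single (dpart d S) a else 0)"
    unfolding nf_def by (rule sum.cong) auto
  then show ?thesis
    using assms by simp
qed

lemma nf_eval: "nf c \<in> carrier A \<and> eval_alg (nf c) = comb c"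
proof -
  interpret A: ring A
    by (rule ring_free_alg)
  have "(\<Sum>S\<in>\<S>. single (dpart d S) (c S)) \<in> carrier A \<and>
      eval_alg (\<Sum>S\<in>\<S>. single (dpart d S) (c S)) = (\<Oplus>S\<in>\<S>. \<sigma> (c S) \<otimes> F S)"
    if "finite \<S>" "\<S> \<subseteq> Pow {1..t}" for \<S>
    using that
  proof (induction \<S> rule: finite_induct)
    case empty
    then show ?case
      by (simp add: eval_alg_def)
  next
    case (insert S \<S>)
    then have S: "S \<subseteq> {1..t}"
      by blast
    have car: "single (dpart d S) (c S) \<in> carrier A"
      by (rule lists_monomial[OF dpart_in_lists[OF S]])
    have "(\<lambda>S. \<sigma> (c S) \<otimes> F S) \<in> \<S> \<rightarrow> carrier H"
      using insert.prems comb_terms[of c] by auto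
    then show ?case
      using insert S car A.a_closed[OF car] eval_add[OF car] eval_word[OF dpart_in_lists[OF S]]
        F_closed[OF S] \<sigma>_closed
      by (simp add: word_prod_dpart H.finsum_insert del: free_alg_simps(1))
  qed
  from this[of "Pow {1..t}"] show ?thesis
    by (simp add: nf_def comb_def)
qed

text \<open>Modulo the relations every element is a combination of \<open>d\<close>-partitions. A word of several letters never
contributes to a single letter, since rearranging preserves the number of letters; this is what makes the
generators irredundant.\<close>

lemma normal_form:
  assumes "p \<in> carrier A"
  shows "\<exists>c. to_pres p = to_pres (nf c) \<and> (\<forall>S\<in>B. c S = lookup p [S])"
  using assms
proof (induction p rule: free_alg_induct)
  case (word w a)
  let ?V = "\<Union> (set w)"
  obtain e where e: "\<And>c. to_pres (single w c) = to_pres (single (dpart d ?V) (e * c))"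
      "e \<noteq> 0 \<Longrightarrow> mset w = mset (dpart d ?V)" "w = dpart d ?V \<Longrightarrow> e = 1"
    using word_normal_form[OF word] by blast
  show ?case
  proof (intro exI[of _ "\<lambda>T. if T = ?V then e * a else 0"] conjI ballI)
    show "to_pres (single w a) = to_pres (nf (\<lambda>T. if T = ?V then e * a else 0))"
      unfolding nf_single[OF Union_subset[OF word]] by (rule e(1))
    fix S assume S: "S \<in> B"
    show "(if S = ?V then e * a else 0) = lookup (single w a) [S]"
    proof (cases "S = ?V")
      case True
      then have dp: "dpart d ?V = [S]"
        using dpart_BB[OF d S] by simp
      show ?thesis
      proof (cases "w = [S]")
        case False
        then have "e = 0"
          using e(2) dp by auto
        then show ?thesis
          using False by (simp add: lookup_single_not_eq)
      qed (use e(3) dp in simp)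
    next
      case False
      then have "w \<noteq> [S]"
        by auto
      then show ?thesis
        using False by (simp add: lookup_single_not_eq)
    qed
  qed
next
  case (add p q)
  interpret P: ring_hom_ring A A\<^sub>2 to_pres
    by (rule to_pres_hom)
  obtain c c' where c: "to_pres p = to_pres (nf c)" "\<forall>S\<in>B. c S = lookup p [S]"
      "to_pres q = to_pres (nf c')" "\<forall>S\<in>B. c' S = lookup q [S]"
    using add.IH by blast
  have "to_pres (p + q) = to_pres (nf c + nf c')"
    using P.hom_add[OF add.hyps] P.hom_add[of "nf c" "nf c'"] nf_eval c by simp
  then show ?case
    using c by (intro exI[of _ "\<lambda>S. c S + c' S"]) (simp add: nf_add lookup_add)
qed

text \<open>A combination of \<open>d\<close>-partitions is sent to the combination of basis elements with the same
coefficients, so it vanishes if its value does.\<close>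

lemma eval_zero_imp:
  assumes p: "p \<in> carrier A" "eval_alg p = \<zero>"
  shows "to_pres p = \<zero>\<^bsub>A\<^sub>2\<^esub>" "S \<in> B \<Longrightarrow> lookup p [S] = 0"
proof -
  obtain c where c: "to_pres p = to_pres (nf c)" "\<forall>S\<in>B. c S = lookup p [S]"
    using normal_form[OF p(1)] by blast
  have "comb c = \<zero>"
    using eval_eq_if_to_pres_eq[OF p(1) _ c(1)] nf_eval p(2) by simp
  then have zero: "c S = 0" if "S \<subseteq> {1..t}" for S
    using comb_eq_zero that by blast
  then have "nf c = 0"
    unfolding nf_def by (intro sum.neutral) simp
  then show "to_pres p = \<zero>\<^bsub>A\<^sub>2\<^esub>"
    using c(1) to_pres_zero by simp
  show "S \<in> B \<Longrightarrow> lookup p [S] = 0"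
    using c(2) zero B_subset by force
qed

lemma word_prod_normal_form:
  assumes w: "w \<in> lists B"
  obtains e where "word_prod w = \<sigma> e \<otimes> F (\<Union> (set w))" "e \<noteq> 0 \<Longrightarrow> mset w = mset (dpart d (\<Union> (set w)))"
proof -
  obtain e where e: "\<And>c. to_pres (single w c) = to_pres (single (dpart d (\<Union> (set w))) (e * c))"
      "e \<noteq> 0 \<Longrightarrow> mset w = mset (dpart d (\<Union> (set w)))" "w = dpart d (\<Union> (set w)) \<Longrightarrow> e = 1"
    using word_normal_form[OF w] by blast
  have V: "\<Union> (set w) \<subseteq> {1..t}"
    by (rule Union_subset[OF w])
  have "eval_alg (single w 1) = eval_alg (single (dpart d (\<Union> (set w))) (e * 1))"
    by (rule eval_eq_if_to_pres_eq[OF lists_monomial[OF w] lists_monomial[OF dpart_in_lists[OF V]] e(1)])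
  then have "word_prod w = \<sigma> e \<otimes> F (\<Union> (set w))"
    using word_prod_closed[OF w] by (simp add: eval_word w dpart_in_lists[OF V] word_prod_dpart[OF V] \<sigma>_one)
  then show ?thesis
    using that e(2) by blast
qed

theorem presentation:
  "\<exists>h \<in> ring_iso A\<^sub>2 H.
    (\<forall>c. h (rel_ideal d t +>\<^bsub>A\<^sub>1\<^esub> gc_scalar B card c) = \<sigma> c) \<and>
    (\<forall>S\<in>B. h (rel_ideal d t +>\<^bsub>A\<^sub>1\<^esub> gc_var B card S) = F S)"
proof -
  have surj: "eval_alg ` carrier A = carrier H"
  proof
    show "carrier H \<subseteq> eval_alg ` carrier A"
    proof
      fix h assume "h \<in> carrier H"
      then obtain c where "h = comb c"
        using comb_surj by blast
      then have "h = eval_alg (nf c)"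
        using nf_eval[of c] by simp
      then show "h \<in> eval_alg ` carrier A"
        using nf_eval by blast
    qed
  qed (use eval_closed in blast)
  obtain h where h: "h \<in> ring_iso A\<^sub>2 H" "\<And>p. p \<in> carrier A \<Longrightarrow> h (to_pres p) = eval_alg p"
    using ring_iso_from_common_kernel[OF to_pres_hom to_pres_surj eval_hom surj]
      eval_zero_if_to_pres_zero eval_zero_imp(1) by blast
  have "h (to_pres (single [] c)) = \<sigma> c" for c
    using h(2)[OF lists_monomial, of "[]" c] eval_word[of "[]" c] \<sigma>_closed by simp
  moreover have "h (to_pres (single [S] 1)) = F S" if "S \<in> B" for S
    using h(2)[OF lists_monomial, of "[S]" 1] eval_word[of "[S]" 1] that F_B_closed by (simp add: \<sigma>_one)
  ultimately show ?thesis
    using h(1) unfolding to_pres_def to_gc_def gc_scalar_def gc_var_def by blast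
qed

subsection \<open>Generators\<close>

theorem generators: "generate_ring H (range \<sigma> \<union> F ` B) = carrier H"
proof
  let ?G = "generate_ring H (range \<sigma> \<union> F ` B)"
  have sub: "range \<sigma> \<union> F ` B \<subseteq> carrier H"
    using \<sigma>_closed F_B_closed by blast
  show "?G \<subseteq> carrier H"
    by (rule H.generate_ring_incl[OF sub])
  have word: "word_prod w \<in> ?G" if "w \<in> lists B" for w
    using that by (induction w) (auto intro: generate_ring.intros)
  have term_in: "\<sigma> (c S) \<otimes> F S \<in> ?G" if "S \<subseteq> {1..t}" for c S
    using word[OF dpart_in_lists[OF that]] word_prod_dpart[OF that]
    by (auto intro!: generate_ring.eng_mult intro: generate_ring.incl)
  have "comb c \<in> ?G" for c
    unfolding comb_def
    by (rule H.finsum_in[OF _ H.zero_in_generate generate_ring.eng_add _ comb_terms]) (simp, assumption, assumption, rule term_in, simp)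
  then show "carrier H \<subseteq> ?G"
    using comb_surj by blast
qed

text \<open>If the generator \<open>S\<close> is omitted, all values of \<open>eval_alg\<close> that can be reached come from elements with
coefficient \<open>0\<close> at the one-letter word \<open>[S]\<close>; these elements form a subring. Since the kernel of
\<open>eval_alg\<close> has the same property, \<open>F S\<close> is not among these values.\<close>

theorem generators_minimal:
  assumes B': "B' \<subset> B"
  shows "generate_ring H (range \<sigma> \<union> F ` B') \<noteq> carrier H"
proof
  assume gen: "generate_ring H (range \<sigma> \<union> F ` B') = carrier H"
  obtain S where S: "S \<in> B" "S \<notin> B'"
    using B' by blast
  interpret E: ring_hom_ring A H eval_alg
    by (rule eval_hom)
  define M where "M = eval_alg ` {p \<in> carrier A. lookup p [S] = 0}"
  have lookup_mult: "lookup (p * q) [S] = 0"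
    if "lookup p [S] = 0" "lookup q [S] = 0" for p q :: "nat set list \<Rightarrow>\<^sub>0 'k"
  proof (rule ccontr)
    assume "lookup (p * q) [S] \<noteq> 0"
    then have "[S] \<in> keys (p * q)"
      by (simp add: in_keys_iff)
    then obtain u w where "[S] = u @ w" "u \<in> keys p" "w \<in> keys q"
      using keys_mult[of p q] by (auto simp: plus_list_def)
    then show False
      using that by (auto simp: Cons_eq_append_conv in_keys_iff)
  qed
  have "h \<in> M" if "h \<in> generate_ring H (range \<sigma> \<union> F ` B')" for h
    using that
  proof (induction h rule: generate_ring.induct)
    case one
    have "eval_alg (single [] 1) = \<one>"
      by (subst eval_word) (simp_all add: \<sigma>_one)
    then show ?case
      unfolding M_def by (intro image_eqI[of _ _ "single [] 1"])
        (auto simp: lookup_single_not_eq)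
  next
    case (incl h)
    then consider c where "h = \<sigma> c" | T where "T \<in> B'" "h = F T"
      by blast
    then show ?case
    proof cases
      case (1 c)
      then show ?thesis
        unfolding M_def using \<sigma>_closed[of c] eval_word[of "[]" c]
        by (intro image_eqI[of _ _ "single [] c"]) (auto simp: lookup_single_not_eq)
    next
      case (2 T)
      then have "T \<in> B" "T \<noteq> S"
        using B' S by blast+
      then show ?thesis
        unfolding M_def using 2 F_B_closed[of T] eval_word[of "[T]" 1]
        by (intro image_eqI[of _ _ "single [T] 1"]) (auto simp: lookup_single_not_eq \<sigma>_one)
    qed
  next
    case (a_inv h)
    then obtain p where p: "p \<in> carrier A" "lookup p [S] = 0" "h = eval_alg p"
      unfolding M_def by blast
    have "- p \<in> carrier A" "eval_alg (- p) = \<ominus> h"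
      using E.R.a_inv_closed[OF p(1)] E.hom_a_inv[OF p(1)] free_alg_minus[OF p(1)] p(3) by simp_all
    then show ?case
      unfolding M_def using p(2) by (intro image_eqI[of _ _ "- p"]) simp_all
  next
    case (eng_add h1 h2)
    then obtain p q where p: "p \<in> carrier A" "lookup p [S] = 0" "h1 = eval_alg p"
        and q: "q \<in> carrier A" "lookup q [S] = 0" "h2 = eval_alg q"
      unfolding M_def by blast
    then show ?case
      unfolding M_def using E.R.a_closed[OF p(1) q(1)] eval_add[OF p(1) q(1)]
      by (intro image_eqI[of _ _ "p + q"]) (simp_all add: lookup_add)
  next
    case (eng_mult h1 h2)
    then obtain p q where p: "p \<in> carrier A" "lookup p [S] = 0" "h1 = eval_alg p"
        and q: "q \<in> carrier A" "lookup q [S] = 0" "h2 = eval_alg q"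
      unfolding M_def by blast
    then show ?case
      unfolding M_def using E.R.m_closed[OF p(1) q(1)] eval_mult[OF p(1) q(1)]
      by (intro image_eqI[of _ _ "p * q"]) (simp_all add: lookup_mult)
  qed
  then have "F S \<in> M"
    using gen F_B_closed S(1) by blast
  then obtain p where p: "p \<in> carrier A" "lookup p [S] = 0" "F S = eval_alg p"
    unfolding M_def by blast
  let ?s = "single [S] (- 1 :: 'k)"
  have s: "?s \<in> carrier A"
    using S(1) by (intro lists_monomial) simp
  have "eval_alg (p + ?s) = F S \<oplus> \<ominus> F S"
    unfolding eval_add[OF p(1) s] p(3)[symmetric] using S(1) F_B_closed
    by (simp add: eval_word \<sigma>_minus \<sigma>_one H.l_minus)
  then have "eval_alg (p + ?s) = \<zero>"
    using F_B_closed[OF S(1)] by (simp add: H.r_neg)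
  moreover have "p + ?s \<in> carrier A"
    using E.R.a_closed[OF p(1) s] by simp
  ultimately have "lookup (p + ?s) [S] = 0"
    using eval_zero_imp(2) S(1) by blast
  then show False
    using p(2) by (simp add: lookup_add)
qed

subsection \<open>The bigrading\<close>

abbreviation "K \<equiv> range \<sigma>"

definition subspace :: "nat set set \<Rightarrow> 'h set"
  where "subspace \<S> = comb ` {c. \<forall>S. c S \<noteq> 0 \<longrightarrow> S \<in> \<S>}"

lemma subspaceI: "(\<And>S. c S \<noteq> 0 \<Longrightarrow> S \<in> \<S>) \<Longrightarrow> comb c \<in> subspace \<S>"
  unfolding subspace_def by blast

lemma subalgebra_subspace: "subalgebra K (subspace \<S>) H"
proof (rule subalgebra.intro)
  show "subgroup (subspace \<S>) (add_monoid H)"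
  proof (rule H.add.subgroupI)
    show "subspace \<S> \<subseteq> carrier H"
      using comb_closed by (auto simp: subspace_def)
    show "subspace \<S> \<noteq> {}"
      using subspaceI[of "\<lambda>_. 0"] by auto
    fix a assume "a \<in> subspace \<S>"
    then obtain c where c: "a = comb c" "\<forall>S. c S \<noteq> 0 \<longrightarrow> S \<in> \<S>"
      unfolding subspace_def by blast
    then show "\<ominus> a \<in> subspace \<S>"
      unfolding c(1) comb_minus[symmetric] by (intro subspaceI) simp
    fix b assume "b \<in> subspace \<S>"
    then obtain c' where c': "b = comb c'" "\<forall>S. c' S \<noteq> 0 \<longrightarrow> S \<in> \<S>"
      unfolding subspace_def by blast
    have "comb (\<lambda>S. c S + c' S) \<in> subspace \<S>"
      by (rule subspaceI) (use c(2) c'(2) in force)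
    then show "a \<oplus> b \<in> subspace \<S>"
      unfolding c(1) c'(1) comb_add .
  qed
  show "subalgebra_axioms K (subspace \<S>) H"
  proof
    fix k h assume "k \<in> K" "h \<in> subspace \<S>"
    then obtain a c where c: "k = \<sigma> a" "h = comb c" "\<forall>S. c S \<noteq> 0 \<longrightarrow> S \<in> \<S>"
      unfolding subspace_def by blast
    then show "k \<otimes> h \<in> subspace \<S>"
      unfolding c(1,2) comb_scale[symmetric] by (intro subspaceI) simp
  qed
qed

definition bidegree_sets :: "nat \<Rightarrow> nat \<Rightarrow> nat set set"
  where "bidegree_sets l p = {S. S \<subseteq> {1..t} \<and> length (dpart d S) = l \<and> card S = p}"

definition bidegree :: "nat \<Rightarrow> nat \<Rightarrow> 'h set"
  where "bidegree l p = lin_span H K {ring_prod H (map F Ss) | Ss.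
    set Ss \<subseteq> B \<and> length Ss = l \<and> sum_list (map card Ss) = p}"

lemma subspace_least:
  assumes V: "subalgebra K V H" and F: "\<And>S. S \<in> \<S> \<Longrightarrow> F S \<in> V" and \<S>: "\<S> \<subseteq> Pow {1..t}"
  shows "subspace \<S> \<subseteq> V"
proof
  interpret V: subalgebra K V H
    by (rule V)
  have zero: "\<zero> \<in> V"
    using V.one_closed by simp
  have add: "a \<oplus> b \<in> V" if "a \<in> V" "b \<in> V" for a b
    using V.m_closed[OF that] by simp
  fix h assume "h \<in> subspace \<S>"
  then obtain c where c: "h = comb c" "\<forall>S. c S \<noteq> 0 \<longrightarrow> S \<in> \<S>"
    unfolding subspace_def by blast
  have term_in: "\<sigma> (c S) \<otimes> F S \<in> V" if "S \<subseteq> {1..t}" for S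
  proof (cases "c S = 0")
    case True
    then show ?thesis
      using zero F_closed[OF that] by (simp add: \<sigma>_zero)
  next
    case False
    then show ?thesis
      using F c(2) by (intro V.smult_closed) auto
  qed
  show "h \<in> V"
    unfolding c(1) comb_def by (rule H.finsum_in[OF _ zero add _ comb_terms]) (simp, assumption, assumption, rule term_in, simp)
qed

lemma F_in_subspace: "S \<subseteq> {1..t} \<Longrightarrow> S \<in> \<S> \<Longrightarrow> F S \<in> subspace \<S>"
  unfolding F_eq_comb by (rule subspaceI) (auto split: if_splits)

text \<open>Each word of \<open>l\<close> letters of total size \<open>p\<close> is zero or, up to a sign, \<open>F S\<close>, where the word is a
rearrangement of the \<open>d\<close>-partition of \<open>S\<close>; so \<open>S\<close> has \<open>p\<close> elements and \<open>l\<close> blocks.\<close>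

lemma bidegree_eq_subspace: "bidegree l p = subspace (bidegree_sets l p)"
proof
  let ?W = "{ring_prod H (map F Ss) | Ss. set Ss \<subseteq> B \<and> length Ss = l \<and> sum_list (map card Ss) = p}"
  have "?W \<subseteq> subspace (bidegree_sets l p)"
  proof
    fix h assume "h \<in> ?W"
    then obtain w where w: "h = word_prod w" "set w \<subseteq> B" "length w = l" "sum_list (map card w) = p"
      unfolding word_prod_def by blast
    let ?V = "\<Union> (set w)"
    obtain e where e: "word_prod w = \<sigma> e \<otimes> F ?V" "e \<noteq> 0 \<Longrightarrow> mset w = mset (dpart d ?V)"
      using word_prod_normal_form[of w] w(2) by blast
    have V: "?V \<subseteq> {1..t}"
      using Union_subset[of w] w(2) by blast
    then have fin: "finite ?V"
      using finite_subset by blast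
    have "h = comb (\<lambda>T. if T = ?V then e else 0)"
      unfolding w(1) e(1) comb_single[OF V] ..
    moreover have "?V \<in> bidegree_sets l p" if "e \<noteq> 0"
    proof -
      have m: "mset w = mset (dpart d ?V)"
        by (rule e(2)[OF that])
      have "length (dpart d ?V) = l"
        using w(3) mset_eq_length[OF m] by simp
      moreover have "sum_list (map card (dpart d ?V)) = p"
        using w(4) m by (metis mset_map sum_mset_sum_list)
      ultimately show ?thesis
        using V card_eq_sum_dpart[OF d fin] by (simp add: bidegree_sets_def)
    qed
    ultimately show "h \<in> subspace (bidegree_sets l p)"
      by (auto intro!: subspaceI split: if_splits)
  qed
  then show "bidegree l p \<subseteq> subspace (bidegree_sets l p)"
    unfolding bidegree_def lin_span_def using subalgebra_subspace by blast
  show "subspace (bidegree_sets l p) \<subseteq> bidegree l p"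
    unfolding bidegree_def lin_span_def
  proof (rule Inter_greatest, elim CollectE conjE)
    fix V assume V: "subalgebra K V H" "?W \<subseteq> V"
    show "subspace (bidegree_sets l p) \<subseteq> V"
    proof (rule subspace_least[OF V(1)])
      fix S assume "S \<in> bidegree_sets l p"
      then have S: "S \<subseteq> {1..t}" "length (dpart d S) = l" "card S = p"
        by (simp_all add: bidegree_sets_def)
      then have "finite S"
        using finite_subset by blast
      then have "word_prod (dpart d S) \<in> ?W"
        unfolding word_prod_def using S dpart_subset_BB(1)[OF d S(1)] card_eq_sum_dpart[OF d] by blast
      then show "F S \<in> V"
        using V(2) word_prod_dpart[OF S(1)] by auto
    qed (auto simp: bidegree_sets_def)
  qed
qed

text \<open>It suffices to consider basis elements, one factor at a time: the elements whose product with the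
other factor has the right bidegree form a subspace.\<close>

lemma bidegree_mult_closed:
  assumes "a \<in> bidegree l p" "b \<in> bidegree l' p'"
  shows "a \<otimes> b \<in> bidegree (l + l') (p + p')"
proof -
  let ?V = "bidegree (l + l') (p + p')"
  have sub: "subalgebra K ?V H"
    unfolding bidegree_eq_subspace by (rule subalgebra_subspace)
  interpret V: subalgebra K ?V H
    by (rule sub)
  have zero: "\<zero> \<in> ?V"
    using V.one_closed by simp
  have add: "x \<oplus> y \<in> ?V" if "x \<in> ?V" "y \<in> ?V" for x y
    using V.m_closed[OF that] by simp
  have minus: "\<ominus> x \<in> ?V" if "x \<in> ?V" for x
    using V.m_inv_closed[OF that] by (simp add: a_inv_def)
  have basis: "F S \<otimes> F T \<in> ?V" if S: "S \<in> bidegree_sets l p" and T: "T \<in> bidegree_sets l' p'" for S T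
  proof -
    have S': "S \<subseteq> {1..t}" "finite S" and T': "T \<subseteq> {1..t}" "finite T"
      using S T finite_subset[of _ "{1..t}"] by (auto simp: bidegree_sets_def)
    let ?w = "dpart d S @ dpart d T"
    have "F S \<otimes> F T = word_prod ?w"
      using word_prod_append[OF dpart_in_lists[OF S'(1)] dpart_in_lists[OF T'(1)]]
      by (simp add: word_prod_dpart[OF S'(1)] word_prod_dpart[OF T'(1)])
    moreover have "set ?w \<subseteq> B" "length ?w = l + l'" "sum_list (map card ?w) = p + p'"
      using S T S' T' dpart_subset_BB(1)[OF d] card_eq_sum_dpart[OF d]
      by (auto simp: bidegree_sets_def)
    ultimately show ?thesis
      unfolding bidegree_def lin_span_def word_prod_def by blast
  qed
  have left: "F S \<otimes> b \<in> ?V" if S: "S \<in> bidegree_sets l p" for S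
  proof -
    have Fc: "F S \<in> carrier H"
      using S F_closed by (simp add: bidegree_sets_def)
    let ?U = "{x \<in> carrier H. F S \<otimes> x \<in> ?V}"
    have "subalgebra K ?U H"
    proof (rule subalgebra.intro)
      show "subgroup ?U (add_monoid H)"
        by (rule H.add.subgroupI) (use Fc zero add minus in \<open>auto simp: H.r_distr H.r_minus intro: exI[of _ \<zero>]\<close>)
      show "subalgebra_axioms K ?U H"
      proof
        fix k x assume "k \<in> K" and x: "x \<in> ?U"
        then obtain c where k: "k = \<sigma> c"
          by blast
        have "F S \<otimes> (\<sigma> c \<otimes> x) = \<sigma> c \<otimes> (F S \<otimes> x)"
          using Fc x \<sigma>_closed \<sigma>_central[OF Fc, of c] by (simp flip: H.m_assoc)
        then show "k \<otimes> x \<in> ?U"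
          using x k V.smult_closed[of k] \<sigma>_closed by simp
      qed
    qed
    then have "subspace (bidegree_sets l' p') \<subseteq> ?U"
      by (rule subspace_least) (use basis[OF S] F_closed in \<open>auto simp: bidegree_sets_def\<close>)
    then show ?thesis
      using assms(2) unfolding bidegree_eq_subspace by blast
  qed
  have b: "b \<in> carrier H"
    using assms(2) comb_closed unfolding bidegree_eq_subspace subspace_def by blast
  let ?U = "{x \<in> carrier H. x \<otimes> b \<in> ?V}"
  have "subalgebra K ?U H"
  proof (rule subalgebra.intro)
    show "subgroup ?U (add_monoid H)"
      by (rule H.add.subgroupI) (use b zero add minus in \<open>auto simp: H.l_distr H.l_minus intro: exI[of _ \<zero>]\<close>)
    show "subalgebra_axioms K ?U H"
    proof
      fix k x assume k: "k \<in> K" and x: "x \<in> ?U"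
      then show "k \<otimes> x \<in> ?U"
        using b V.smult_closed[OF k] \<sigma>_closed by (auto simp: H.m_assoc)
    qed
  qed
  then have "subspace (bidegree_sets l p) \<subseteq> ?U"
    by (rule subspace_least) (use left F_closed in \<open>auto simp: bidegree_sets_def\<close>)
  then show ?thesis
    using assms(1) unfolding bidegree_eq_subspace by blast
qed


definition bideg :: "nat set \<Rightarrow> nat \<times> nat"
  where "bideg S = (length (dpart d S), card S)"

lemma bidegree_sets_iff: "S \<in> bidegree_sets l p \<longleftrightarrow> S \<subseteq> {1..t} \<and> bideg S = (l, p)"
  by (simp add: bidegree_sets_def bideg_def)

lemma finsum_comb: "finite Q \<Longrightarrow> (\<Oplus>q\<in>Q. comb (f q)) = comb (\<lambda>S. \<Sum>q\<in>Q. f q S)"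
proof (induction Q rule: finite_induct)
  case (insert q Q)
  then show ?case
    using comb_closed by (simp add: H.finsum_insert Pi_def comb_add)
qed (simp add: comb_zero)

text \<open>The bidegrees of the subsets of \<open>{1..t}\<close> split the basis into disjoint parts, so the component of
bidegree \<open>q\<close> has to consist of the coordinates at the sets of bidegree \<open>q\<close>.\<close>

lemma bidegree_decomposition:
  assumes h: "h \<in> carrier H"
  shows "\<exists>!c. (\<forall>l p. c (l, p) \<in> bidegree l p) \<and> finite {q. c q \<noteq> \<zero>} \<and> h = finsum H c {q. c q \<noteq> \<zero>}"
proof -
  obtain a where a: "h = comb a"
    using comb_surj[OF h] by blast
  define part where "part = (\<lambda>q S. if S \<subseteq> {1..t} \<and> bideg S = q then a S else 0)"
  show ?thesis
  proof (rule ex1I[of _ "\<lambda>q. comb (part q)"], intro conjI allI)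
    show "comb (part (l, p)) \<in> bidegree l p" for l p
      unfolding bidegree_eq_subspace
      by (rule subspaceI) (auto simp: part_def bidegree_sets_iff split: if_splits)
    have "comb (part q) = \<zero>" if "q \<notin> bideg ` Pow {1..t}" for q
    proof -
      have "part q = (\<lambda>_. 0)"
        using that by (intro ext) (auto simp: part_def)
      then show ?thesis
        using comb_zero by simp
    qed
    then have "{q. comb (part q) \<noteq> \<zero>} \<subseteq> bideg ` Pow {1..t}"
      by blast
    then show fin: "finite {q. comb (part q) \<noteq> \<zero>}"
      by (rule finite_subset) simp
    have "a S = (\<Sum>q\<in>{q. comb (part q) \<noteq> \<zero>}. part q S)" if S: "S \<subseteq> {1..t}" for S
    proof -
      have "(\<Sum>q\<in>{q. comb (part q) \<noteq> \<zero>}. part q S) =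
          (\<Sum>q\<in>{q. comb (part q) \<noteq> \<zero>}. if q = bideg S then a S else 0)"
        using S by (intro sum.cong) (auto simp: part_def)
      also have "\<dots> = (if comb (part (bideg S)) \<noteq> \<zero> then a S else 0)"
        using fin by simp
      also have "\<dots> = a S"
        using comb_eq_zero[of "part (bideg S)" S] S by (auto simp: part_def)
      finally show ?thesis ..
    qed
    then show "h = finsum H (\<lambda>q. comb (part q)) {q. comb (part q) \<noteq> \<zero>}"
      unfolding a finsum_comb[OF fin] by (rule comb_cong)
  next
    fix c assume c: "(\<forall>l p. c (l, p) \<in> bidegree l p) \<and> finite {q. c q \<noteq> \<zero>} \<and> h = finsum H c {q. c q \<noteq> \<zero>}"
    have "\<exists>f. c q = comb f \<and> (\<forall>S. f S \<noteq> 0 \<longrightarrow> S \<subseteq> {1..t} \<and> bideg S = q)" for q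
    proof -
      obtain l p where q: "q = (l, p)"
        by (cases q)
      then have "c q \<in> bidegree l p"
        using c by blast
      then show ?thesis
        unfolding bidegree_eq_subspace subspace_def bidegree_sets_iff q by blast
    qed
    then obtain f where f: "\<And>q. c q = comb (f q)" "\<And>q S. f q S \<noteq> 0 \<Longrightarrow> S \<subseteq> {1..t} \<and> bideg S = q"
      by metis
    have fin: "finite {q. c q \<noteq> \<zero>}"
      using c by blast
    have "comb a = (\<Oplus>q\<in>{q. c q \<noteq> \<zero>}. comb (f q))"
      using c unfolding a[symmetric] by (simp flip: f(1))
    then have eq: "comb a = comb (\<lambda>S. \<Sum>q\<in>{q. c q \<noteq> \<zero>}. f q S)"
      unfolding finsum_comb[OF fin] .
    have a_eq: "a S = f (bideg S) S" if S: "S \<subseteq> {1..t}" for S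
    proof -
      have "a S = (\<Sum>q\<in>{q. c q \<noteq> \<zero>}. f q S)"
        by (rule comb_inj[OF eq S])
      also have "\<dots> = (\<Sum>q\<in>{q. c q \<noteq> \<zero>}. if q = bideg S then f (bideg S) S else 0)"
        by (rule sum.cong[OF refl]) (metis f(2))
      also have "\<dots> = (if c (bideg S) \<noteq> \<zero> then f (bideg S) S else 0)"
        using fin by simp
      also have "\<dots> = f (bideg S) S"
        using comb_eq_zero[of "f (bideg S)" S] S f(1) by auto
      finally show ?thesis .
    qed
    show "c = (\<lambda>q. comb (part q))"
    proof
      fix q
      have "f q S = part q S" if "S \<subseteq> {1..t}" for S
        using a_eq[OF that] f(2)[of q S] that by (auto simp: part_def)
      then show "c q = comb (part q)"
        unfolding f(1) by (rule comb_cong)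
    qed
  qed
qed

theorem bigraded: "bigraded_algebra H K bidegree"
  unfolding bigraded_algebra_def
proof (intro conjI allI ballI)
  show "subalgebra K (bidegree l p) H" for l p
    unfolding bidegree_eq_subspace by (rule subalgebra_subspace)
  have "F {} \<in> bidegree 0 0"
    unfolding bidegree_eq_subspace
    by (rule F_in_subspace) (simp_all add: bidegree_sets_def dpart_empty[OF d])
  then show "\<one> \<in> bidegree 0 0"
    by (simp add: F_empty)
  show "a \<otimes> b \<in> bidegree (l + l') (p + p')" if "a \<in> bidegree l p" "b \<in> bidegree l' p'" for l p l' p' a b
    using that by (rule bidegree_mult_closed)
qed (rule bidegree_decomposition)

lemma subfield_K: "subfield K H"
proof (rule H.subfieldI)
  show "subcring K H"
  proof (rule H.subcringI)
    show "subring K H"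
      by (rule H.subringI) (use \<sigma>_closed in \<open>auto simp flip: \<sigma>_one \<sigma>_minus \<sigma>_mult \<sigma>_add\<close>)
    show "h1 \<otimes> h2 = h2 \<otimes> h1" if "h1 \<in> K" "h2 \<in> K" for h1 h2
      using that \<sigma>_central \<sigma>_closed by blast
  qed
  have units: "\<sigma> a \<in> Units (H\<lparr>carrier := K\<rparr>) \<longleftrightarrow> a \<noteq> 0" for a
  proof
    assume "a \<noteq> 0"
    then have "\<sigma> (inverse a) \<otimes> \<sigma> a = \<one>" "\<sigma> a \<otimes> \<sigma> (inverse a) = \<one>"
      by (simp_all flip: \<sigma>_mult \<sigma>_one)
    then show "\<sigma> a \<in> Units (H\<lparr>carrier := K\<rparr>)"
      unfolding Units_def by auto
  next
    assume "\<sigma> a \<in> Units (H\<lparr>carrier := K\<rparr>)"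
    then obtain b where "\<sigma> (b * a) = \<sigma> 1"
      unfolding Units_def by (auto simp: \<sigma>_mult \<sigma>_one)
    then have "\<sigma> (b * a + - 1) = \<zero>"
      unfolding \<sigma>_add \<sigma>_minus by (simp add: H.r_neg \<sigma>_closed)
    then have "b * a + - 1 = 0"
      by (rule \<sigma>_eq_zero)
    then show "a \<noteq> 0"
      by auto
  qed
  have "Units (H\<lparr>carrier := K\<rparr>) \<subseteq> K"
    unfolding Units_def by auto
  moreover have "x \<in> Units (H\<lparr>carrier := K\<rparr>) \<longleftrightarrow> x \<noteq> \<zero>" if "x \<in> K" for x
    using that units \<sigma>_eq_zero \<sigma>_zero by (metis rangeE)
  ultimately show "Units (H\<lparr>carrier := K\<rparr>) = K - {\<zero>}"
    by blast
qed

text \<open>This is the inductive step in the library notion of dimension.\<close>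

lemma subspace_insert:
  assumes "S \<subseteq> {1..t}"
  shows "subspace (insert S \<S>) = H.line_extension K (F S) (subspace \<S>)"
proof
  show "subspace (insert S \<S>) \<subseteq> H.line_extension K (F S) (subspace \<S>)"
  proof
    fix h assume "h \<in> subspace (insert S \<S>)"
    then obtain c where c: "h = comb c" "\<forall>T. c T \<noteq> 0 \<longrightarrow> T \<in> insert S \<S>"
      unfolding subspace_def by blast
    define c' where "c' = (\<lambda>T. if T = S then 0 else c T)"
    have "comb c = comb (\<lambda>T. (if T = S then c S else 0) + c' T)"
      by (rule comb_cong) (simp add: c'_def)
    then have "h = \<sigma> (c S) \<otimes> F S \<oplus> comb c'"
      unfolding c(1) comb_add comb_single[OF assms] .
    moreover have "comb c' \<in> subspace \<S>"
      using c(2) by (intro subspaceI) (auto simp: c'_def split: if_splits)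
    ultimately show "h \<in> H.line_extension K (F S) (subspace \<S>)"
      unfolding H.line_extension_def set_add_def' r_coset_def by blast
  qed
  show "H.line_extension K (F S) (subspace \<S>) \<subseteq> subspace (insert S \<S>)"
  proof
    fix h assume "h \<in> H.line_extension K (F S) (subspace \<S>)"
    then obtain a c where c: "h = \<sigma> a \<otimes> F S \<oplus> comb c" "\<forall>T. c T \<noteq> 0 \<longrightarrow> T \<in> \<S>"
      unfolding H.line_extension_def set_add_def' r_coset_def subspace_def by blast
    have "h = comb (\<lambda>T. (if T = S then a else 0) + c T)"
      unfolding comb_add comb_single[OF assms] by (rule c)
    also have "\<dots> \<in> subspace (insert S \<S>)"
      using c(2) by (intro subspaceI) (auto split: if_splits)
    finally show "h \<in> subspace (insert S \<S>)" .
  qed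
qed

lemma dimension_subspace:
  assumes "\<S> \<subseteq> Pow {1..t}"
  shows "H.dimension (card \<S>) K (subspace \<S>)"
proof -
  have "finite \<S>"
    using assms finite_subset by blast
  then show ?thesis
    using assms
  proof (induction \<S> rule: finite_induct)
    case empty
    have "subspace {} = {\<zero>}"
      using comb_zero by (auto simp: subspace_def simp flip: fun_eq_iff)
    then show ?case
      by simp
  next
    case (insert S \<S>)
    then have S: "S \<subseteq> {1..t}"
      by blast
    have "F S \<notin> subspace \<S>"
    proof
      assume "F S \<in> subspace \<S>"
      then obtain c where c: "comb (\<lambda>T. if T = S then 1 else 0) = comb c" "\<forall>T. c T \<noteq> 0 \<longrightarrow> T \<in> \<S>"
        unfolding subspace_def F_eq_comb[OF S] by blast
      have "c S = 1"
        using comb_inj[OF c(1) S] by simp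
      then show False
        using c(2) insert.hyps(2) by auto
    qed
    then show ?case
      using insert F_closed[OF S] unfolding subspace_insert[OF S]
      by (simp add: H.Suc_dim)
  qed
qed

lemma dim_bidegree: "H.dim K (bidegree l p) = card (bidegree_sets l p)"
proof -
  have "H.dimension (card (bidegree_sets l p)) K (bidegree l p)"
    unfolding bidegree_eq_subspace by (rule dimension_subspace) (auto simp: bidegree_sets_def)
  then show ?thesis
    using H.dimI[OF subfield_K] by (simp add: over_def)
qed

lemma card_bidegree_sets:
  "card (bidegree_sets l p) =
    (\<Sum>ns\<in>{ns. (set ns \<subseteq> {1..t} \<and> length ns \<le> t) \<and> length ns = l \<and> sum_list ns = p}. weight_count d t ns)"
proof -
  let ?w = "\<lambda>S. map card (dpart d S)"
  let ?N = "{ns. (set ns \<subseteq> {1..t} \<and> length ns \<le> t) \<and> length ns = l \<and> sum_list ns = p}"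
  have "finite {ns. set ns \<subseteq> {1..t} \<and> length ns \<le> t}"
    by (rule finite_lists_length_le) simp
  then have fin: "finite ?N"
    by (rule rev_finite_subset) blast
  have weight: "length (?w S) = length (dpart d S)" "sum_list (?w S) = card S" if "S \<subseteq> {1..t}" for S
    using card_eq_sum_dpart[OF d, of S] finite_subset[OF that] by simp_all
  have image: "?w ` bidegree_sets l p \<subseteq> ?N"
  proof (rule image_subsetI)
    fix S assume "S \<in> bidegree_sets l p"
    then have S: "S \<subseteq> {1..t}" "length (dpart d S) = l" "card S = p"
      by (simp_all add: bidegree_sets_def)
    show "?w S \<in> ?N"
      using dpart_weight_bounds[OF d S(1)] weight[OF S(1)] S(2,3) by (simp del: set_map)
  qed
  have "bidegree_sets l p \<subseteq> Pow {1..t}"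
    by (auto simp: bidegree_sets_def)
  then have "finite (bidegree_sets l p)"
    by (rule finite_subset) simp
  then have "(\<Sum>ns\<in>?N. \<Sum>S\<in>{S \<in> bidegree_sets l p. ?w S = ns}. 1) = (\<Sum>S\<in>bidegree_sets l p. 1 :: nat)"
    by (rule sum.group[OF _ fin image])
  then have "card (bidegree_sets l p) = (\<Sum>ns\<in>?N. \<Sum>S\<in>{S \<in> bidegree_sets l p. ?w S = ns}. 1)"
    by simp
  also have "\<dots> = (\<Sum>ns\<in>?N. weight_count d t ns)"
  proof (rule sum.cong[OF refl])
    fix ns assume ns: "ns \<in> ?N"
    have "{S \<in> bidegree_sets l p. ?w S = ns} = {S. S \<subseteq> {1..t} \<and> ?w S = ns}"
      using ns weight by (auto simp: bidegree_sets_def)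
    then show "(\<Sum>S\<in>{S \<in> bidegree_sets l p. ?w S = ns}. 1) = weight_count d t ns"
      by (simp add: weight_count_eq[OF d])
  qed
  finally show ?thesis .
qed

theorem hilbert_series:
  "Hilb H K bidegree = (\<Sum>ns\<in>{ns. set ns \<subseteq> {1..t} \<and> length ns \<le> t}.
    of_nat (weight_count d t ns) * XX ^ length ns * YY ^ sum_list ns)"
proof (rule fps_ext, rule fps_ext)
  fix l p
  let ?N = "{ns. set ns \<subseteq> {1..t} \<and> length ns \<le> t}"
  have fin: "finite ?N"
    by (rule finite_lists_length_le) simp
  have coeff: "fps_nth (fps_nth (of_nat (weight_count d t ns) * XX ^ length ns * YY ^ sum_list ns) l) p =
      (if length ns = l \<and> sum_list ns = p then int (weight_count d t ns) else 0)" for ns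
  proof -
    have "of_nat (weight_count d t ns) * XX ^ length ns * YY ^ sum_list ns =
        fps_const (fps_const (int (weight_count d t ns))) * fps_X ^ length ns * fps_const (fps_X ^ sum_list ns)"
      by (simp add: XX_def YY_def fps_const_power flip: fps_of_nat)
    then show ?thesis
      by (simp add: fps_mult_right_const_nth fps_mult_left_const_nth fps_X_power_nth mult.assoc)
  qed
  have "fps_nth (fps_nth (Hilb H K bidegree) l) p = int (card (bidegree_sets l p))"
    by (simp add: Hilb_def dim_bidegree)
  also have "\<dots> = (\<Sum>ns\<in>?N. if length ns = l \<and> sum_list ns = p then int (weight_count d t ns) else 0)"
    unfolding card_bidegree_sets using fin
    by (simp add: sum.inter_filter[symmetric])
  also have "\<dots> = fps_nth (fps_nth (\<Sum>ns\<in>?N. of_nat (weight_count d t ns) * XX ^ length ns * YY ^ sum_list ns) l) p"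
    by (simp add: fps_sum_nth coeff)
  finally show "fps_nth (fps_nth (Hilb H K bidegree) l) p =
    fps_nth (fps_nth (\<Sum>ns\<in>?N. of_nat (weight_count d t ns) * XX ^ length ns * YY ^ sum_list ns) l) p" .
qed

end

section \<open>The Koszul homology of a monomial ring\<close>

context private_variables
begin

lemma hclass_simps:
  fixes z z' :: "'n set \<Rightarrow> ('n, 'k::field) mpoly"
  assumes "z \<in> cycles" "z' \<in> cycles"
  shows "hclass (emul z z') = hclass z \<otimes>\<^bsub>HK poly_ideal\<^esub> hclass z'"
    and "hclass (z + z') = hclass z \<oplus>\<^bsub>HK poly_ideal\<^esub> hclass z'"
    and "hclass z \<in> carrier (HK poly_ideal)"
  using assms ring_hom_memE(1)[OF hclass_hom, of z] ring_hom_memE(2)[OF hclass_hom, of z z']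
    ring_hom_memE(3)[OF hclass_hom, of z z'] by simp_all

lemma hclass_one: "hclass (ebasis {} 1) = \<one>\<^bsub>HK poly_ideal\<^esub>"
  using ring_hom_memE(4)[OF hclass_hom] by simp

lemma hclass_zero: "hclass 0 = \<zero>\<^bsub>HK poly_ideal :: ('n, 'k::field) koszul set ring\<^esub>"
proof -
  interpret ring_hom_ring cycle_ring "HK poly_ideal :: ('n, 'k) koszul set ring" hclass
    by (rule ring_hom_ringI2[OF ring_cycle_ring ring_HK hclass_hom])
  show ?thesis
    using hom_zero by simp
qed

lemma hclass_comb:
  fixes c :: "nat set \<Rightarrow> 'k::field"
  assumes "\<S> \<subseteq> Pow {1..t}"
  shows "(\<Sum>S\<in>\<S>. emul (ebasis {} (const_poly (c S))) (koszul_cycle S)) \<in> cycles \<and>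
    hclass (\<Sum>S\<in>\<S>. emul (ebasis {} (const_poly (c S))) (koszul_cycle S)) =
    (\<Oplus>\<^bsub>HK poly_ideal\<^esub>S\<in>\<S>. HK_scalar poly_ideal (c S) \<otimes>\<^bsub>HK poly_ideal\<^esub> HK_f poly_ideal m v S)"
proof -
  interpret H: ring "HK poly_ideal :: ('n, 'k) koszul set ring"
    by (rule ring_HK)
  have "finite \<S>"
    using assms finite_subset by blast
  then show ?thesis
    using assms
  proof (induction \<S> rule: finite_induct)
    case empty
    then show ?case
      by (simp add: hclass_zero cycles_zero flip: zero_fun_def)
  next
    case (insert S \<S>)
    have car: "emul (ebasis {} (const_poly (c T))) (koszul_cycle T) \<in> cycles" if "T \<subseteq> {1..t}" for T
      by (rule cycles_emul[OF ebasis_empty_in_cycles koszul_cycle_in_cycles[OF that]])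
    have eq: "hclass (emul (ebasis {} (const_poly (c T))) (koszul_cycle T)) =
        HK_scalar poly_ideal (c T) \<otimes>\<^bsub>HK poly_ideal\<^esub> HK_f poly_ideal m v T" if "T \<subseteq> {1..t}" for T
      using hclass_simps(1)[OF ebasis_empty_in_cycles koszul_cycle_in_cycles[OF that]]
      by (simp add: HK_scalar_eq HK_f_eq)
    have terms_closed: "(\<lambda>T. HK_scalar poly_ideal (c T) \<otimes>\<^bsub>HK poly_ideal\<^esub> HK_f poly_ideal m v T) \<in>
        insert S \<S> \<rightarrow> carrier (HK poly_ideal)"
    proof (rule Pi_I)
      fix T assume "T \<in> insert S \<S>"
      then have T: "T \<subseteq> {1..t}"
        using insert.prems by blast
      show "HK_scalar poly_ideal (c T) \<otimes>\<^bsub>HK poly_ideal\<^esub> HK_f poly_ideal m v T \<in> carrier (HK poly_ideal)"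
        unfolding eq[OF T, symmetric] by (rule hclass_simps(3)[OF car[OF T] car[OF T]])
    qed
    let ?f = "\<lambda>T. emul (ebasis {} (const_poly (c T))) (koszul_cycle T)"
    have S: "S \<subseteq> {1..t}" and IH: "(\<Sum>T\<in>\<S>. ?f T) \<in> cycles"
      "hclass (\<Sum>T\<in>\<S>. ?f T) =
        (\<Oplus>\<^bsub>HK poly_ideal\<^esub>T\<in>\<S>. HK_scalar poly_ideal (c T) \<otimes>\<^bsub>HK poly_ideal\<^esub> HK_f poly_ideal m v T)"
      using insert by blast+
    have "(\<Sum>T\<in>insert S \<S>. ?f T) = ?f S + (\<Sum>T\<in>\<S>. ?f T)"
      by (rule sum.insert[OF insert.hyps])
    moreover have "?f S + (\<Sum>T\<in>\<S>. ?f T) \<in> cycles"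
      by (rule cycles_add[OF car[OF S] IH(1)])
    moreover have "hclass (?f S + (\<Sum>T\<in>\<S>. ?f T)) =
        (\<Oplus>\<^bsub>HK poly_ideal\<^esub>T\<in>insert S \<S>. HK_scalar poly_ideal (c T) \<otimes>\<^bsub>HK poly_ideal\<^esub> HK_f poly_ideal m v T)"
      unfolding hclass_simps(2)[OF car[OF S] IH(1)] eq[OF S] IH(2)
      using terms_closed by (intro H.finsum_insert[symmetric] insert.hyps) auto
    ultimately show ?case
      by (simp only: simp_thms)
  qed
qed

text \<open>The elements \<open>HK_f poly_ideal m v S\<close> differ from the basis of \<open>taylor_cycle\<close>s by signs, which are absorbed
in the coordinates.\<close>

theorem koszul_homology:
  assumes d: "1 \<le> d"
    and near: "\<And>i j. i \<in> {1..t} \<Longrightarrow> j \<in> {1..t} \<Longrightarrow> i < j + d \<Longrightarrow> j < i + d \<Longrightarrow>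
      \<exists>y. 0 < expo (m i) y \<and> 0 < expo (m j) y"
    and far: "\<And>i j x. i \<in> {1..t} \<Longrightarrow> j \<in> {1..t} \<Longrightarrow> i + d \<le> j \<Longrightarrow> expo (m i) x = 0 \<or> expo (m j) x = 0"
  shows "taylor_homology (HK poly_ideal) (HK_scalar poly_ideal :: 'k::field \<Rightarrow> _) (HK_f poly_ideal m v) d t"
proof (intro taylor_homology.intro[OF ring_HK] taylor_homology_axioms.intro)
  let ?H = "HK poly_ideal :: ('n, 'k) koszul set ring"
  let ?s = "HK_scalar poly_ideal :: 'k \<Rightarrow> _" and ?F = "HK_f poly_ideal m v :: nat set \<Rightarrow> ('n, 'k) koszul set"
  show "1 \<le> d"
    by (rule d)
  have scalar: "ebasis {} (const_poly a) \<in> cycles" for a :: 'k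
    by (rule ebasis_empty_in_cycles)
  show "?s a \<in> carrier ?H" for a
    unfolding HK_scalar_eq by (rule hclass_simps(3)[OF scalar scalar])
  show "?s (a + b) = ?s a \<oplus>\<^bsub>?H\<^esub> ?s b" for a b
  proof -
    have "ebasis {} (const_poly (a + b)) =
        (ebasis {} (const_poly a) + ebasis {} (const_poly b) :: 'n set \<Rightarrow> ('n, 'k) mpoly)"
      by (simp add: ebasis_def const_poly_def single_add fun_eq_iff)
    then show ?thesis
      by (simp add: HK_scalar_eq hclass_simps(2)[OF scalar scalar])
  qed
  show "?s (a * b) = ?s a \<otimes>\<^bsub>?H\<^esub> ?s b" for a b
  proof -
    have "ebasis {} (const_poly (a * b)) =
        (emul (ebasis {} (const_poly a)) (ebasis {} (const_poly b)) :: 'n set \<Rightarrow> ('n, 'k) mpoly)"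
      by (simp add: emul_ebasis const_poly_def mult_single)
    then show ?thesis
      by (simp add: HK_scalar_eq hclass_simps(1)[OF scalar scalar])
  qed
  show "?s 1 = \<one>\<^bsub>?H\<^esub>"
    unfolding HK_scalar_eq hclass_one[symmetric] by (simp add: const_poly_def)
  show "?s a \<otimes>\<^bsub>?H\<^esub> h = h \<otimes>\<^bsub>?H\<^esub> ?s a" if h: "h \<in> carrier ?H" for h a
  proof -
    obtain z where z: "z \<in> cycles" "h = hclass z"
      using h unfolding carrier_HK by blast
    show ?thesis
      unfolding HK_scalar_eq z(2) hclass_simps(1)[OF scalar z(1), symmetric]
        hclass_simps(1)[OF z(1) scalar, symmetric]
      by (simp add: emul_ebasis_empty_left emul_ebasis_empty_right)
  qed
  show "?F S \<in> carrier ?H" if "S \<subseteq> {1..t}" for S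
    unfolding HK_f_eq by (rule hclass_simps(3)[OF koszul_cycle_in_cycles koszul_cycle_in_cycles]) (rule that)+
  show "?F {} = \<one>\<^bsub>?H\<^esub>"
    by (simp add: HK_f_eq koszul_cycle_empty hclass_one)
  have "\<forall>S\<in>Pow {1..t}. \<exists>e :: 'k. e * e = 1 \<and> koszul_cycle S = taylor_cycle S e"
    using koszul_cycle_eq_taylor_cycle by (metis PowD)
  then obtain e :: "nat set \<Rightarrow> 'k" where e: "\<And>S. S \<subseteq> {1..t} \<Longrightarrow> e S * e S = 1"
      "\<And>S. S \<subseteq> {1..t} \<Longrightarrow> koszul_cycle S = taylor_cycle S (e S)"
    by (metis PowI)
  have sum: "(\<Sum>S\<in>Pow {1..t}. emul (ebasis {} (const_poly (c S))) (koszul_cycle S)) =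
      (\<Sum>S\<in>Pow {1..t}. taylor_cycle S (c S * e S))" for c
    by (rule sum.cong) (simp_all add: e(2) scalar_taylor_cycle)
  show "\<exists>c. h = (\<Oplus>\<^bsub>?H\<^esub>S\<in>Pow {1..t}. ?s (c S) \<otimes>\<^bsub>?H\<^esub> ?F S)" if h: "h \<in> carrier ?H" for h
  proof -
    obtain z where z: "z \<in> cycles" "h = hclass z"
      using h unfolding carrier_HK by blast
    obtain c where c: "z - (\<Sum>S\<in>Pow {1..t}. taylor_cycle S (c S)) \<in> boundaries"
      using taylor_cycles_span[OF z(1)] by blast
    define c' where "c' = (\<lambda>S. c S * e S)"
    have "(\<Sum>S\<in>Pow {1..t}. taylor_cycle S (c' S * e S)) = (\<Sum>S\<in>Pow {1..t}. taylor_cycle S (c S))"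
      by (rule sum.cong) (simp_all add: c'_def mult.assoc e(1))
    then have "z - (\<Sum>S\<in>Pow {1..t}. emul (ebasis {} (const_poly (c' S))) (koszul_cycle S)) \<in> boundaries"
      using c unfolding sum by (simp only:)
    then have "hclass z = hclass (\<Sum>S\<in>Pow {1..t}. emul (ebasis {} (const_poly (c' S))) (koszul_cycle S))"
      using hclass_eq_iff[OF z(1) conjunct1[OF hclass_comb[OF subset_refl, of c']]] by blast
    also have "\<dots> = (\<Oplus>\<^bsub>?H\<^esub>S\<in>Pow {1..t}. ?s (c' S) \<otimes>\<^bsub>?H\<^esub> ?F S)"
      by (rule conjunct2[OF hclass_comb[OF subset_refl]])
    finally show ?thesis
      unfolding z(2) by blast
  qed
  show "c S = 0" if zero: "(\<Oplus>\<^bsub>?H\<^esub>S\<in>Pow {1..t}. ?s (c S) \<otimes>\<^bsub>?H\<^esub> ?F S) = \<zero>\<^bsub>?H\<^esub>" and S: "S \<subseteq> {1..t}" for c S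
  proof -
    let ?z = "\<Sum>S\<in>Pow {1..t}. emul (ebasis {} (const_poly (c S))) (koszul_cycle S)"
    have "?z \<in> cycles"
      by (rule conjunct1[OF hclass_comb[OF subset_refl]])
    moreover have "hclass ?z = hclass 0"
      unfolding conjunct2[OF hclass_comb[OF subset_refl]] zero hclass_zero ..
    ultimately have "?z - 0 \<in> boundaries"
      using hclass_eq_iff cycles_zero by blast
    then have "(\<Sum>S\<in>Pow {1..t}. taylor_cycle S (c S * e S)) \<in> boundaries"
      unfolding sum diff_zero .
    then have "c S * e S = 0"
      using taylor_cycles_independent[of "\<lambda>S. c S * e S"] S by blast
    then show ?thesis
      using e(1)[OF S] by auto
  qed
  show "?F S \<otimes>\<^bsub>?H\<^esub> ?F T = ?F (S \<union> T)"
    if S: "S \<subseteq> {1..t}" and T: "T \<subseteq> {1..t}" and sep: "\<And>i j. i \<in> S \<Longrightarrow> j \<in> T \<Longrightarrow> i + d \<le> j" for S T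
  proof -
    have "emul (koszul_cycle S) (koszul_cycle T) = (koszul_cycle (S \<union> T) :: 'n set \<Rightarrow> ('n, 'k) mpoly)"
    proof (rule koszul_cycle_concat[OF S T])
      fix i j assume ij: "i \<in> S" "j \<in> T"
      then show "i < j"
        using sep[OF ij] d by linarith
      show "expo (m i) x = 0 \<or> expo (m j) x = 0" for x
        by (rule far) (use ij S T sep in auto)
    qed
    then show ?thesis
      unfolding HK_f_eq hclass_simps(1)[OF koszul_cycle_in_cycles[OF S] koszul_cycle_in_cycles[OF T], symmetric]
      by simp
  qed
  show "?F S \<otimes>\<^bsub>?H\<^esub> ?F T = \<zero>\<^bsub>?H\<^esub>" if S: "S \<in> BB d t" and T: "T \<in> BB d t" and close: "close_in (BB d t) S T" for S T
  proof -
    have sub: "S \<subseteq> {1..t}" "T \<subseteq> {1..t}"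
      using S T by (simp_all add: BB_def)
    obtain i j where ij: "i \<in> S" "j \<in> T" "i < j + d" "j < i + d"
      using BB_close_pair[OF d S T] close unfolding close_in_def by blast
    then obtain y where "0 < expo (m i) y" "0 < expo (m j) y"
      using near sub by blast
    then have "emul (koszul_cycle S) (koszul_cycle T) \<in> (boundaries :: ('n set \<Rightarrow> ('n, 'k) mpoly) set)"
      using koszul_cycle_product_boundary[OF sub ij(1,2)] by blast
    moreover have "emul (koszul_cycle S) (koszul_cycle T) \<in> (cycles :: ('n set \<Rightarrow> ('n, 'k) mpoly) set)"
      by (intro cycles_emul koszul_cycle_in_cycles sub)
    ultimately have "hclass (emul (koszul_cycle S) (koszul_cycle T)) = (hclass 0 :: ('n, 'k) koszul set)"
      by (subst hclass_eq_iff) (simp_all add: cycles_zero)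
    then have "hclass (emul (koszul_cycle S) (koszul_cycle T)) = \<zero>\<^bsub>?H\<^esub>"
      unfolding hclass_zero .
    then show ?thesis
      unfolding HK_f_eq
        hclass_simps(1)[OF koszul_cycle_in_cycles[OF sub(1)] koszul_cycle_in_cycles[OF sub(2)], symmetric] .
  qed
  show "?F S \<otimes>\<^bsub>?H\<^esub> ?F T = ?s ((- 1) ^ (card S * card T)) \<otimes>\<^bsub>?H\<^esub> (?F T \<otimes>\<^bsub>?H\<^esub> ?F S)"
    if "S \<in> BB d t" "T \<in> BB d t" for S T
  proof -
    have S: "S \<subseteq> {1..t}" and T: "T \<subseteq> {1..t}"
      using that by (simp_all add: BB_def)
    note cyc = koszul_cycle_in_cycles[OF S] koszul_cycle_in_cycles[OF T]
    show ?thesis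
      unfolding HK_f_eq HK_scalar_eq hclass_simps(1)[OF cyc(2,1), symmetric]
        hclass_simps(1)[OF cyc, symmetric] hclass_simps(1)[OF scalar cycles_emul[OF cyc(2,1)], symmetric]
      by (subst koszul_cycle_commute[OF S T]) (rule refl)
  qed
qed

end

section \<open>Common divisors of the generators\<close>

lemma mono_gcd_window_imp_common_variable:
  assumes d: "1 \<le> d" "d \<le> t"
    and window: "\<And>i. 1 \<le> i \<Longrightarrow> i + d - 1 \<le> t \<Longrightarrow> mono_gcd m {i..i + d - 1} \<noteq> 0"
    and ij: "i \<in> {1..t}" "j \<in> {1..t}" "i < j + d" "j < i + d"
  shows "\<exists>y. 0 < expo (m i) y \<and> 0 < expo (m j) y"
proof -
  \<comment> \<open>A window of \<open>d\<close> indices starting at the smaller one contains both; it is moved to the left if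
    it would exceed \<open>t\<close>.\<close>
  define s where "s = min (min i j) (t + 1 - d)"
  have "1 \<le> s" "s + d - 1 \<le> t"
    using d ij by (auto simp: s_def)
  then have "mono_gcd m {s..s + d - 1} \<noteq> 0"
    by (rule window)
  then obtain y where "expo (mono_gcd m {s..s + d - 1}) y \<noteq> 0"
    by (metis lookup_zero mono_eqI)
  then have y: "0 < Min ((\<lambda>k. expo (m k) y) ` {s..s + d - 1})"
    by simp
  have "0 < expo (m k) y" if "k \<in> {s..s + d - 1}" for k
  proof -
    have "Min ((\<lambda>k. expo (m k) y) ` {s..s + d - 1}) \<le> expo (m k) y"
      using that by (intro Min_le) auto
    then show ?thesis
      using y by linarith
  qed
  moreover have "i \<in> {s..s + d - 1}" "j \<in> {s..s + d - 1}"
    using d ij by (auto simp: s_def)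
  ultimately show ?thesis
    by blast
qed

lemma mono_gcd_pair_zero_imp_coprime:
  assumes "mono_gcd m {i, j} = 0"
  shows "expo (m i) x = 0 \<or> expo (m j) x = 0"
proof -
  have "expo (mono_gcd m {i, j}) x = 0"
    using assms by simp
  then have "min (expo (m i) x) (expo (m j) x) = 0"
    by simp
  then show ?thesis
    by (simp add: min_def split: if_splits)
qed

theorem theorem3p3:
  fixes I :: "('n::{finite,linorder}, 'k::field) mpoly set"
    and m :: "nat \<Rightarrow> 'n mono" and v :: "nat \<Rightarrow> 'n" and d t :: nat
  assumes d: "1 \<le> d" "d \<le> t"
    and monomial: "monomial_ideal I"
    and gens: "inj_on m {1..t}" "min_mono_gens I (m ` {1..t})"
    and minimal: "taylor_minimal TYPE('k) m t"
    and gcd_window: "\<And>i. 1 \<le> i \<Longrightarrow> i + d - 1 \<le> t \<Longrightarrow> mono_gcd m {i..i + d - 1} \<noteq> 0"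
    and gcd_far: "\<And>i j. i \<in> {1..t - d} \<Longrightarrow> i + d + j \<le> t \<Longrightarrow> mono_gcd m {i, i + d + j} = 0"
    and v_pos: "\<And>i. i \<in> {1..t} \<Longrightarrow> 0 < Poly_Mapping.lookup (m i) (v i)"
    and v_max: "\<And>i j. i \<in> {1..t} \<Longrightarrow> j \<in> {1..t} \<Longrightarrow> j \<noteq> i \<Longrightarrow>
      Poly_Mapping.lookup (m j) (v i) < Poly_Mapping.lookup (m i) (v i)"
  shows
    "(generate_ring (HK I) (range (HK_scalar I) \<union> HK_f I m v ` BB d t) = carrier (HK I) \<and>
      (\<forall>B' \<subset> BB d t.
         generate_ring (HK I) (range (HK_scalar I) \<union> HK_f I m v ` B') \<noteq> carrier (HK I)))
     \<and>
     (\<exists>h \<in> ring_iso (free_gc_alg (BB d t) card Quot rel_ideal d t) (HK I).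
        (\<forall>c :: 'k. h (rel_ideal d t +>\<^bsub>free_gc_alg (BB d t) card\<^esub> gc_scalar (BB d t) card c)
           = HK_scalar I c) \<and>
        (\<forall>S \<in> BB d t. h (rel_ideal d t +>\<^bsub>free_gc_alg (BB d t) card\<^esub> gc_var (BB d t) card S)
           = HK_f I m v S))
     \<and>
     (\<forall>S. S \<noteq> {} \<and> S \<subseteq> {1..t} \<longrightarrow>
        (\<exists>P. partition_on S P \<and> P \<subseteq> BB d t \<and> (\<forall>T\<in>P. \<forall>U\<in>P. T \<noteq> U \<longrightarrow> T \<union> U \<notin> BB d t)))
     \<and>
     bigraded_algebra (HK I) (range (HK_scalar I)) (HK_bidegree I m v d t)
     \<and>
     Hilb (HK I) (range (HK_scalar I)) (HK_bidegree I m v d t) =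
       (\<Sum>ns \<in> {ns. set ns \<subseteq> {1..t} \<and> length ns \<le> t}.
          of_nat (weight_count d t ns) * XX ^ length ns * YY ^ sum_list ns)"
proof -
  interpret private_variables m v t
    by unfold_locales (use v_pos v_max in auto)
  have I: "I = poly_ideal"
    using gens(2) Idl_monomials unfolding min_mono_gens_def by blast
  interpret taylor_homology "HK I" "HK_scalar I :: 'k \<Rightarrow> _" "HK_f I m v" d t
    unfolding I
  proof (rule koszul_homology[OF d(1)])
    show "\<exists>y. 0 < expo (m i) y \<and> 0 < expo (m j) y"
      if "i \<in> {1..t}" "j \<in> {1..t}" "i < j + d" "j < i + d" for i j
      by (rule mono_gcd_window_imp_common_variable[OF d gcd_window that])
    show "expo (m i) x = 0 \<or> expo (m j) x = 0" if "i \<in> {1..t}" "j \<in> {1..t}" "i + d \<le> j" for i j x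
    proof (rule mono_gcd_pair_zero_imp_coprime)
      have "i \<in> {1..t - d}" "i + d + (j - (i + d)) \<le> t" "i + d + (j - (i + d)) = j"
        using that by auto
      then show "mono_gcd m {i, j} = 0"
        using gcd_far[of i "j - (i + d)"] by simp
    qed
  qed
  have "HK_bidegree I m v d t = bidegree"
    by (simp add: HK_bidegree_def bidegree_def fun_eq_iff)
  then show ?thesis
    using generators generators_minimal presentation ex_partition_not_close[OF d(1)] bigraded hilbert_series
    by simp
qed

end
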